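(* Consider the original Bregman iteration with iterates $u_k\in W^{1,1}(\Omega;\Gamma)$ and subgradients $p_k$, and the lifted Bregman iteration with iterates $v_k\in C$ and subgradients $\tilde p_k$, both for $J=\mathrm{TV}$ and as defined in the context. Assume that the minimization problems $$\min_{u}\ \{H(u)+\mathrm{TV}(u)-\langle p_{k-1},u\rangle\}$$ in the original Bregman iteration have unique solutions $u_k$. Moreover, assume that the solutions $v_k$ of the minimization problems $$\min_{v\in C}\ \{\mathcal{H}(v)+\mathcal{TV}(v)-\langle \tilde p_{k-1},v\rangle\}$$ in the lifted iteration are integral, i.e., $v_k=1_u$ is the indicator function of the subgraph of some $u\in W^{1,1}(\Omega;\Gamma)$. If the chosen subgradients $p_{k-1}\in\partial\mathrm{TV}(u_{k-1})$ and $\tilde p_{k-1}\in\partial\mathcal{TV}(v_{k-1})$ satisfy $$\tilde p_{k-1}(\cdot,t)=p_{k-1}(\cdot)\qquad\text{for a.e. } t\in\Gamma,$$ then the iterates $v_k$ of the lifted Bregman iteration are the indicator functions of the subgraphs of the iterates $u_k$ of the original Bregman iteration, i.e., $v_k=1_{u_k}$.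
   Context: Setting: $\Omega\subset\mathbb{R}^2$ (so $d=2$) is open and bounded, $\Gamma\subset\mathbb{R}$ is a compact interval, $\rho:\Omega\times\Gamma\to\overline{\mathbb{R}}=\mathbb{R}\cup\{\pm\infty\}$ is proper and non-negative, and $H(u)=\int_\Omega\rho(x,u(x))\,dx$. The total variation is $$\mathrm{TV}(u)=\sup\Big\{\int_\Omega \langle u,-\operatorname{div}\psi\rangle\,dx : \psi\in C_c^\infty(\Omega;\mathbb{R}^d),\ \|\psi(x)\|_2\le 1\Big\}.$$ Functions $u$ are taken in $W^{1,1}(\Omega;\Gamma)\subset L^2(\Omega)$, and all subgradients are assumed to be representable by $L^2$ functions: $p_k\in L^2(\Omega)$, $\tilde p_k\in L^2(\Omega\times\Gamma)$. Here $\partial$ denotes the convex subdifferential and the pairings are $\langle p,u\rangle=\int_\Omega p\,u\,dx$ and $\langle\tilde p,v\rangle=\int_{\Omega\times\Gamma}\tilde p\,v\,d(x,t)$. Original Bregman iteration (defined for convex non-negative $H$): $p_0=0$ and, for $k=1,2,\dots$, $u_k\in\arg\min_u\{H(u)+\mathrm{TV}(u)-\langle p_{k-1},u\rangle\}$, $p_k\in\partial\mathrm{TV}(u_k)$. Lifting: for $u:\Omega\to\Gamma$, the indicator function of its subgraph is $1_u(x,z)=1$ if $u(x)>z$ and $1_u(x,z)=0$ otherwise, for $(x,z)\in\Omega\times\mathbb{R}$. The relaxed feasible set is $$C=\{v\in \mathrm{BV}_{\mathrm{loc}}(\Omega\times\mathbb{R};[0,1]) : v(\cdot,t)=1 \text{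 for a.e. } t\le\min\Gamma,\ v(\cdot,t)=0\text{ for a.e. } t>\max\Gamma\}.$$ With $Dv=((Dv)_x,(Dv)_t)$ the distributional derivative (a Radon measure), the lifted energy is $$\mathcal{F}(v)=\sup_{\phi_x\in\mathcal{K}_x,\ \phi_t\in\mathcal{K}_t}\int_{\Omega\times\Gamma}\langle(\phi_x,\phi_t),Dv\rangle=\mathcal{H}(v)+\mathcal{TV}(v),$$ $$\mathcal{K}_x=\{\phi_x\in C_0(\Omega\times\mathbb{R};\mathbb{R}^d):\|\phi_x(x,t)\|_2\le 1\ \text{for all }(x,t)\},$$ $$\mathcal{K}_t=\{\phi_t\in C_0(\Omega\times\mathbb{R};\mathbb{R}):-\phi_t(x,t)\le\rho(x,t)\ \text{for all }(x,t)\in\Omega\times\Gamma\},$$ where $\mathcal{TV}(v)=\sup_{\phi_x\in\mathcal{K}_x}\int_{\Omega\times\Gamma}\langle\phi_x,(Dv)_x\rangle$ and $\mathcal{H}(v)=\sup_{\phi_t\in\mathcal{K}_t}\int_{\Omega\times\Gamma}\phi_t\,(Dv)_t$. Lifted Bregman iteration: $\tilde p_0=0$ and, for $k=1,2,\dots$, $v_k\in\arg\min_{v\in C}\{\mathcal{H}(v)+\mathcal{TV}(v)-\langle\tilde p_{k-1},v\rangle\}$, $\tilde p_k\in\partial\mathcal{TV}(v_k)$.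
   Formalization: The formal theorem additionally assumes that ρ is jointly lower semicontinuous on Ω×Γ; without this the claim fails, e.g. for ρ = 0 when x lies in a countable dense set and ρ = (t−1/2)² otherwise. *)

theory Defs
  imports "HOL-Analysis.Analysis"
begin

fun C_k :: "nat \<Rightarrow> ('a::euclidean_space \<Rightarrow> 'b::real_normed_vector) \<Rightarrow> bool" where
  "C_k 0 f \<longleftrightarrow> continuous_on UNIV f"
| "C_k (Suc n) f \<longleftrightarrow> (\<forall>x. f differentiable (at x)) \<and>
     (\<forall>h. C_k n (\<lambda>x. frechet_derivative f (at x) h))"

(* Functions in C_c^\<infinity>(U) are represented by their extension by zero to the whole space. *)
definition test_functions ::
    "'a::euclidean_space set \<Rightarrow> ('a \<Rightarrow> 'b::real_normed_vector) set" where
  "test_functions U =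
     {\<psi>. (\<forall>n. C_k n \<psi>) \<and> (\<exists>K. compact K \<and> K \<subseteq> U \<and> (\<forall>x. x \<notin> K \<longrightarrow> \<psi> x = 0))}"

definition divergence :: "('a::euclidean_space \<Rightarrow> 'a) \<Rightarrow> 'a \<Rightarrow> real" where
  "divergence \<psi> x = (\<Sum>i\<in>Basis. frechet_derivative \<psi> (at x) i \<bullet> i)"

(* Continuous functions on U vanishing at infinity, i.e. the sup-norm closure of C_c(U). *)
definition C_0 :: "'a::topological_space set \<Rightarrow> ('a \<Rightarrow> 'b::real_normed_vector) set" where
  "C_0 U = {\<phi>. continuous_on U \<phi> \<and> (\<forall>e>0. compact {x \<in> U. e \<le> norm (\<phi> x)})}"

(* Elements of the spaces below are representatives; equality is meant almost everywhere. *)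

definition L2_space :: "'a measure \<Rightarrow> ('a \<Rightarrow> real) set" where
  "L2_space M = {f. f \<in> borel_measurable M \<and> integrable M (\<lambda>x. (f x)\<^sup>2)}"

definition pairing :: "'a measure \<Rightarrow> ('a \<Rightarrow> real) \<Rightarrow> ('a \<Rightarrow> real) \<Rightarrow> real" where
  "pairing M p u = (\<integral>x. p x * u x \<partial>M)"

definition weak_gradient ::
    "'a::euclidean_space set \<Rightarrow> ('a \<Rightarrow> real) \<Rightarrow> ('a \<Rightarrow> 'a) \<Rightarrow> bool" where
  "weak_gradient \<Omega> u g \<longleftrightarrow>
     (\<forall>\<phi>\<in>test_functions \<Omega>. \<forall>i\<in>Basis.
        (\<integral>x. u x * frechet_derivative \<phi> (at x) i \<partial>lebesgue_on \<Omega>)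
          = - (\<integral>x. (g x \<bullet> i) * \<phi> x \<partial>lebesgue_on \<Omega>))"

definition W11 :: "'a::euclidean_space set \<Rightarrow> real set \<Rightarrow> ('a \<Rightarrow> real) set" where
  "W11 \<Omega> \<Gamma> = {u. integrable (lebesgue_on \<Omega>) u \<and>
     (AE x in lebesgue_on \<Omega>. u x \<in> \<Gamma>) \<and>
     (\<exists>g. integrable (lebesgue_on \<Omega>) g \<and> weak_gradient \<Omega> u g)}"

(* The distributional derivative as a vector-valued Radon measure, given by its polar
   decomposition Dv = \<sigma> \<mu> with \<mu> = |Dv| a locally finite Borel measure on U and |\<sigma>| = 1.
   Such a pair is unique up to changing \<sigma> on a \<mu>-null set. *)
definition is_derivative_measure ::
    "'a::euclidean_space set \<Rightarrow> ('a \<Rightarrow> real) \<Rightarrow> 'a measure \<Rightarrow> ('a \<Rightarrow> 'a) \<Rightarrow> bool" where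
  "is_derivative_measure U v \<mu> \<sigma> \<longleftrightarrow>
     sets \<mu> = sets borel \<and> emeasure \<mu> (- U) = 0 \<and>
     (\<forall>K. compact K \<and> K \<subseteq> U \<longrightarrow> emeasure \<mu> K < \<infinity>) \<and>
     \<sigma> \<in> borel_measurable borel \<and> (AE z in \<mu>. norm (\<sigma> z) = 1) \<and>
     (\<forall>\<psi>\<in>test_functions U.
        (\<integral>z. v z * divergence \<psi> z \<partial>lebesgue_on U) = - (\<integral>z. \<psi> z \<bullet> \<sigma> z \<partial>\<mu>))"

definition dist_derivative ::
    "'a::euclidean_space set \<Rightarrow> ('a \<Rightarrow> real) \<Rightarrow> 'a measure \<times> ('a \<Rightarrow> 'a)" where
  "dist_derivative U v = (SOME d. is_derivative_measure U v (fst d) (snd d))"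

definition BV_loc :: "'a::euclidean_space set \<Rightarrow> ('a \<Rightarrow> real) set" where
  "BV_loc U = {v. v \<in> borel_measurable (lebesgue_on U) \<and>
     (\<forall>K. compact K \<and> K \<subseteq> U \<longrightarrow> integrable (lebesgue_on K) v) \<and>
     (\<exists>\<mu> \<sigma>. is_derivative_measure U v \<mu> \<sigma>)}"

definition lsc_on :: "'a::topological_space set \<Rightarrow> ('a \<Rightarrow> ereal) \<Rightarrow> bool" where
  "lsc_on S f \<longleftrightarrow> (\<forall>c. closedin (top_of_set S) {x \<in> S. f x \<le> c})"

definition convex_functional_on :: "('a \<Rightarrow> real) set \<Rightarrow> (('a \<Rightarrow> real) \<Rightarrow> ereal) \<Rightarrow> bool" where
  "convex_functional_on S E \<longleftrightarrow>
     (\<forall>u\<in>S. \<forall>w\<in>S. \<forall>c::real. 0 < c \<longrightarrow> c < 1 \<longrightarrow>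
        E (\<lambda>x. (1 - c) * u x + c * w x) \<le> ereal (1 - c) * E u + ereal c * E w)"

(* Subgradients of J at u representable by functions in L^2(M); X is the domain on which J
   is considered (J = \<infinity> elsewhere). *)
definition subdifferential ::
    "'a measure \<Rightarrow> ('a \<Rightarrow> real) set \<Rightarrow> (('a \<Rightarrow> real) \<Rightarrow> ereal) \<Rightarrow> ('a \<Rightarrow> real) \<Rightarrow> ('a \<Rightarrow> real) set" where
  "subdifferential M X J u = {p \<in> L2_space M. u \<in> X \<and> \<bar>J u\<bar> \<noteq> \<infinity> \<and>
     (\<forall>w\<in>X. J u + ereal (pairing M p (\<lambda>x. w x - u x)) \<le> J w)}"

definition data_term ::
    "'a::euclidean_space set \<Rightarrow> ('a \<times> real \<Rightarrow> ereal) \<Rightarrow> ('a \<Rightarrow> real) \<Rightarrow> ereal" where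
  "data_term \<Omega> \<rho> u = enn2ereal (\<integral>\<^sup>+x. e2ennreal (\<rho> (x, u x)) \<partial>lebesgue_on \<Omega>)"

definition TV :: "'a::euclidean_space set \<Rightarrow> ('a \<Rightarrow> real) \<Rightarrow> ereal" where
  "TV \<Omega> u = (SUP \<psi>\<in>{\<psi> \<in> test_functions \<Omega>. \<forall>x\<in>\<Omega>. norm (\<psi> x) \<le> 1}.
     ereal (\<integral>x. u x * (- divergence \<psi> x) \<partial>lebesgue_on \<Omega>))"

definition bregman_energy ::
    "'a::euclidean_space set \<Rightarrow> ('a \<times> real \<Rightarrow> ereal) \<Rightarrow> ('a \<Rightarrow> real) \<Rightarrow> ('a \<Rightarrow> real) \<Rightarrow> ereal" where
  "bregman_energy \<Omega> \<rho> p u =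
     data_term \<Omega> \<rho> u + TV \<Omega> u - ereal (pairing (lebesgue_on \<Omega>) p u)"

definition bregman_iteration ::
    "'a::euclidean_space set \<Rightarrow> real set \<Rightarrow> ('a \<times> real \<Rightarrow> ereal) \<Rightarrow>
     (nat \<Rightarrow> 'a \<Rightarrow> real) \<Rightarrow> (nat \<Rightarrow> 'a \<Rightarrow> real) \<Rightarrow> bool" where
  "bregman_iteration \<Omega> \<Gamma> \<rho> u p \<longleftrightarrow>
     p 0 = (\<lambda>_. 0) \<and>
     (\<forall>k\<ge>1. is_arg_min (bregman_energy \<Omega> \<rho> (p (k - 1))) (\<lambda>w. w \<in> W11 \<Omega> \<Gamma>) (u k) \<and>
            p k \<in> subdifferential (lebesgue_on \<Omega>) (L2_space (lebesgue_on \<Omega>)) (TV \<Omega>) (u k))"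

definition subgraph_indicator :: "('a \<Rightarrow> real) \<Rightarrow> 'a \<times> real \<Rightarrow> real" where
  "subgraph_indicator u = (\<lambda>(x, z). if u x > z then 1 else 0)"

(* For a nonempty compact interval, Inf and Sup are its minimum and maximum. *)
definition relaxed_set ::
    "'a::euclidean_space set \<Rightarrow> real set \<Rightarrow> ('a \<times> real \<Rightarrow> real) set" where
  "relaxed_set \<Omega> \<Gamma> = {v \<in> BV_loc (\<Omega> \<times> UNIV).
     (AE z in lebesgue_on (\<Omega> \<times> UNIV). v z \<in> {0..1}) \<and>
     (AE t in lebesgue. t \<le> Inf \<Gamma> \<longrightarrow> (AE x in lebesgue_on \<Omega>. v (x, t) = 1)) \<and>
     (AE t in lebesgue. t > Sup \<Gamma> \<longrightarrow> (AE x in lebesgue_on \<Omega>. v (x, t) = 0))}"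

definition K_x :: "'a::euclidean_space set \<Rightarrow> ('a \<times> real \<Rightarrow> 'a) set" where
  "K_x \<Omega> = {\<phi> \<in> C_0 (\<Omega> \<times> UNIV). \<forall>z\<in>\<Omega> \<times> UNIV. norm (\<phi> z) \<le> 1}"

definition K_t ::
    "'a::euclidean_space set \<Rightarrow> real set \<Rightarrow> ('a \<times> real \<Rightarrow> ereal) \<Rightarrow> ('a \<times> real \<Rightarrow> real) set" where
  "K_t \<Omega> \<Gamma> \<rho> = {\<phi> \<in> C_0 (\<Omega> \<times> UNIV). \<forall>z\<in>\<Omega> \<times> \<Gamma>. ereal (- \<phi> z) \<le> \<rho> z}"

definition lifted_TV ::
    "'a::euclidean_space set \<Rightarrow> real set \<Rightarrow> ('a \<times> real \<Rightarrow> real) \<Rightarrow> ereal" where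
  "lifted_TV \<Omega> \<Gamma> v = (let (\<mu>, \<sigma>) = dist_derivative (\<Omega> \<times> UNIV) v in
     SUP \<phi>\<in>K_x \<Omega>. ereal (LINT z:\<Omega> \<times> \<Gamma>|\<mu>. \<phi> z \<bullet> fst (\<sigma> z)))"

definition lifted_data_term ::
    "'a::euclidean_space set \<Rightarrow> real set \<Rightarrow> ('a \<times> real \<Rightarrow> ereal) \<Rightarrow> ('a \<times> real \<Rightarrow> real) \<Rightarrow> ereal" where
  "lifted_data_term \<Omega> \<Gamma> \<rho> v = (let (\<mu>, \<sigma>) = dist_derivative (\<Omega> \<times> UNIV) v in
     SUP \<phi>\<in>K_t \<Omega> \<Gamma> \<rho>. ereal (LINT z:\<Omega> \<times> \<Gamma>|\<mu>. \<phi> z * snd (\<sigma> z)))"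

definition lifted_energy ::
    "'a::euclidean_space set \<Rightarrow> real set \<Rightarrow> ('a \<times> real \<Rightarrow> ereal) \<Rightarrow>
     ('a \<times> real \<Rightarrow> real) \<Rightarrow> ('a \<times> real \<Rightarrow> real) \<Rightarrow> ereal" where
  "lifted_energy \<Omega> \<Gamma> \<rho> q v =
     lifted_data_term \<Omega> \<Gamma> \<rho> v + lifted_TV \<Omega> \<Gamma> v - ereal (pairing (lebesgue_on (\<Omega> \<times> \<Gamma>)) q v)"

(* The domain of the lifted total variation consists of the locally BV functions on
   \<Omega> \<times> \<real> (not only those in the relaxed feasible set) that are square integrable on
   \<Omega> \<times> \<Gamma>, so that the duality pairing with L^2(\<Omega> \<times> \<Gamma>) is defined. *)
definition lifted_bregman_iteration ::
    "'a::euclidean_space set \<Rightarrow> real set \<Rightarrow> ('a \<times> real \<Rightarrow> ereal) \<Rightarrow>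
     (nat \<Rightarrow> 'a \<times> real \<Rightarrow> real) \<Rightarrow> (nat \<Rightarrow> 'a \<times> real \<Rightarrow> real) \<Rightarrow> bool" where
  "lifted_bregman_iteration \<Omega> \<Gamma> \<rho> v q \<longleftrightarrow>
     q 0 = (\<lambda>_. 0) \<and>
     (\<forall>k\<ge>1. is_arg_min (lifted_energy \<Omega> \<Gamma> \<rho> (q (k - 1))) (\<lambda>w. w \<in> relaxed_set \<Omega> \<Gamma>) (v k) \<and>
            q k \<in> subdifferential (lebesgue_on (\<Omega> \<times> \<Gamma>))
                    (BV_loc (\<Omega> \<times> UNIV) \<inter> L2_space (lebesgue_on (\<Omega> \<times> \<Gamma>)))
                    (lifted_TV \<Omega> \<Gamma>) (v k))"

end

theory Submission
  imports Defs "HOL-Computational_Algebra.Polynomial"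
begin

text \<open>The distributional derivative of \<open>1\<^sub>u\<close> is the image of \<open>(\<nabla>u, -1) dx\<close> under \<open>x \<mapsto> (x, u(x))\<close>:
  tested against \<open>\<psi>\<close> in a spatial direction, the difference quotients of \<open>1\<^sub>u\<close> integrate to those of \<open>u\<close>
  times \<open>\<psi>(x, u(x))\<close>, and the difference quotients of \<open>u\<close> converge to the weak derivative in \<open>L\<^sup>1\<close>.
  The polar decomposition of the derivative is unique, so the lifted functionals of \<open>1\<^sub>u\<close> are
  integrals over \<open>\<Omega>\<close>. The lifted total variation equals \<open>TV(u)\<close>; the lifted data term equals \<open>H(u)\<close>, because
  the lower semicontinuous \<open>\<rho>\<close> is the limit of continuous functions below it. If \<open>q(\<cdot>, t) = p\<close>, then
  \<open>\<langle>q, 1\<^sub>u\<rangle> = \<langle>p, u - min \<Gamma>\<rangle>\<close>. On subgraphs the two energies thus differ by a constant, and if \<open>1\<^sub>w\<close> minimises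
  the lifted energy, then \<open>w\<close> minimises the original one, whose minimiser is unique.\<close>

subsection \<open>Smooth functions\<close>

text \<open>The obstacle is that x \<mapsto> \<psi>(x, u(x)) is not smooth, so the weak derivative
  of u cannot be tested against it directly. Difference quotients avoid this: they need only L1
  convergence of the quotients of u and an elementary estimate for step functions. Uniqueness of the
  polar decomposition is essential because \<open>dist_derivative\<close> is a choice among all
  derivative measures; a formula for one of them says nothing about the chosen one otherwise.
  Uniqueness, the convergence of the difference quotients and the identity of TV(u) with the L1 norm
  of the weak gradient all rest on one duality, \<open>L1_norm_le_if_test_functions_le\<close>. The
  statement concerns Lebesgue measurable functions on \<Omega> up to null sets, whereas
  translations, Fubini and image measures are handled for Borel functions on the whole space; hence
  the passage to Borel representatives extended by zero. On subgraphs only the data term can be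
  infinite; the constant between the energies is real and cancels in the extended reals. A single
  competitor, the subgraph of \<open>u k\<close>, suffices for the comparison.\<close>

lemma C_k_SucI:
  assumes "\<And>x. (f has_derivative f' x) (at x)" and "\<And>h. C_k n (\<lambda>x. f' x h)"
  shows "C_k (Suc n) f"
proof -
  have "frechet_derivative f (at x) = f' x" for x
    using frechet_derivative_at[OF assms(1)] by simp
  then show ?thesis using assms by (auto simp: differentiable_def)
qed

lemma C_k_has_derivative:
  "C_k (Suc n) f \<Longrightarrow> (f has_derivative frechet_derivative f (at x)) (at x)"
  by (simp add: frechet_derivative_works)

text \<open>Needed for the product rule: the undifferentiated factors reappear in the derivative of
  a product, and there they are used at the lower order.\<close>

lemma C_k_mono_Suc: "C_k (Suc n) f \<Longrightarrow> C_k n f"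
proof (induction n arbitrary: f)
  case 0
  then show ?case
    by (auto intro!: continuous_at_imp_continuous_on differentiable_imp_continuous_within)
next
  case (Suc n)
  then show ?case by auto
qed

lemma C_k_const: "C_k n (\<lambda>x. c)"
proof (induction n arbitrary: c)
  case (Suc n)
  show ?case by (rule C_k_SucI[where f'="\<lambda>x h. 0"]) (auto intro: Suc)
qed simp

lemma C_k_add: "C_k n f \<Longrightarrow> C_k n g \<Longrightarrow> C_k n (\<lambda>x. f x + g x)"
proof (induction n arbitrary: f g)
  case (Suc n)
  show ?case
  proof (rule C_k_SucI[where f'="\<lambda>x h. frechet_derivative f (at x) h + frechet_derivative g (at x) h"])
    show "((\<lambda>x. f x + g x) has_derivative
       (\<lambda>h. frechet_derivative f (at x) h + frechet_derivative g (at x) h)) (at x)" for x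
      by (intro has_derivative_add C_k_has_derivative[of n] Suc.prems)
    show "C_k n (\<lambda>x. frechet_derivative f (at x) h + frechet_derivative g (at x) h)" for h
      using Suc.prems by (intro Suc.IH) auto
  qed
qed (auto intro: continuous_intros)

lemma C_k_linear:
  assumes "bounded_linear L"
  shows "C_k n L"
proof (cases n)
  case 0
  then show ?thesis using assms by (simp add: linear_continuous_on)
next
  case (Suc m)
  show ?thesis unfolding Suc
    by (rule C_k_SucI[where f'="\<lambda>x. L"]) (auto intro: bounded_linear_imp_has_derivative assms C_k_const)
qed

lemma C_k_scaleR:
  fixes f :: "'a::euclidean_space \<Rightarrow> real"
  shows "C_k n f \<Longrightarrow> C_k n g \<Longrightarrow> C_k n (\<lambda>x. f x *\<^sub>R g x)"
proof (induction n arbitrary: f g)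
  case (Suc n)
  show ?case
  proof (rule C_k_SucI[where f'="\<lambda>x h. f x *\<^sub>R frechet_derivative g (at x) h + frechet_derivative f (at x) h *\<^sub>R g x"])
    show "((\<lambda>x. f x *\<^sub>R g x) has_derivative
       (\<lambda>h. f x *\<^sub>R frechet_derivative g (at x) h + frechet_derivative f (at x) h *\<^sub>R g x)) (at x)" for x
      by (intro has_derivative_scaleR C_k_has_derivative[of n] Suc.prems)
    show "C_k n (\<lambda>x. f x *\<^sub>R frechet_derivative g (at x) h + frechet_derivative f (at x) h *\<^sub>R g x)" for h
      using Suc.prems C_k_mono_Suc[OF Suc.prems(1)] C_k_mono_Suc[OF Suc.prems(2)]
      by (auto intro!: C_k_add Suc.IH)
  qed
qed (auto intro: continuous_intros)

lemma C_k_linear_compose: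
  assumes "bounded_linear L"
  shows "C_k n f \<Longrightarrow> C_k n (\<lambda>x. L (f x))"
proof (induction n arbitrary: f)
  case 0
  then show ?case using assms by (auto intro: bounded_linear.continuous_on)
next
  case (Suc n)
  show ?case
    by (rule C_k_SucI[where f'="\<lambda>x h. L (frechet_derivative f (at x) h)"])
      (use Suc in \<open>auto intro!: bounded_linear.has_derivative[OF assms] simp: frechet_derivative_works\<close>)
qed

lemma has_derivative_affine_compose:
  assumes "bounded_linear L" and "(f has_derivative f') (at (L x + c))"
  shows "((\<lambda>x. f (L x + c)) has_derivative (\<lambda>h. f' (L h))) (at x)"
proof -
  have 1: "((\<lambda>x. L x + c) has_derivative L) (at x)"
    using assms(1) by (auto intro!: derivative_eq_intros bounded_linear_imp_has_derivative)
  show ?thesis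
    using diff_chain_at[OF 1 assms(2)] by (simp add: o_def)
qed

lemma C_k_affine_compose:
  fixes L :: "'a::euclidean_space \<Rightarrow> 'b::euclidean_space"
  assumes "bounded_linear L"
  shows "C_k n f \<Longrightarrow> C_k n (\<lambda>x. f (L x + c))"
proof (induction n arbitrary: f)
  case 0
  have "continuous_on UNIV (\<lambda>x. L x + c)"
    using assms by (intro continuous_intros linear_continuous_on)
  from continuous_on_compose[OF this, of f] 0 show ?case
    by (auto simp: o_def intro: continuous_on_subset)
next
  case (Suc n)
  show ?case
    by (rule C_k_SucI[where f'="\<lambda>x h. frechet_derivative f (at (L x + c)) (L h)"])
      (use Suc in \<open>auto intro!: has_derivative_affine_compose assms simp: frechet_derivative_works\<close>)
qed

definition smooth :: "('a::euclidean_space \<Rightarrow> 'b::real_normed_vector) \<Rightarrow> bool" where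
  "smooth f \<longleftrightarrow> (\<forall>n. C_k n f)"

lemma smooth_const [simp]: "smooth (\<lambda>x. c)"
  and smooth_add: "smooth f \<Longrightarrow> smooth g \<Longrightarrow> smooth (\<lambda>x. f x + g x)"
  and smooth_linear: "bounded_linear L \<Longrightarrow> smooth L"
  and smooth_linear_compose: "bounded_linear L' \<Longrightarrow> smooth f \<Longrightarrow> smooth (\<lambda>x. L' (f x))"
  by (auto simp: smooth_def C_k_const C_k_add C_k_linear C_k_linear_compose)

lemma smooth_scaleR: "smooth f \<Longrightarrow> smooth g \<Longrightarrow> smooth (\<lambda>x. f x *\<^sub>R g x)"
  by (auto simp: smooth_def C_k_scaleR)

lemma smooth_mult:
  fixes f g :: "'a::euclidean_space \<Rightarrow> real"
  shows "smooth f \<Longrightarrow> smooth g \<Longrightarrow> smooth (\<lambda>x. f x * g x)"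
  using smooth_scaleR[of f g] by simp

lemma smooth_affine_compose:
  "bounded_linear L \<Longrightarrow> smooth f \<Longrightarrow> smooth (\<lambda>x. f (L x + c))"
  for L :: "'a::euclidean_space \<Rightarrow> 'b::euclidean_space"
  by (auto simp: smooth_def C_k_affine_compose)

lemma smooth_sum: "(\<And>i. i \<in> I \<Longrightarrow> smooth (f i)) \<Longrightarrow> smooth (\<lambda>x. \<Sum>i\<in>I. f i x)"
  by (induction I rule: infinite_finite_induct) (auto intro: smooth_add)

lemma smooth_prod:
  fixes f :: "_ \<Rightarrow> 'a::euclidean_space \<Rightarrow> real"
  shows "(\<And>i. i \<in> I \<Longrightarrow> smooth (f i)) \<Longrightarrow> smooth (\<lambda>x. \<Prod>i\<in>I. f i x)"
  by (induction I rule: infinite_finite_induct) (auto intro: smooth_mult)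

lemma smooth_one_minus:
  fixes f :: "'a::euclidean_space \<Rightarrow> real"
  shows "smooth f \<Longrightarrow> smooth (\<lambda>x. 1 - f x)"
  using smooth_add[OF smooth_const smooth_linear_compose[of "\<lambda>x. - x"], of f 1]
  by (simp add: bounded_linear_minus bounded_linear_ident)

lemma smooth_power:
  fixes f :: "'a::euclidean_space \<Rightarrow> real"
  shows "smooth f \<Longrightarrow> smooth (\<lambda>x. f x ^ n)"
  by (induction n) (auto intro: smooth_mult)

lemma smooth_real_polynomial: "real_polynomial_function p \<Longrightarrow> smooth p"
  by (induction rule: real_polynomial_function.induct)
    (auto intro: smooth_linear smooth_add smooth_mult)

text \<open>Turns the approximants of the Stone-Weierstrass theorem into smooth fields, which become
  test functions after multiplication by a cut-off.\<close>

lemma smooth_polynomial: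
  fixes p :: "'a::euclidean_space \<Rightarrow> 'b::euclidean_space"
  assumes "polynomial_function p"
  shows "smooth p"
proof -
  have "smooth (\<lambda>x. \<Sum>i\<in>Basis. (p x \<bullet> i) *\<^sub>R i)"
  proof (intro smooth_sum smooth_scaleR smooth_const)
    fix i :: 'b
    assume "i \<in> Basis"
    have "real_polynomial_function ((\<lambda>y. y \<bullet> i) \<circ> p)"
      using assms by (auto simp: polynomial_function_def bounded_linear_inner_left)
    then show "smooth (\<lambda>x. p x \<bullet> i)" by (auto dest: smooth_real_polynomial simp: o_def)
  qed
  then show ?thesis by (simp add: euclidean_representation)
qed

lemma smooth_imp_continuous: "smooth f \<Longrightarrow> continuous_on S f"
  using continuous_on_subset[of UNIV f S] C_k.simps(1)[of f] unfolding smooth_def by blast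

lemma smooth_has_derivative: "smooth f \<Longrightarrow> (f has_derivative frechet_derivative f (at x)) (at x)"
  using C_k_has_derivative[of 0] unfolding smooth_def by blast

lemma smooth_frechet_derivative: "smooth f \<Longrightarrow> smooth (\<lambda>x. frechet_derivative f (at x) h)"
  using C_k.simps(2) unfolding smooth_def by blast

section \<open>A function flat at the origin, and smooth bumps on boxes\<close>

definition flat_exp :: "real poly \<Rightarrow> real \<Rightarrow> real" where
  "flat_exp P t = (if t > 0 then poly P (1 / t) * exp (- (1 / t)) else 0)"

lemma poly_times_exp_minus_tendsto_0:
  fixes P :: "real poly"
  shows "((\<lambda>s. poly P s * exp (- s)) \<longlongrightarrow> 0) at_top"
proof -
  have "((\<lambda>s. \<Sum>i\<le>degree P. coeff P i * (s ^ i / exp s)) \<longlongrightarrow> (\<Sum>i\<le>degree P. coeff P i * 0)) at_top"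
    by (intro tendsto_intros tendsto_power_div_exp_0)
  then show ?thesis
    by (simp add: poly_altdef exp_minus field_simps sum_divide_distrib)
qed

text \<open>With s = 1/t, the chain rule gives s^2 (P(s) - P'(s)) exp(-s) as the derivative of P(s)
  exp(-s). The family is therefore closed under differentiation, and smoothness follows by an
  induction over the order with \<open>P\<close> arbitrary. At the origin, dividing by h multiplies
  by s = 1/h, which is why \<open>pCons 0 P\<close> appears, and the exponential beats every
  polynomial.\<close>

lemma DERIV_flat_exp:
  "(flat_exp P has_field_derivative flat_exp (monom 1 2 * (P - pderiv P)) t) (at t)"
proof (cases t "0 :: real" rule: linorder_cases)
  case less
  have "((\<lambda>_. 0) has_field_derivative 0) (at t)" by simp
  then have "(flat_exp P has_field_derivative 0) (at t)"
    by (rule has_field_derivative_transform_within_open[of _ _ _ "{..<0}"])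
      (use less in \<open>auto simp: flat_exp_def\<close>)
  then show ?thesis using less by (simp add: flat_exp_def)
next
  case greater
  have "((\<lambda>t. poly P (1 / t) * exp (- (1 / t))) has_field_derivative
      flat_exp (monom 1 2 * (P - pderiv P)) t) (at t)"
    using greater
    by (auto intro!: derivative_eq_intros DERIV_chain2[OF poly_DERIV]
        simp: flat_exp_def poly_monom power2_eq_square)
      (simp add: field_simps)
  then show ?thesis
    by (rule has_field_derivative_transform_within_open[of _ _ _ "{0<..}"])
      (use greater in \<open>auto simp: flat_exp_def\<close>)
next
  case equal
  have "((\<lambda>h. flat_exp P h / h) \<longlongrightarrow> 0) (at_right 0)"
  proof -
    have "((\<lambda>h. poly (pCons 0 P) (inverse h) * exp (- inverse h)) \<longlongrightarrow> 0) (at_right 0)"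
      using poly_times_exp_minus_tendsto_0[of "pCons 0 P"] filterlim_inverse_at_top_right
      by (rule filterlim_compose)
    then show ?thesis
      by (rule Lim_transform_eventually)
        (auto simp: eventually_at_filter flat_exp_def field_simps)
  qed
  moreover have "((\<lambda>h. flat_exp P h / h) \<longlongrightarrow> 0) (at_left 0)"
    by (rule tendsto_eventually) (auto simp: eventually_at_filter flat_exp_def)
  ultimately have "((\<lambda>h. flat_exp P h / h) \<longlongrightarrow> 0) (at 0)"
    by (simp add: filterlim_at_split)
  then show ?thesis
    using equal by (simp add: has_field_derivative_iff flat_exp_def)
qed

lemma smooth_flat_exp: "smooth (flat_exp P)"
  unfolding smooth_def
proof
  fix n
  show "C_k n (flat_exp P)"
  proof (induction n arbitrary: P)
    case 0
    then show ?case
      using DERIV_isCont[OF DERIV_flat_exp] by (auto intro: continuous_at_imp_continuous_on)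
  next
    case (Suc n)
    show ?case
    proof (rule C_k_SucI)
      show "(flat_exp P has_derivative (\<lambda>h. h * flat_exp (monom 1 2 * (P - pderiv P)) t)) (at t)" for t
        using DERIV_flat_exp[of P t]
        by (simp add: has_field_derivative_def mult.commute[of _ "flat_exp _ t"])
      show "C_k n (\<lambda>t. h * flat_exp (monom 1 2 * (P - pderiv P)) t)" for h
        by (rule C_k_linear_compose[OF bounded_linear_mult_right Suc])
    qed
  qed
qed

lemma flat_exp_one: "0 \<le> flat_exp 1 t" "flat_exp 1 t \<le> 1" "flat_exp 1 t > 0 \<longleftrightarrow> t > 0"
  by (auto simp: flat_exp_def)

text \<open>In each coordinate, exp(-1/s) is taken at the distances s to the two faces, so the
  product vanishes as soon as one face is reached.\<close>

definition box_bump :: "'a::euclidean_space \<Rightarrow> 'a \<Rightarrow> 'a \<Rightarrow> real" where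
  "box_bump a b x = (\<Prod>i\<in>Basis. flat_exp 1 ((x - a) \<bullet> i) * flat_exp 1 ((b - x) \<bullet> i))"

lemma smooth_box_bump: "smooth (box_bump a b)"
  unfolding box_bump_def
proof (intro smooth_prod smooth_mult)
  fix i :: 'a
  assume "i \<in> Basis"
  show "smooth (\<lambda>x. flat_exp 1 ((x - a) \<bullet> i))"
    using smooth_affine_compose[OF bounded_linear_inner_left[of i] smooth_flat_exp, of 1 "- (a \<bullet> i)"]
    by (simp add: inner_diff_left)
  show "smooth (\<lambda>x. flat_exp 1 ((b - x) \<bullet> i))"
    using smooth_affine_compose[OF bounded_linear_minus[OF bounded_linear_inner_left[of i]] smooth_flat_exp, of 1 "b \<bullet> i"]
    by (simp add: inner_diff_left)
qed

lemma box_bump_bounds: "0 \<le> box_bump a b x" "box_bump a b x \<le> 1"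
  by (auto simp: box_bump_def flat_exp_one intro!: prod_nonneg prod_le_1 mult_le_one)

lemma box_bump_pos: "box_bump a b x > 0 \<longleftrightarrow> x \<in> box a b"
proof
  assume x: "x \<in> box a b"
  then show "box_bump a b x > 0"
    by (auto simp: box_bump_def flat_exp_one mem_box inner_diff_left intro!: prod_pos mult_pos_pos)
next
  assume "box_bump a b x > 0"
  then have "box_bump a b x \<noteq> 0" by simp
  then have "flat_exp 1 ((x - a) \<bullet> i) * flat_exp 1 ((b - x) \<bullet> i) \<noteq> 0" if "i \<in> Basis" for i
    using that unfolding box_bump_def by (simp only: prod_zero_iff finite_Basis) blast
  then have "flat_exp 1 ((x - a) \<bullet> i) > 0 \<and> flat_exp 1 ((b - x) \<bullet> i) > 0" if "i \<in> Basis" for i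
    using that flat_exp_one(1)[of "(x - a) \<bullet> i"] flat_exp_one(1)[of "(b - x) \<bullet> i"]
    by (metis less_eq_real_def mult_eq_0_iff)
  then show "x \<in> box a b"
    by (auto simp: flat_exp_one mem_box inner_diff_left)
qed

lemma box_bump_eq_0: "x \<notin> box a b \<Longrightarrow> box_bump a b x = 0"
  using box_bump_pos[of a b x] box_bump_bounds(1)[of a b x] by auto

section \<open>Test functions and cut-offs\<close>

lemma test_functions_smooth: "\<psi> \<in> test_functions U \<Longrightarrow> smooth \<psi>"
  by (simp add: test_functions_def smooth_def)

lemma test_functionsI:
  "smooth \<psi> \<Longrightarrow> compact K \<Longrightarrow> K \<subseteq> U \<Longrightarrow> (\<And>x. x \<notin> K \<Longrightarrow> \<psi> x = 0) \<Longrightarrow> \<psi> \<in> test_functions U"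
  by (auto simp: test_functions_def smooth_def)

lemma test_functionsE:
  assumes "\<psi> \<in> test_functions U"
  obtains K where "compact K" "K \<subseteq> U" "\<forall>x. x \<notin> K \<longrightarrow> \<psi> x = 0"
proof -
  have "\<exists>K. compact K \<and> K \<subseteq> U \<and> (\<forall>x. x \<notin> K \<longrightarrow> \<psi> x = 0)"
    using assms unfolding test_functions_def mem_Collect_eq by (rule conjunct2)
  then show ?thesis using that by (elim exE conjE)
qed

lemma test_function_zero_outside:
  assumes "\<psi> \<in> test_functions U" and "x \<notin> U"
  shows "\<psi> x = 0"
proof -
  obtain K where "K \<subseteq> U" and 0: "\<forall>x. x \<notin> K \<longrightarrow> \<psi> x = 0" by (rule test_functionsE[OF assms(1)])
  then show ?thesis using assms(2) by blast
qed

lemma test_function_continuous: "\<psi> \<in> test_functions U \<Longrightarrow> continuous_on S \<psi>"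
  by (rule smooth_imp_continuous[OF test_functions_smooth])

lemma test_function_measurable:
  "\<phi> \<in> test_functions U \<Longrightarrow> \<phi> \<in> borel_measurable borel"
  by (rule borel_measurable_continuous_onI[OF test_function_continuous])

lemma zero_test_function: "(\<lambda>_. 0) \<in> test_functions U"
  by (rule test_functionsI[of _ "{}"]) auto

lemma test_functions_mono: "U \<subseteq> V \<Longrightarrow> test_functions U \<subseteq> test_functions V"
  by (auto simp: test_functions_def)

lemma test_function_scaleR:
  assumes "\<phi> \<in> test_functions U" and "smooth \<psi>"
  shows "(\<lambda>x. \<phi> x *\<^sub>R \<psi> x) \<in> test_functions U"
proof -
  obtain K where K: "compact K" "K \<subseteq> U" and 0: "\<forall>x. x \<notin> K \<longrightarrow> \<phi> x = 0"
    by (rule test_functionsE[OF assms(1)])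
  show ?thesis
  proof (rule test_functionsI[OF _ K])
    show "smooth (\<lambda>x. \<phi> x *\<^sub>R \<psi> x)"
      by (rule smooth_scaleR[OF test_functions_smooth[OF assms(1)] assms(2)])
    show "\<phi> x *\<^sub>R \<psi> x = 0" if "x \<notin> K" for x
      using 0[rule_format, OF that] by simp
  qed
qed

lemma test_function_linear_compose:
  assumes "bounded_linear L" and "\<psi> \<in> test_functions U"
  shows "(\<lambda>x. L (\<psi> x)) \<in> test_functions U"
proof -
  obtain K where K: "compact K" "K \<subseteq> U" and 0: "\<forall>x. x \<notin> K \<longrightarrow> \<psi> x = 0"
    by (rule test_functionsE[OF assms(2)])
  show ?thesis
  proof (rule test_functionsI[OF _ K])
    show "smooth (\<lambda>x. L (\<psi> x))"
      by (rule smooth_linear_compose[OF assms(1) test_functions_smooth[OF assms(2)]])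
    show "L (\<psi> x) = 0" if "x \<notin> K" for x
      using 0[rule_format, OF that] linear_simps(3)[OF assms(1)] by simp
  qed
qed

text \<open>If the bumps \<open>b\<^sub>j\<close> have supports covering \<open>U\<close>, then \<open>1 - (\<Prod>j<n. (1 - b\<^sub>j) ^ n)\<close> works:
  at a point of \<open>U\<close> some factor is less than one.\<close>

lemma test_functions_approx_indicator:
  fixes U :: "'a::euclidean_space set"
  assumes "open U"
  obtains \<eta> :: "nat \<Rightarrow> 'a \<Rightarrow> real"
  where "\<And>n. \<eta> n \<in> test_functions U" "\<And>n x. 0 \<le> \<eta> n x" "\<And>n x. \<eta> n x \<le> 1"
    "\<And>x. (\<lambda>n. \<eta> n x) \<longlonglongrightarrow> indicator U x"
proof (cases "U = {}")
  case True
  then show ?thesis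
    by (intro that[of "\<lambda>_ _. 0"] zero_test_function) simp_all
next
  case False
  let ?F = "{box a b |a b. cbox a b \<subseteq> U}"
  have cover: "\<Union>?F = U"
  proof
    show "\<Union>?F \<subseteq> U" using box_subset_cbox by blast
    show "U \<subseteq> \<Union>?F"
    proof
      fix x
      assume "x \<in> U"
      then obtain a b where "cbox a b \<subseteq> U" "x \<in> box a b"
        by (rule open_contains_cbox[OF assms])
      then show "x \<in> \<Union>?F" by blast
    qed
  qed
  have "\<And>S. S \<in> ?F \<Longrightarrow> open S" by (auto simp: open_box)
  then obtain F where F: "F \<subseteq> ?F" "countable F" "\<Union>F = \<Union>?F"
    by (rule Lindelof)
  with cover False have "F \<noteq> {}" by auto
  \<comment> \<open>\<open>from_nat_into\<close> repeats elements if \<open>F\<close> is finite, so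
    a total enumeration only needs \<open>F\<close> to be nonempty; this is the reason for the case
    split on \<open>U\<close>.\<close>
  define B where "B = from_nat_into F"
  have B: "range B = F"
    using \<open>F \<noteq> {}\<close> F(2) by (simp add: B_def)
  then have "\<forall>j. \<exists>a b. B j = box a b \<and> cbox a b \<subseteq> U" using F(1) by blast
  then obtain a b where ab: "\<And>j. B j = box (a j) (b j)" "\<And>j. cbox (a j) (b j) \<subseteq> U" by metis
  \<comment> \<open>The index \<open>n\<close> has two roles: as an exponent it drives a factor
    below one to zero, and as a bound on \<open>j\<close> it lets only finitely many boxes enter,
    which keeps the support compact.\<close>
  define \<eta> where "\<eta> n x = 1 - (\<Prod>j<n. (1 - box_bump (a j) (b j) x) ^ n)" for n :: nat and x
  have factor: "0 \<le> (1 - box_bump (a j) (b j) x) ^ n" "(1 - box_bump (a j) (b j) x) ^ n \<le> 1" for j n x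
    using box_bump_bounds[of "a j" "b j" x] by (auto intro!: zero_le_power power_le_one)
  show ?thesis
  proof (rule that)
    show "\<eta> n \<in> test_functions U" for n
    proof (rule test_functionsI)
      show "smooth (\<eta> n)"
        unfolding \<eta>_def by (intro smooth_one_minus smooth_prod smooth_power smooth_box_bump)
      show "compact (\<Union>j<n. cbox (a j) (b j))" by (intro compact_UN) auto
      show "(\<Union>j<n. cbox (a j) (b j)) \<subseteq> U" using ab(2) by blast
      fix x
      assume "x \<notin> (\<Union>j<n. cbox (a j) (b j))"
      then have "\<And>j. j < n \<Longrightarrow> box_bump (a j) (b j) x = 0"
        using box_subset_cbox[of "a _" "b _"] by (intro box_bump_eq_0) auto
      then show "\<eta> n x = 0" by (simp add: \<eta>_def)
    qed
    show "0 \<le> \<eta> n x" for n x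
      using prod_le_1[of "{..<n}" "\<lambda>j. (1 - box_bump (a j) (b j) x) ^ n"] factor by (simp add: \<eta>_def)
    show "\<eta> n x \<le> 1" for n x
      using prod_nonneg[of "{..<n}" "\<lambda>j. (1 - box_bump (a j) (b j) x) ^ n"] factor by (simp add: \<eta>_def)
    show "(\<lambda>n. \<eta> n x) \<longlonglongrightarrow> indicator U x" for x
    proof (cases "x \<in> U")
      case False
      then have "box_bump (a j) (b j) x = 0" for j
        using ab(2) box_subset_cbox by (intro box_bump_eq_0) blast
      with False show ?thesis by (simp add: \<eta>_def)
    next
      case True
      then have "x \<in> \<Union>(range B)" by (simp only: B F(3) cover)
      then obtain j where j: "x \<in> box (a j) (b j)"
        using ab(1) by auto
      define c where "c = 1 - box_bump (a j) (b j) x"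
      have c: "0 \<le> c" "c < 1"
        using j box_bump_bounds[of "a j" "b j" x] by (auto simp: c_def box_bump_pos)
      have le: "(\<Prod>i<n. (1 - box_bump (a i) (b i) x) ^ n) \<le> c ^ n" if "n > j" for n
      proof -
        have "(\<Prod>i<n. (1 - box_bump (a i) (b i) x) ^ n)
            = c ^ n * (\<Prod>i\<in>{..<n} - {j}. (1 - box_bump (a i) (b i) x) ^ n)"
          using that by (subst prod.remove[of _ j]) (auto simp: c_def)
        also have "\<dots> \<le> c ^ n * 1"
          using c factor by (intro mult_left_mono prod_le_1 zero_le_power) auto
        finally show ?thesis by simp
      qed
      have "(\<lambda>n. \<Prod>i<n. (1 - box_bump (a i) (b i) x) ^ n) \<longlonglongrightarrow> 0"
      proof (rule tendsto_sandwich[of "\<lambda>_. 0" _ _ "\<lambda>n. c ^ n"])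
        show "\<forall>\<^sub>F n in sequentially. 0 \<le> (\<Prod>i<n. (1 - box_bump (a i) (b i) x) ^ n)"
          using factor by (intro always_eventually allI prod_nonneg) auto
        show "\<forall>\<^sub>F n in sequentially. (\<Prod>i<n. (1 - box_bump (a i) (b i) x) ^ n) \<le> c ^ n"
          using le by (intro eventually_sequentiallyI[of "Suc j"]) auto
        show "(\<lambda>n. c ^ n) \<longlonglongrightarrow> 0" using c by (intro LIMSEQ_realpow_zero)
      qed simp
      from tendsto_diff[OF tendsto_const this, of 1] show ?thesis
        using True by (simp add: \<eta>_def)
    qed
  qed
qed

subsection \<open>Duality between test functions and integrable functions\<close>

lemma integrable_inner_bounded:
  fixes f \<psi> :: "'a \<Rightarrow> 'b::euclidean_space"
  assumes "integrable M f" and "\<psi> \<in> borel_measurable M" and "AE x in M. norm (\<psi> x) \<le> B"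
  shows "integrable M (\<lambda>x. f x \<bullet> \<psi> x)"
proof (rule Bochner_Integration.integrable_bound[of _ "\<lambda>x. B * norm (f x)"])
  show "AE x in M. norm (f x \<bullet> \<psi> x) \<le> norm (B * norm (f x))"
    using assms(3)
  proof eventually_elim
    case (elim x)
    have "norm (f x \<bullet> \<psi> x) \<le> norm (f x) * norm (\<psi> x)" by (simp add: Cauchy_Schwarz_ineq2)
    also have "\<dots> \<le> norm (f x) * B" by (rule mult_left_mono[OF elim]) simp
    also have "\<dots> \<le> norm (B * norm (f x))" by (simp add: abs_mult mult.commute mult_right_mono)
    finally show ?case .
  qed
qed (use assms in auto)

section \<open>Density of continuous functions in L1\<close>

lemma continuous_imp_measurable_lebesgue_on:
  fixes f :: "'a::euclidean_space \<Rightarrow> 'b::euclidean_space"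
  shows "continuous_on UNIV f \<Longrightarrow> f \<in> borel_measurable (lebesgue_on S)"
  by (intro measurable_restrict_space1 measurable_completion)
    (simp add: borel_measurable_continuous_onI)

text \<open>Outer regularity supplies an open set of nearly the same mass as \<open>A\<close>, and
  its indicator is a bounded pointwise limit of test functions.\<close>

lemma continuous_dense_L1_indicator:
  fixes A :: "'a::euclidean_space set"
  assumes M: "sets M = sets borel" "emeasure M UNIV < \<infinity>" and A: "A \<in> sets borel" and "e > 0"
  obtains \<xi> :: "'a \<Rightarrow> real" where "continuous_on UNIV \<xi>" "integrable M \<xi>" "(LINT x|M. \<bar>indicator A x - \<xi> x\<bar>) < e"
proof -
  have sp: "space M = UNIV" using M(1) by (simp add: sets_eq_imp_space_eq[of _ borel])
  interpret finite_measure M by (rule finite_measureI) (use M(2) sp in auto)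
  have "(INF U\<in>{U. A \<subseteq> U \<and> open U}. emeasure M U) < ennreal (measure M A + e)"
  proof -
    have "emeasure M A = (INF U\<in>{U. A \<subseteq> U \<and> open U}. emeasure M U)"
      using M(2) by (intro outer_regular[OF M(1) _ A]) (simp add: sp)
    moreover have "emeasure M A < ennreal (measure M A + e)"
      using \<open>e > 0\<close> by (simp add: emeasure_eq_measure ennreal_lessI)
    ultimately show ?thesis by (simp only:)
  qed
  then obtain U where U: "A \<subseteq> U" "open U" "emeasure M U < ennreal (measure M A + e)"
    by (auto simp: INF_less_iff)
  obtain \<eta> :: "nat \<Rightarrow> 'a \<Rightarrow> real" where \<eta>: "\<And>n. \<eta> n \<in> test_functions U" "\<And>n x. 0 \<le> \<eta> n x" "\<And>n x. \<eta> n x \<le> 1"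
    "\<And>x. (\<lambda>n. \<eta> n x) \<longlonglongrightarrow> indicator U x"
    using test_functions_approx_indicator[OF U(2)] by metis
  have cont: "continuous_on UNIV (\<eta> n)" for n
    by (rule test_function_continuous[OF \<eta>(1)])
  have meas: "\<eta> n \<in> borel_measurable M" for n
    using borel_measurable_continuous_onI[OF cont] by (simp add: measurable_cong_sets[OF M(1) refl])
  have sets: "A \<in> sets M" "U \<in> sets M" using A U by (simp_all add: M(1))
  have int: "integrable M (\<eta> n)" for n
    by (rule integrable_const_bound[of _ 1]) (use \<eta> meas in auto)
  have "(\<lambda>n. LINT x|M. \<bar>indicator A x - \<eta> n x\<bar>) \<longlonglongrightarrow> (LINT x|M. \<bar>indicator A x - indicator U x\<bar>)"
  proof (rule integral_dominated_convergence[where w="\<lambda>_. 1"])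
    show "AE x in M. (\<lambda>n. \<bar>indicator A x - \<eta> n x\<bar>) \<longlonglongrightarrow> \<bar>indicator A x - indicator U x\<bar>"
      by (intro AE_I2 tendsto_rabs tendsto_diff tendsto_const \<eta>(4))
    show "AE x in M. norm \<bar>indicator A x - \<eta> n x\<bar> \<le> 1" for n
    proof (rule AE_I2)
      fix x
      show "norm \<bar>indicator A x - \<eta> n x\<bar> \<le> 1" using \<eta>(2,3)[of n x] by (cases "x \<in> A") auto
    qed
  qed (use sets meas in auto)
  also have "(LINT x|M. \<bar>indicat_real A x - indicator U x\<bar>) = (LINT x|M. indicator (U - A) x)"
    by (rule Bochner_Integration.integral_cong[OF refl]) (use U(1) in \<open>auto simp: indicator_def\<close>)
  also have "\<dots> = measure M U - measure M A"
    using sets U(1) by (simp add: finite_measure_Diff)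
  finally have "(\<lambda>n. LINT x|M. \<bar>indicator A x - \<eta> n x\<bar>) \<longlonglongrightarrow> measure M U - measure M A" .
  moreover have "measure M U - measure M A < e"
    using U(3) by (simp add: emeasure_eq_measure ennreal_less_iff del: ennreal_plus)
  ultimately have "\<forall>\<^sub>F n in sequentially. (LINT x|M. \<bar>indicator A x - \<eta> n x\<bar>) < e"
    by (rule order_tendstoD(2))
  from eventually_happens'[OF _ this] obtain n where "(LINT x|M. \<bar>indicator A x - \<eta> n x\<bar>) < e" by auto
  then show ?thesis by (rule that[OF cont int])
qed

text \<open>Induction over the integrable functions: multiples of indicators, sums, and dominated
  limits of simple functions.\<close>

lemma continuous_dense_L1:
  fixes f :: "'a::euclidean_space \<Rightarrow> 'b::euclidean_space"
  assumes M: "sets M = sets borel" "emeasure M UNIV < \<infinity>" and "integrable M f"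
  shows "\<forall>e>0. \<exists>\<xi>. continuous_on UNIV \<xi> \<and> integrable M \<xi> \<and> (LINT x|M. norm (f x - \<xi> x)) < e"
  using assms(3)
proof induction
  case (base A c)
  show ?case
  proof (intro allI impI)
    fix e :: real assume "e > 0"
    have "A \<in> sets borel" using base(1) by (simp add: M(1))
    \<comment> \<open>Adding 1 avoids a division by zero when \<open>c = 0\<close>.\<close>
    moreover have pos: "norm c + 1 > 0" by (simp add: add_nonneg_pos)
    with \<open>e > 0\<close> have "e / (norm c + 1) > 0" by simp
    ultimately obtain \<xi> :: "'a \<Rightarrow> real" where \<xi>: "continuous_on UNIV \<xi>" "integrable M \<xi>"
      "(LINT x|M. \<bar>indicator A x - \<xi> x\<bar>) < e / (norm c + 1)"
      by (rule continuous_dense_L1_indicator[OF M])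
    have "(LINT x|M. norm (indicator A x *\<^sub>R c - \<xi> x *\<^sub>R c)) = (LINT x|M. \<bar>indicator A x - \<xi> x\<bar>) * norm c"
      by (simp flip: scaleR_left_diff_distrib)
    also have "\<dots> \<le> (LINT x|M. \<bar>indicator A x - \<xi> x\<bar>) * (norm c + 1)" by (intro mult_left_mono) auto
    also have "\<dots> < e" using \<xi>(3) pos by (simp add: pos_less_divide_eq)
    finally show "\<exists>\<xi>. continuous_on UNIV \<xi> \<and> integrable M \<xi> \<and> (LINT x|M. norm (indicator A x *\<^sub>R c - \<xi> x)) < e"
      using \<xi>(1,2) by (intro exI[of _ "\<lambda>x. \<xi> x *\<^sub>R c"]) (auto intro!: continuous_intros)
  qed
next
  case (add f g)
  show ?case
  proof (intro allI impI)
    fix e :: real assume "e > 0"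
    then obtain \<xi> \<zeta> where \<xi>: "continuous_on UNIV \<xi>" "integrable M \<xi>" "(LINT x|M. norm (f x - \<xi> x)) < e / 2"
      and \<zeta>: "continuous_on UNIV \<zeta>" "integrable M \<zeta>" "(LINT x|M. norm (g x - \<zeta> x)) < e / 2"
      using add.IH by (meson half_gt_zero)
    have "(LINT x|M. norm (f x + g x - (\<xi> x + \<zeta> x))) \<le> (LINT x|M. norm (f x - \<xi> x) + norm (g x - \<zeta> x))"
      using \<xi> \<zeta> add.hyps by (intro integral_mono) (auto simp: add_diff_add intro: norm_triangle_ineq)
    also have "\<dots> < e" using \<xi> \<zeta> add.hyps by simp
    finally show "\<exists>\<xi>. continuous_on UNIV \<xi> \<and> integrable M \<xi> \<and> (LINT x|M. norm (f x + g x - \<xi> x)) < e"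
      using \<xi> \<zeta> by (intro exI[of _ "\<lambda>x. \<xi> x + \<zeta> x"]) (auto intro!: continuous_intros)
  qed
next
  case (lim f s)
  show ?case
  proof (intro allI impI)
    fix e :: real assume "e > 0"
    have "(\<lambda>i. LINT x|M. norm (f x - s i x)) \<longlonglongrightarrow> (LINT x|M. 0)"
    \<comment> \<open>The induction provides \<open>norm (s i x) \<le> 2 * norm (f x)\<close>, so
      the difference is bounded by three times the norm of \<open>f\<close>.\<close>
    proof (rule integral_dominated_convergence[where w="\<lambda>x. 3 * norm (f x)"])
      show "AE x in M. (\<lambda>i. norm (f x - s i x)) \<longlonglongrightarrow> 0"
      proof (rule AE_I2)
        fix x assume "x \<in> space M"
        from tendsto_norm[OF tendsto_diff[OF tendsto_const lim.hyps(2)[OF this]], of "f x"]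
        show "(\<lambda>i. norm (f x - s i x)) \<longlonglongrightarrow> 0" by simp
      qed
      show "AE x in M. norm (norm (f x - s i x)) \<le> 3 * norm (f x)" for i
      proof (rule AE_I2)
        fix x assume "x \<in> space M"
        from lim.hyps(3)[OF this, of i] show "norm (norm (f x - s i x)) \<le> 3 * norm (f x)"
          using norm_triangle_ineq4[of "f x" "s i x"] by simp
      qed
    qed (use lim.hyps in auto)
    then have "(\<lambda>i. LINT x|M. norm (f x - s i x)) \<longlonglongrightarrow> 0" by simp
    from eventually_happens'[OF _ order_tendstoD(2)[OF this half_gt_zero[OF \<open>e > 0\<close>]]]
    obtain i where i: "(LINT x|M. norm (f x - s i x)) < e / 2" by auto
    obtain \<xi> where \<xi>: "continuous_on UNIV \<xi>" "integrable M \<xi>" "(LINT x|M. norm (s i x - \<xi> x)) < e / 2"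
      using lim.IH[of i] \<open>e > 0\<close> by (meson half_gt_zero)
    have "(LINT x|M. norm (f x - \<xi> x)) \<le> (LINT x|M. norm (f x - s i x) + norm (s i x - \<xi> x))"
    proof (rule integral_mono)
      show "norm (f x - \<xi> x) \<le> norm (f x - s i x) + norm (s i x - \<xi> x)" for x
        using norm_triangle_ineq[of "f x - s i x" "s i x - \<xi> x"] by simp
    qed (use lim.hyps \<xi> in auto)
    also have "\<dots> < e" using lim.hyps \<xi> i by simp
    finally show "\<exists>\<xi>. continuous_on UNIV \<xi> \<and> integrable M \<xi> \<and> (LINT x|M. norm (f x - \<xi> x)) < e"
      using \<xi> by blast
  qed
qed

text \<open>On the compact closure of \<open>V\<close> the field \<xi> is uniformly close to a
  polynomial field, which is smooth and becomes a test function after a cut-off. The cut-offs tend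
  to one on \<open>V\<close>, and the approximation error is controlled by the L1 norm of
  \<open>f\<close>.\<close>

lemma integral_inner_continuous_le:
  fixes f \<xi> :: "'a::euclidean_space \<Rightarrow> 'b::euclidean_space"
  assumes V: "open V" "bounded V" and M: "sets M = sets borel" "AE x in M. x \<in> V" and f: "integrable M f"
    and T: "\<And>\<psi>. \<psi> \<in> test_functions V \<Longrightarrow> (\<forall>x. norm (\<psi> x) \<le> 1) \<Longrightarrow> (LINT x|M. f x \<bullet> \<psi> x) \<le> T"
    and \<xi>: "continuous_on UNIV \<xi>" "\<And>x. norm (\<xi> x) \<le> 1"
  shows "(LINT x|M. f x \<bullet> \<xi> x) \<le> T"
proof -
  obtain \<eta> :: "nat \<Rightarrow> 'a \<Rightarrow> real" where \<eta>: "\<And>n. \<eta> n \<in> test_functions V" "\<And>n x. 0 \<le> \<eta> n x" "\<And>n x. \<eta> n x \<le> 1"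
    "\<And>x. (\<lambda>n. \<eta> n x) \<longlonglongrightarrow> indicator V x"
    using test_functions_approx_indicator[OF V(1)] by metis
  have meas: "h \<in> borel_measurable M" if "continuous_on UNIV h" for h :: "'a \<Rightarrow> 'c::euclidean_space"
    using borel_measurable_continuous_onI[OF that] by (simp add: measurable_cong_sets[OF M(1) refl])
  have bound: "(LINT x|M. f x \<bullet> \<xi> x) \<le> (1 + e) * T + e * (LINT x|M. norm (f x))" if "e > 0" for e
  proof -
    obtain P where P: "polynomial_function P" "\<And>x. x \<in> closure V \<Longrightarrow> norm (\<xi> x - P x) < e"
      using Stone_Weierstrass_polynomial_function[OF _ continuous_on_subset[OF \<xi>(1)] \<open>e > 0\<close>, of "closure V"] V(2)
      by (auto simp: compact_closure)
    have P': "smooth P" using P(1) by (rule smooth_polynomial)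
    have close: "norm (\<xi> x - P x) < e" if "x \<in> V" for x using P(2) that closure_subset by blast
    have P_le: "norm (P x) \<le> 1 + e" if "x \<in> V" for x
      using close[OF that] \<xi>(2)[of x] norm_triangle_ineq2[of "P x" "\<xi> x"] by (simp add: norm_minus_commute)
    have P_meas: "P \<in> borel_measurable M" and \<eta>_meas: "\<eta> n \<in> borel_measurable M" for n
      by (rule meas[OF smooth_imp_continuous[OF P']],
          rule meas[OF test_function_continuous[OF \<eta>(1)]])
    have int_P: "integrable M (\<lambda>x. f x \<bullet> P x)"
      using M(2) by (intro integrable_inner_bounded[OF f P_meas, of "1 + e"]) (auto elim: eventually_mono intro: P_le)
    have int_\<xi>: "integrable M (\<lambda>x. f x \<bullet> \<xi> x)"
      by (rule integrable_inner_bounded[OF f meas[OF \<xi>(1)], of 1]) (simp add: \<xi>)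
    have \<eta>P: "(LINT x|M. \<eta> n x * (f x \<bullet> P x)) \<le> (1 + e) * T" for n
    proof -
      \<comment> \<open>The polynomial may exceed norm one by up to \<open>e\<close> on
        \<open>V\<close>; division by \<open>1 + e\<close> makes the field admissible, and the
        factor is paid for in \<open>bound\<close> before \<open>e\<close> tends to zero.\<close>
      define \<psi> where "\<psi> x = \<eta> n x *\<^sub>R ((1 / (1 + e)) *\<^sub>R P x)" for x
      have "\<psi> \<in> test_functions V"
        unfolding \<psi>_def by (intro test_function_scaleR \<eta> smooth_scaleR[OF smooth_const P'])
      moreover have "norm (\<psi> x) \<le> 1" for x
      proof (cases "x \<in> V")
        case True
        then have "norm ((1 / (1 + e)) *\<^sub>R P x) \<le> 1" using P_le[OF True] \<open>e > 0\<close> by simp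
        then show ?thesis
          using \<eta>(2,3)[of n x] mult_le_one[of "\<eta> n x" "norm ((1 / (1 + e)) *\<^sub>R P x)"]
          by (simp del: mult_le_one add: \<psi>_def)
      next
        case False
        then show ?thesis using test_function_zero_outside[OF \<eta>(1)] by (simp add: \<psi>_def)
      qed
      ultimately have "(LINT x|M. f x \<bullet> \<psi> x) \<le> T" using T by blast
      moreover have "f x \<bullet> \<psi> x = (1 / (1 + e)) * (\<eta> n x * (f x \<bullet> P x))" for x
        by (simp add: \<psi>_def)
      ultimately have "(1 / (1 + e)) * (LINT x|M. \<eta> n x * (f x \<bullet> P x)) \<le> T" by simp
      then show ?thesis using \<open>e > 0\<close> by (simp add: field_simps)
    qed
    have "(\<lambda>n. LINT x|M. \<eta> n x * (f x \<bullet> P x)) \<longlonglongrightarrow> (LINT x|M. f x \<bullet> P x)"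
    proof (rule integral_dominated_convergence[where w="\<lambda>x. norm (f x \<bullet> P x)"])
      show "AE x in M. (\<lambda>n. \<eta> n x * (f x \<bullet> P x)) \<longlonglongrightarrow> f x \<bullet> P x"
        using M(2)
      proof eventually_elim
        case (elim x)
        then show ?case using tendsto_mult[OF \<eta>(4) tendsto_const, of x "f x \<bullet> P x"] by simp
      qed
      show "AE x in M. norm (\<eta> n x * (f x \<bullet> P x)) \<le> norm (f x \<bullet> P x)" for n
        using \<eta>(2,3)[of n] by (intro AE_I2) (simp add: abs_mult mult_left_le_one_le)
    qed (use int_P \<eta>_meas in auto)
    then have *: "(LINT x|M. f x \<bullet> P x) \<le> (1 + e) * T"
      by (rule LIMSEQ_le_const2) (use \<eta>P in auto)
    have "(LINT x|M. f x \<bullet> \<xi> x) \<le> (LINT x|M. f x \<bullet> P x + e * norm (f x))"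
    proof (rule integral_mono_AE)
      show "AE x in M. f x \<bullet> \<xi> x \<le> f x \<bullet> P x + e * norm (f x)"
        using M(2)
      proof eventually_elim
        case (elim x)
        have "f x \<bullet> (\<xi> x - P x) \<le> norm (f x) * norm (\<xi> x - P x)" by (rule norm_cauchy_schwarz)
        also have "\<dots> \<le> norm (f x) * e" using close[OF elim] by (intro mult_left_mono) auto
        finally show ?case by (simp add: inner_diff_right mult.commute)
      qed
    qed (use int_\<xi> int_P f in auto)
    also have "\<dots> = (LINT x|M. f x \<bullet> P x) + e * (LINT x|M. norm (f x))"
      using int_P f by simp
    finally show ?thesis using * by simp
  qed
  have "(\<lambda>n. (1 + inverse (real (Suc n))) * T + inverse (real (Suc n)) * (LINT x|M. norm (f x)))
      \<longlonglongrightarrow> (1 + 0) * T + 0 * (LINT x|M. norm (f x))"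
    by (intro tendsto_intros LIMSEQ_inverse_real_of_nat)
  then show ?thesis
    by (intro LIMSEQ_le_const[of _ T]) (use bound in auto)
qed

text \<open>The field \<open>sgn (f x)\<close> attains the L1 norm but is only measurable. It is
  approximated in L1 by continuous fields, which are projected onto the unit ball to be admissible
  in the preceding lemma; a subsequence converges almost everywhere, and \<open>norm (f x)\<close>
  dominates.\<close>

lemma L1_norm_le_if_test_functions_le:
  fixes f :: "'a::euclidean_space \<Rightarrow> 'b::euclidean_space"
  assumes V: "open V" "bounded V" and M: "sets M = sets borel" "emeasure M UNIV < \<infinity>" "AE x in M. x \<in> V"
    and f: "integrable M f"
    and T: "\<And>\<psi>. \<psi> \<in> test_functions V \<Longrightarrow> (\<forall>x. norm (\<psi> x) \<le> 1) \<Longrightarrow> (LINT x|M. f x \<bullet> \<psi> x) \<le> T"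
  shows "(LINT x|M. norm (f x)) \<le> T"
proof -
  have "space M = UNIV" using M(1) by (simp add: sets_eq_imp_space_eq[of _ borel])
  then interpret finite_measure M by (intro finite_measureI) (use M(2) in auto)
  have meas: "h \<in> borel_measurable M" if "continuous_on UNIV h" for h :: "'a \<Rightarrow> 'b"
    using borel_measurable_continuous_onI[OF that] by (simp add: measurable_cong_sets[OF M(1) refl])
  have s_meas: "(\<lambda>x. sgn (f x)) \<in> borel_measurable M" using f by (auto simp: sgn_div_norm)
  then have s: "integrable M (\<lambda>x. sgn (f x))"
    by (intro integrable_const_bound[of _ 1]) (auto simp: norm_sgn)
  have "\<exists>\<xi>. continuous_on UNIV \<xi> \<and> integrable M \<xi> \<and> (LINT x|M. norm (sgn (f x) - \<xi> x)) < inverse (real (Suc n))" for n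
    using continuous_dense_L1[OF M(1,2) s] by simp
  then obtain g where g: "\<And>n. continuous_on UNIV (g n)" "\<And>n. integrable M (g n)"
    "\<And>n. (LINT x|M. norm (sgn (f x) - g n x)) < inverse (real (Suc n))" by metis
  \<comment> \<open>The projection onto the ball is 1-Lipschitz and fixes \<open>sgn (f x)\<close>,
    so it does not increase the distance of the approximants to \<open>sgn (f x)\<close>.\<close>
  let ?cp = "closest_point (cball (0 :: 'b) 1)"
  define \<xi> where "\<xi> n x = ?cp (g n x)" for n x
  have \<xi>_cont: "continuous_on UNIV (\<xi> n)" for n
    unfolding \<xi>_def by (rule continuous_on_compose2[OF continuous_on_closest_point g(1)]) auto
  have \<xi>_le: "norm (\<xi> n x) \<le> 1" for n x
    using closest_point_in_set[of "cball (0::'b) 1" "g n x"] by (simp add: \<xi>_def)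
  have int: "integrable M (\<lambda>x. \<xi> n x - sgn (f x))" for n
    by (intro Bochner_Integration.integrable_diff s integrable_const_bound[of _ 1] meas \<xi>_cont) (simp add: \<xi>_le)
  have close: "norm (\<xi> n x - sgn (f x)) \<le> norm (sgn (f x) - g n x)" for n x
  proof -
    have "?cp (sgn (f x)) = sgn (f x)" by (rule closest_point_self) (simp add: norm_sgn)
    then show ?thesis
      using closest_point_lipschitz[of "cball (0::'b) 1" "g n x" "sgn (f x)"]
      by (simp add: \<xi>_def dist_norm norm_minus_commute)
  qed
  have "(\<lambda>n. LINT x|M. norm (\<xi> n x - sgn (f x))) \<longlonglongrightarrow> 0"
  proof (rule tendsto_sandwich[OF _ _ tendsto_const LIMSEQ_inverse_real_of_nat])
    have "(LINT x|M. norm (\<xi> n x - sgn (f x))) \<le> (LINT x|M. norm (sgn (f x) - g n x))" for n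
      using int s g(2) close by (intro integral_mono) auto
    then show "\<forall>\<^sub>F n in sequentially. (LINT x|M. norm (\<xi> n x - sgn (f x))) \<le> inverse (real (Suc n))"
      using g(3) by (intro always_eventually allI) (meson less_imp_le order_trans)
  qed simp
  from tendsto_L1_AE_subseq[OF int this] obtain r :: "nat \<Rightarrow> nat" where
    r: "AE x in M. (\<lambda>n. \<xi> (r n) x - sgn (f x)) \<longlonglongrightarrow> 0" by blast
  have "(\<lambda>n. LINT x|M. f x \<bullet> \<xi> (r n) x) \<longlonglongrightarrow> (LINT x|M. norm (f x))"
  proof (rule integral_dominated_convergence[where w="\<lambda>x. norm (f x)"])
    show "AE x in M. (\<lambda>n. f x \<bullet> \<xi> (r n) x) \<longlonglongrightarrow> norm (f x)"
      using r
    proof eventually_elim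
      case (elim x)
      have "(\<lambda>n. f x \<bullet> \<xi> (r n) x) \<longlonglongrightarrow> f x \<bullet> sgn (f x)"
        by (intro tendsto_inner tendsto_const LIM_zero_cancel[OF elim])
      then show ?case
        by (cases "f x = 0") (simp_all add: sgn_div_norm dot_square_norm power2_eq_square flip: mult.assoc)
    qed
    show "AE x in M. norm (f x \<bullet> \<xi> (r n) x) \<le> norm (f x)" for n
    proof (rule AE_I2)
      fix x
      have "norm (f x \<bullet> \<xi> (r n) x) \<le> norm (f x) * norm (\<xi> (r n) x)" by (simp add: Cauchy_Schwarz_ineq2)
      also have "\<dots> \<le> norm (f x) * 1" by (intro mult_left_mono \<xi>_le) simp
      finally show "norm (f x \<bullet> \<xi> (r n) x) \<le> norm (f x)" by simp
    qed
  qed (use f meas[OF \<xi>_cont] in auto)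
  then show ?thesis
    by (rule LIMSEQ_le_const2)
      (use integral_inner_continuous_le[OF V M(1,3) f T \<xi>_cont \<xi>_le] in auto)
qed

text \<open>Localisation uses \<open>density M (indicator V)\<close> instead of a restricted space:
  the measurable sets remain all Borel sets of the whole space, as the duality lemmas
  require.\<close>

lemma integral_restricted:
  fixes f :: "'a \<Rightarrow> 'b::{banach, second_countable_topology}"
  assumes "V \<in> sets M" "f \<in> borel_measurable M"
  shows "(LINT x|density M (indicator V). f x) = (LINT x|M. indicator V x *\<^sub>R f x)"
  using integral_density[of f M "indicat_real V"] assms by (simp add: ennreal_indicator)

lemma integrable_lebesgue_on_indicator:
  fixes f :: "'a::euclidean_space \<Rightarrow> real"
  assumes "integrable lborel (\<lambda>x. f x * indicator S x)" and "S \<in> sets borel"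
  shows "integrable (lebesgue_on S) f"
proof -
  have "integrable lebesgue (\<lambda>x. indicator S x *\<^sub>R f x)"
    using assms(1) by (simp add: integrable_completion mult.commute)
  then show ?thesis using assms(2) by (simp add: integrable_restrict_space)
qed

lemma integrable_restricted:
  fixes f :: "'a \<Rightarrow> 'b::{banach, second_countable_topology}"
  assumes "V \<in> sets M" "f \<in> borel_measurable M"
  shows "integrable (density M (indicator V)) f \<longleftrightarrow> integrable M (\<lambda>x. indicator V x *\<^sub>R f x)"
  using integrable_density[of f M "indicat_real V"] assms by (simp add: ennreal_indicator)

text \<open>The bridge from the Lebesgue integrals over a set in the definitions to Borel integrals
  over the whole space, where the computations take place.\<close>

lemma integral_lebesgue_on_borel:
  fixes f :: "'a::euclidean_space \<Rightarrow> 'b::{banach, second_countable_topology}"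
  assumes "f \<in> borel_measurable borel" and "S \<in> sets borel"
  shows "(LINT x|lebesgue_on S. f x) = (LBINT x. indicator S x *\<^sub>R f x)"
  using assms by (simp add: integral_restrict_space integral_completion)

lemma L1_norm_lebesgue_le_if_test_functions_le:
  fixes f :: "'a::euclidean_space \<Rightarrow> 'b::euclidean_space"
  assumes V: "open V" "bounded V" and f: "integrable lborel f"
    and T: "\<And>\<psi>. \<psi> \<in> test_functions V \<Longrightarrow> (\<forall>x. norm (\<psi> x) \<le> 1) \<Longrightarrow>
      (LINT x|lebesgue_on V. f x \<bullet> \<psi> x) \<le> T"
  shows "(LINT x|lebesgue_on V. norm (f x)) \<le> T"
proof -
  let ?M = "density lborel (indicator V) :: 'a measure"
  have V': "V \<in> sets borel" using V by simp
  have f_meas: "f \<in> borel_measurable borel" using borel_measurable_integrable[OF f] by simp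
  have eq: "(LINT x|?M. h x) = (LINT x|lebesgue_on V. h x)" if "h \<in> borel_measurable borel" for h :: "'a \<Rightarrow> real"
    using that V' by (simp add: integral_restricted integral_lebesgue_on_borel)
  have "(LINT x|?M. norm (f x)) \<le> T"
  proof (rule L1_norm_le_if_test_functions_le[OF V])
    show "emeasure ?M UNIV < \<infinity>" using emeasure_bounded_finite[OF V(2)] V' by (simp add: emeasure_restricted)
    show "AE x in ?M. x \<in> V" using V' by (simp add: AE_density indicator_def)
    show "integrable ?M f" using f_meas V' integrable_mult_indicator[OF _ f, of V] by (simp add: integrable_restricted)
    fix \<psi> :: "'a \<Rightarrow> 'b"
    assume \<psi>: "\<psi> \<in> test_functions V" "\<forall>x. norm (\<psi> x) \<le> 1"
    show "(LINT x|?M. f x \<bullet> \<psi> x) \<le> T"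
      using T[OF \<psi>] f_meas test_function_measurable[OF \<psi>(1)] by (simp add: eq)
  qed simp
  then show ?thesis using f_meas by (simp add: eq)
qed

lemma integrable_bounded_mult:
  fixes s h :: "'a \<Rightarrow> real"
  assumes "integrable M s" and "h \<in> borel_measurable M" and "AE x in M. \<bar>h x\<bar> \<le> B"
  shows "integrable M (\<lambda>x. h x * s x)"
proof (rule Bochner_Integration.integrable_bound[of _ "\<lambda>x. B * \<bar>s x\<bar>"])
  show "(\<lambda>x. h x * s x) \<in> borel_measurable M" using assms by measurable
  show "AE x in M. norm (h x * s x) \<le> norm (B * \<bar>s x\<bar>)"
    using assms(3)
    by eventually_elim (simp add: abs_mult mult_right_mono)
qed (use assms in auto)

lemma integrable_mult_bounded:
  fixes s h :: "'a \<Rightarrow> real"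
  shows "integrable M s \<Longrightarrow> h \<in> borel_measurable M \<Longrightarrow> AE x in M. \<bar>h x\<bar> \<le> B \<Longrightarrow> integrable M (\<lambda>x. s x * h x)"
  using integrable_bounded_mult[of M s h B] by (simp add: mult.commute)

subsection \<open>Uniqueness of the derivative measure\<close>

lemma smooth_divergence: "smooth \<psi> \<Longrightarrow> smooth (divergence \<psi>)"
  unfolding divergence_def[abs_def]
  by (rule smooth_sum, rule smooth_linear_compose[OF bounded_linear_inner_left], rule smooth_frechet_derivative)

text \<open>The function enters the predicate only under an integral. This is needed because
  integrality of the lifted minimiser is given only almost everywhere.\<close>

lemma is_derivative_measure_cong:
  fixes v w :: "'a::euclidean_space \<Rightarrow> real"
  assumes "AE z in lebesgue_on U. v z = w z"
    and "v \<in> borel_measurable (lebesgue_on U)" "w \<in> borel_measurable (lebesgue_on U)"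
  shows "is_derivative_measure U v = is_derivative_measure U w"
proof -
  have eq: "(LINT z|lebesgue_on U. v z * divergence \<psi> z) = (LINT z|lebesgue_on U. w z * divergence \<psi> z)"
    if "\<psi> \<in> test_functions U" for \<psi>
  proof (rule integral_cong_AE)
    have d: "divergence \<psi> \<in> borel_measurable (lebesgue_on U)"
      by (intro continuous_imp_measurable_lebesgue_on smooth_imp_continuous smooth_divergence
          test_functions_smooth[OF that])
    show "(\<lambda>z. v z * divergence \<psi> z) \<in> borel_measurable (lebesgue_on U)"
      and "(\<lambda>z. w z * divergence \<psi> z) \<in> borel_measurable (lebesgue_on U)"
      by (intro borel_measurable_times d assms)+
    show "AE z in lebesgue_on U. v z * divergence \<psi> z = w z * divergence \<psi> z"
      using assms(1) by eventually_elim simp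
  qed
  show ?thesis
  proof (intro ext)
    fix \<mu> \<sigma>
    have "(\<forall>\<psi>\<in>test_functions U. (LINT z|lebesgue_on U. v z * divergence \<psi> z) = - (LINT z|\<mu>. \<psi> z \<bullet> \<sigma> z)) \<longleftrightarrow>
      (\<forall>\<psi>\<in>test_functions U. (LINT z|lebesgue_on U. w z * divergence \<psi> z) = - (LINT z|\<mu>. \<psi> z \<bullet> \<sigma> z))"
      by (rule ball_cong[OF refl]) (simp only: eq)
    then show "is_derivative_measure U v \<mu> \<sigma> = is_derivative_measure U w \<mu> \<sigma>"
      unfolding is_derivative_measure_def by (simp only:)
  qed
qed

text \<open>A derivative measure is only locally finite. Its restriction to an open subset of a
  compact set is finite, so that \<sigma> is integrable and the duality lemma applies; test
  functions on \<open>V\<close> do not notice the restriction.\<close>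

lemma derivative_measure_restricted:
  fixes U :: "'a::euclidean_space set"
  assumes d: "is_derivative_measure U v \<mu> \<sigma>" and K: "compact K" "K \<subseteq> U" and V: "open V" "V \<subseteq> K"
  defines "M \<equiv> density \<mu> (indicator V)"
  shows "sets M = sets borel" "emeasure M UNIV < \<infinity>" "AE z in M. z \<in> V" "AE z in M. norm (\<sigma> z) = 1"
    "\<And>A. A \<in> sets borel \<Longrightarrow> emeasure M A = emeasure \<mu> (A \<inter> V)" "integrable M \<sigma>"
    "\<And>\<psi>. \<psi> \<in> test_functions V \<Longrightarrow>
      (LINT z|lebesgue_on U. v z * divergence \<psi> z) = - (LINT z|M. \<sigma> z \<bullet> \<psi> z)"
proof -
  have sets: "sets \<mu> = sets borel" and \<sigma>: "\<sigma> \<in> borel_measurable borel" and norm: "AE z in \<mu>. norm (\<sigma> z) = 1"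
    and fin: "emeasure \<mu> K < \<infinity>"
    using d K by (simp_all add: is_derivative_measure_def)
  have V': "V \<in> sets \<mu>" using V(1) by (simp add: sets)
  have \<sigma>\<mu>: "\<sigma> \<in> borel_measurable \<mu>" using \<sigma> by (simp add: measurable_cong_sets[OF sets refl])
  show sets_M: "sets M = sets borel" by (simp add: M_def sets)
  show em: "emeasure M A = emeasure \<mu> (A \<inter> V)" if "A \<in> sets borel" for A
    using that V' unfolding M_def by (subst emeasure_restricted) (simp_all add: sets Int_commute)
  have "emeasure \<mu> V \<le> emeasure \<mu> K"
    using V K by (intro emeasure_mono) (simp_all add: sets compact_imp_closed)
  with fin show fin_M: "emeasure M UNIV < \<infinity>" by (simp add: em)
  have AE_M: "(AE z in M. P z) \<longleftrightarrow> (AE z in \<mu>. z \<in> V \<longrightarrow> P z)" for P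
    unfolding M_def using V' by (subst AE_density) (auto simp: indicator_def)
  show "AE z in M. z \<in> V" by (simp add: AE_M)
  show norm_M: "AE z in M. norm (\<sigma> z) = 1"
    unfolding AE_M using norm by eventually_elim simp
  have "space M = UNIV" using sets_M by (simp add: sets_eq_imp_space_eq[of _ borel])
  then interpret finite_measure M by (intro finite_measureI) (use fin_M in auto)
  show "integrable M \<sigma>"
    using norm_M \<sigma> by (intro integrable_const_bound[of _ 1])
      (auto simp: measurable_cong_sets[OF sets_M refl] elim: eventually_mono)
  fix \<psi> :: "'a \<Rightarrow> 'a"
  assume \<psi>: "\<psi> \<in> test_functions V"
  have "\<psi> \<in> test_functions U" using \<psi> test_functions_mono[of V U] V K by blast
  then have "(LINT z|lebesgue_on U. v z * divergence \<psi> z) = - (LINT z|\<mu>. \<psi> z \<bullet> \<sigma> z)"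
    using d by (simp add: is_derivative_measure_def)
  also have "(LINT z|\<mu>. \<psi> z \<bullet> \<sigma> z) = (LINT z|\<mu>. indicator V z *\<^sub>R (\<sigma> z \<bullet> \<psi> z))"
  proof (rule Bochner_Integration.integral_cong[OF refl])
    show "\<psi> z \<bullet> \<sigma> z = indicator V z *\<^sub>R (\<sigma> z \<bullet> \<psi> z)" for z
      using test_function_zero_outside[OF \<psi>, of z] by (cases "z \<in> V") (simp_all add: inner_commute)
  qed
  also have "\<dots> = (LINT z|M. \<sigma> z \<bullet> \<psi> z)"
    using test_function_measurable[OF \<psi>] \<sigma>\<mu> V' unfolding M_def
    by (intro integral_restricted[symmetric]) (simp_all add: measurable_cong_sets[OF sets refl])
  finally show "(LINT z|lebesgue_on U. v z * divergence \<psi> z) = - (LINT z|M. \<sigma> z \<bullet> \<psi> z)" .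
qed

text \<open>The mass of an open set is the supremum of \<open>\<integral> \<sigma> \<bullet> \<psi>\<close> over test functions \<open>\<psi>\<close> bounded by one,
  which is determined by \<open>v\<close>.\<close>

lemma emeasure_derivative_measure_le:
  fixes U :: "'a::euclidean_space set"
  assumes d: "is_derivative_measure U v \<mu> \<sigma>" "is_derivative_measure U v \<mu>' \<sigma>'"
    and K: "compact K" "K \<subseteq> U" and V: "open V" "V \<subseteq> K"
  shows "emeasure \<mu> V \<le> emeasure \<mu>' V"
proof -
  define M where "M = density \<mu> (indicator V)"
  define M' where "M' = density \<mu>' (indicator V)"
  note D = derivative_measure_restricted[OF d(1) K V, folded M_def]
  note D' = derivative_measure_restricted[OF d(2) K V, folded M'_def]
  have sp: "space M = UNIV" "space M' = UNIV" using D(1) D'(1) by (simp_all add: sets_eq_imp_space_eq[of _ borel])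
  interpret M: finite_measure M by (rule finite_measureI) (use D(2) sp in auto)
  interpret M': finite_measure M' by (rule finite_measureI) (use D'(2) sp in auto)
  have V_bdd: "bounded V" using compact_imp_bounded[OF K(1)] V(2) by (rule bounded_subset)
  have "measure M UNIV = (LINT z|M. norm (\<sigma> z))"
  proof -
    have "(LINT z|M. norm (\<sigma> z)) = (LINT z|M. 1)"
      using D(4) D(6) by (intro integral_cong_AE) auto
    then show ?thesis by (simp add: sp)
  qed
  also have "\<dots> \<le> measure M' UNIV"
  proof (rule L1_norm_le_if_test_functions_le[OF V(1) V_bdd D(1,2,3,6)])
    fix \<psi> :: "'a \<Rightarrow> 'a"
    assume \<psi>: "\<psi> \<in> test_functions V" "\<forall>z. norm (\<psi> z) \<le> 1"
    have "(LINT z|M. \<sigma> z \<bullet> \<psi> z) = (LINT z|M'. \<sigma>' z \<bullet> \<psi> z)" using D(7)[OF \<psi>(1)] D'(7)[OF \<psi>(1)] by simp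
    also have "\<dots> \<le> (LINT z|M'. 1)"
    proof (rule integral_mono_AE)
      show "integrable M' (\<lambda>z. \<sigma>' z \<bullet> \<psi> z)"
        using \<psi>(2) test_function_measurable[OF \<psi>(1)]
        by (intro integrable_inner_bounded[OF D'(6), of _ 1]) (simp_all add: measurable_cong_sets[OF D'(1) refl])
      show "AE z in M'. \<sigma>' z \<bullet> \<psi> z \<le> 1"
        using D'(4)
      proof eventually_elim
        case (elim z)
        then show ?case using norm_cauchy_schwarz[of "\<sigma>' z" "\<psi> z"] \<psi>(2)[rule_format, of z] by simp
      qed
    qed simp
    finally show "(LINT z|M. \<sigma> z \<bullet> \<psi> z) \<le> measure M' UNIV" by (simp add: sp)
  qed
  finally have "emeasure M UNIV \<le> emeasure M' UNIV"
    by (simp add: M.emeasure_eq_measure M'.emeasure_eq_measure)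
  then show ?thesis by (simp add: D(5) D'(5))
qed

text \<open>The mass comparison, used in both directions, gives equality on open sets, which
  generate the Borel sets and are stable under intersection. Over the common measure, the difference
  of the two directions annihilates every test function, so its L1 norm vanishes by duality.\<close>

lemma derivative_measure_unique_local:
  fixes U :: "'a::euclidean_space set"
  assumes d: "is_derivative_measure U v \<mu> \<sigma>" "is_derivative_measure U v \<mu>' \<sigma>'"
    and K: "compact K" "K \<subseteq> U" and V: "open V" "V \<subseteq> K"
  shows "density \<mu> (indicator V) = density \<mu>' (indicator V)"
    and "AE z in density \<mu>' (indicator V). \<sigma> z = \<sigma>' z"
proof -
  define M where "M = density \<mu> (indicator V)"
  define M' where "M' = density \<mu>' (indicator V)"
  note D = derivative_measure_restricted[OF d(1) K V, folded M_def]
  note D' = derivative_measure_restricted[OF d(2) K V, folded M'_def]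
  have eq: "M = M'"
  proof (rule measure_eqI_generator_eq[of "{S. open S}" UNIV _ _ "\<lambda>_. UNIV"])
    fix W :: "'a set"
    assume "W \<in> {S. open S}"
    then have W: "open (W \<inter> V)" "W \<inter> V \<subseteq> K" "W \<in> sets borel" using V by auto
    have "emeasure \<mu> (W \<inter> V) = emeasure \<mu>' (W \<inter> V)"
      by (intro antisym emeasure_derivative_measure_le[OF d K W(1,2)] emeasure_derivative_measure_le[OF d(2,1) K W(1,2)])
    then show "emeasure M W = emeasure M' W" by (simp add: D(5) D'(5) W(3))
  qed (use D(1,2) D'(1) in \<open>auto simp: Int_stable_def borel_def\<close>)
  then show "density \<mu> (indicator V) = density \<mu>' (indicator V)" by (simp only: M_def M'_def)
  have V_bdd: "bounded V" using compact_imp_bounded[OF K(1)] V(2) by (rule bounded_subset)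
  have \<sigma>: "integrable M' \<sigma>" using D(6) by (simp only: eq)
  have int: "integrable M' (\<lambda>z. \<sigma> z - \<sigma>' z)" using \<sigma> D'(6) by simp
  have "(LINT z|M'. norm (\<sigma> z - \<sigma>' z)) \<le> 0"
  proof (rule L1_norm_le_if_test_functions_le[OF V(1) V_bdd D'(1,2,3) int])
    fix \<psi> :: "'a \<Rightarrow> 'a"
    assume \<psi>: "\<psi> \<in> test_functions V" "\<forall>z. norm (\<psi> z) \<le> 1"
    have "integrable M' (\<lambda>z. s z \<bullet> \<psi> z)" if "integrable M' s" for s
      using \<psi>(2) test_function_measurable[OF \<psi>(1)]
      by (intro integrable_inner_bounded[OF that, of _ 1]) (simp_all add: measurable_cong_sets[OF D'(1) refl])
    then have "(LINT z|M'. (\<sigma> z - \<sigma>' z) \<bullet> \<psi> z) = (LINT z|M'. \<sigma> z \<bullet> \<psi> z) - (LINT z|M'. \<sigma>' z \<bullet> \<psi> z)"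
      using \<sigma> D'(6) by (simp add: inner_diff_left)
    also have "\<dots> = 0" using D(7)[OF \<psi>(1)] D'(7)[OF \<psi>(1)] by (simp add: eq)
    finally show "(LINT z|M'. (\<sigma> z - \<sigma>' z) \<bullet> \<psi> z) \<le> 0" by simp
  qed
  then have "(LINT z|M'. norm (\<sigma> z - \<sigma>' z)) = 0" by (intro antisym) simp_all
  then have "AE z in M'. norm (\<sigma> z - \<sigma>' z) = 0"
    using int by (subst (asm) integral_nonneg_eq_0_iff_AE) auto
  then show "AE z in density \<mu>' (indicator V). \<sigma> z = \<sigma>' z"
    unfolding M'_def[symmetric] by simp
qed

text \<open>\<open>U\<close> is exhausted by open sets lying in compact subsets, where the local
  result holds, and both measures vanish outside \<open>U\<close>.\<close>

lemma derivative_measure_unique: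
  fixes U :: "'a::euclidean_space set"
  assumes "open U" and d: "is_derivative_measure U v \<mu> \<sigma>" "is_derivative_measure U v \<mu>' \<sigma>'"
  shows "\<mu> = \<mu>'" and "AE z in \<mu>'. \<sigma> z = \<sigma>' z"
proof -
  obtain C where C: "\<And>n. compact (C n)" "\<And>n. C n \<subseteq> U" "\<And>n. C n \<subseteq> interior (C (Suc n))" "\<Union>(range C) = U"
    using open_Union_compact_subsets[OF \<open>open U\<close>] by metis
  \<comment> \<open>With the shift by one, \<open>V n\<close> contains \<open>C n\<close>, so these
    open sets cover \<open>U\<close>, while \<open>V n\<close> still lies in the compact set
    \<open>C (Suc n)\<close>.\<close>
  define V where "V n = interior (C (Suc n))" for n
  have V: "open (V n)" "V n \<subseteq> C (Suc n)" for n
    by (simp_all add: V_def interior_subset)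
  have UV: "(\<Union>n. V n) = U"
    using C(2,3,4) V unfolding V_def by blast
  have "C n \<subseteq> C (Suc n)" for n using C(3)[of n] interior_subset by blast
  then have incV: "incseq V" unfolding V_def by (intro incseq_SucI interior_mono)
  note loc = derivative_measure_unique_local[OF d C(1,2) V]
  have loc_eq: "emeasure \<mu> (A \<inter> V n) = emeasure \<mu>' (A \<inter> V n)" if "A \<in> sets borel" for A n
    using arg_cong[OF loc(1)[of n], of "\<lambda>M. emeasure M A"] that
    by (simp add: derivative_measure_restricted(5)[OF d(1) C(1,2) V] derivative_measure_restricted(5)[OF d(2) C(1,2) V])
  have sets: "sets \<mu> = sets borel" "sets \<mu>' = sets borel"
    and null: "emeasure \<mu> (- U) = 0" "emeasure \<mu>' (- U) = 0"
    using d by (simp_all add: is_derivative_measure_def)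
  have U: "U \<in> sets borel" using \<open>open U\<close> by simp
  have decomp: "emeasure M A = (SUP n. emeasure M (A \<inter> V n))"
    if M: "sets M = sets borel" and null: "emeasure M (- U) = 0" and A: "A \<in> sets borel" for M :: "'a measure" and A
  proof -
    have "AE x in M. x \<in> U"
      using null U by (intro AE_I[of _ _ "- U"]) (auto simp: M)
    then have "emeasure M A = emeasure M (\<Union>n. A \<inter> V n)"
      using A UV by (intro emeasure_eq_AE) (auto simp: M V(1))
    also have "\<dots> = (SUP n. emeasure M (A \<inter> V n))"
      using A V(1) incV by (intro SUP_emeasure_incseq[symmetric]) (auto simp: M incseq_def)
    finally show ?thesis .
  qed
  show "\<mu> = \<mu>'"
  proof (rule measure_eqI)
    show "sets \<mu> = sets \<mu>'" by (simp add: sets)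
    fix A assume "A \<in> sets \<mu>"
    then have "A \<in> sets borel" by (simp add: sets)
    then show "emeasure \<mu> A = emeasure \<mu>' A"
      using decomp[OF sets(1) null(1)] decomp[OF sets(2) null(2)] loc_eq by simp
  qed
  have "AE z in \<mu>'. z \<in> V n \<longrightarrow> \<sigma> z = \<sigma>' z" for n
  proof -
    have "V n \<in> sets \<mu>'" using V(1) by (simp add: sets)
    then show ?thesis using loc(2)[of n] by (subst (asm) AE_density) (auto simp: indicator_def)
  qed
  then have "AE z in \<mu>'. \<forall>n. z \<in> V n \<longrightarrow> \<sigma> z = \<sigma>' z" by (simp only: AE_all_countable) blast
  moreover have "AE z in \<mu>'. z \<in> U"
    using null U by (intro AE_I[of _ _ "- U"]) (auto simp: sets)
  ultimately show "AE z in \<mu>'. \<sigma> z = \<sigma>' z"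
  proof eventually_elim
    case (elim z)
    then obtain n where "z \<in> V n" using UV by blast
    with elim show ?case by blast
  qed
qed

subsection \<open>Translations and difference quotients\<close>

lemma test_function_derivative:
  assumes "\<phi> \<in> test_functions U"
  shows "(\<lambda>x. frechet_derivative \<phi> (at x) h) \<in> test_functions U"
proof -
  obtain K where K: "compact K" "K \<subseteq> U" and 0: "\<forall>x. x \<notin> K \<longrightarrow> \<phi> x = 0"
    by (rule test_functionsE[OF assms])
  show ?thesis
  proof (rule test_functionsI[OF _ K])
    show "smooth (\<lambda>x. frechet_derivative \<phi> (at x) h)"
      by (rule smooth_frechet_derivative[OF test_functions_smooth[OF assms]])
    show "frechet_derivative \<phi> (at x) h = 0" if "x \<notin> K" for x
    proof -
      have "(\<phi> has_derivative (\<lambda>h. 0)) (at x)"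
      proof (rule has_derivative_transform_within_open[of "\<lambda>_. 0"])
        show "open (- K)" using K by (simp add: compact_imp_closed open_Compl)
        show "x \<in> - K" using that by simp
      qed (use 0 in auto)
      then show ?thesis using frechet_derivative_at by metis
    qed
  qed
qed

lemma test_function_divergence:
  assumes "\<psi> \<in> test_functions U"
  shows "divergence \<psi> \<in> test_functions U"
proof -
  obtain K where K: "compact K" "K \<subseteq> U" and 0: "\<forall>x. x \<notin> K \<longrightarrow> \<psi> x = 0"
    by (rule test_functionsE[OF assms])
  \<comment> \<open>With the support set \<open>K\<close> itself as the domain, vanishing outside
    the domain means vanishing outside \<open>K\<close>, and this passes to the derivatives.\<close>
  have "\<psi> \<in> test_functions K" by (rule test_functionsI[OF test_functions_smooth[OF assms] K(1)]) (use 0 in auto)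
  note D = test_function_zero_outside[OF test_function_derivative[OF this]]
  show ?thesis
    by (rule test_functionsI[OF smooth_divergence[OF test_functions_smooth[OF assms]] K]) (simp add: divergence_def D)
qed

lemma test_function_bounded:
  assumes "\<phi> \<in> test_functions U"
  obtains B where "B > 0" "\<forall>x. norm (\<phi> x) \<le> B"
proof -
  obtain K where K: "compact K" "K \<subseteq> U" and 0: "\<forall>x. x \<notin> K \<longrightarrow> \<phi> x = 0"
    by (rule test_functionsE[OF assms])
  have "compact (\<phi> ` K)"
    by (rule compact_continuous_image[OF test_function_continuous[OF assms] K(1)])
  then obtain B where B: "B > 0" "\<forall>y\<in>\<phi> ` K. norm y \<le> B"
    using compact_imp_bounded bounded_pos by metis
  have "norm (\<phi> x) \<le> B" for x
    using B 0[rule_format, of x] by (cases "x \<in> K") auto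
  with B(1) that show ?thesis by blast
qed

lemma test_function_integrable:
  fixes \<phi> :: "'a::euclidean_space \<Rightarrow> real"
  assumes "\<phi> \<in> test_functions U"
  shows "integrable lborel \<phi>"
proof -
  obtain K where K: "compact K" "K \<subseteq> U" and 0: "\<forall>x. x \<notin> K \<longrightarrow> \<phi> x = 0"
    by (rule test_functionsE[OF assms])
  have "integrable lborel (\<lambda>x. indicator K x *\<^sub>R \<phi> x)"
    by (rule borel_integrable_compact[OF K(1) test_function_continuous[OF assms]])
  moreover have "(\<lambda>x. indicator K x *\<^sub>R \<phi> x) = \<phi>"
  proof
    fix x
    show "indicator K x *\<^sub>R \<phi> x = \<phi> x" using 0[rule_format, of x] by (cases "x \<in> K") auto
  qed
  ultimately show ?thesis by simp
qed

lemma integrable_mult_test_function: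
  fixes f \<phi> :: "'a::euclidean_space \<Rightarrow> real"
  assumes f: "integrable lborel f" and \<phi>: "\<phi> \<in> test_functions U"
  shows "integrable lborel (\<lambda>x. f x * \<phi> x)"
proof -
  obtain B where "B > 0" "\<forall>x. norm (\<phi> x) \<le> B" by (rule test_function_bounded[OF \<phi>])
  then show ?thesis
    using test_function_measurable[OF \<phi>] by (intro integrable_mult_bounded[OF f, where B=B]) auto
qed

lemma integrable_indicator_bounded:
  "S \<in> sets borel \<Longrightarrow> bounded S \<Longrightarrow> integrable lborel (indicat_real S)"
  for S :: "'a::euclidean_space set"
  by (intro integrable_real_indicator emeasure_bounded_finite) simp_all

lemma integral_lebesgue_on_supported:
  fixes f :: "'a::euclidean_space \<Rightarrow> 'b::{banach, second_countable_topology}"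
  assumes "f \<in> borel_measurable borel" and "S \<in> sets borel" and "\<And>x. x \<notin> S \<Longrightarrow> f x = 0"
  shows "(LINT x|lebesgue_on S. f x) = (LBINT x. f x)"
  unfolding integral_lebesgue_on_borel[OF assms(1,2)]
  using assms(3) by (intro Bochner_Integration.integral_cong refl) (simp add: indicator_def)

lemma test_function_translate:
  assumes "\<phi> \<in> test_functions U" and "\<And>x. x \<in> U \<Longrightarrow> x + c \<in> V"
  shows "(\<lambda>x. \<phi> (x - c)) \<in> test_functions V"
proof -
  obtain K where K: "compact K" "K \<subseteq> U" and 0: "\<forall>x. x \<notin> K \<longrightarrow> \<phi> x = 0"
    by (rule test_functionsE[OF assms(1)])
  show ?thesis
  proof (rule test_functionsI)
    show "smooth (\<lambda>x. \<phi> (x - c))"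
      using smooth_affine_compose[OF bounded_linear_ident test_functions_smooth[OF assms(1)], of "- c"]
      by simp
    show "compact ((+) c ` K)" by (rule compact_translation[OF K(1)])
    show "(+) c ` K \<subseteq> V" using K(2) assms(2) by (auto simp: add.commute)
    show "\<phi> (x - c) = 0" if "x \<notin> (+) c ` K" for x
    proof -
      have "x - c \<notin> K" using that by (metis add.commute diff_add_cancel image_eqI)
      then show ?thesis using 0 by blast
    qed
  qed
qed

lemma integral_translate:
  fixes f :: "'a::euclidean_space \<Rightarrow> real"
  assumes "f \<in> borel_measurable borel"
  shows "(LBINT x. f (x + c)) = (LBINT x. f x)"
proof -
  have "(LINT x|distr lborel borel ((+) c). f x) = (LBINT x. f (c + x))"
    using assms by (intro integral_distr) simp_all
  then show ?thesis by (simp add: lborel_distr_plus add.commute)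
qed

lemma integrable_translate:
  fixes f :: "'a::euclidean_space \<Rightarrow> real"
  assumes "integrable lborel f"
  shows "integrable lborel (\<lambda>x. f (x + c))"
proof -
  have "integrable (distr lborel borel ((+) c)) f" using assms by (simp add: lborel_distr_plus)
  then have "integrable lborel (\<lambda>x. f (c + x))" by (rule integrable_distr[rotated]) simp
  then show ?thesis by (simp add: add.commute)
qed

text \<open>Continuous functions are dense in L1 of a ball and uniformly continuous on its closure;
  \<open>D\<close> measures the error of the approximation at the point and at the translated
  point.\<close>

lemma L1_translation_local:
  fixes f :: "'a::euclidean_space \<Rightarrow> real"
  assumes f: "integrable lborel f" and W: "W \<in> sets borel" "bounded W" and "c > 0"
  obtains d where "d > 0" "\<forall>y. norm y < d \<longrightarrow> (LBINT x. indicator W x * \<bar>f (x + y) - f x\<bar>) \<le> c"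
proof -
  obtain R where R: "W \<subseteq> ball 0 R" using bounded_subset_ballD[OF W(2), of 0] by blast
  \<comment> \<open>The margin 1 keeps \<open>x + y\<close> in the ball for \<open>x\<close> in
    \<open>W\<close> and \<open>norm y < 1\<close>.\<close>
  define B where "B = ball (0 :: 'a) (R + 1)"
  have B: "B \<in> sets borel" "bounded B" by (simp_all add: B_def)
  have f_meas: "f \<in> borel_measurable borel" using borel_measurable_integrable[OF f] by simp
  let ?M = "density lborel (indicator B) :: 'a measure"
  have M_fin: "emeasure ?M UNIV < \<infinity>"
    using emeasure_bounded_finite[OF B(2)] B(1) by (simp add: emeasure_restricted)
  have f_M: "integrable ?M f"
    using f_meas B integrable_mult_indicator[OF _ f, of B] by (simp add: integrable_restricted)
  have "sets ?M = sets borel" "c / 4 > 0" using \<open>c > 0\<close> by simp_all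
  then obtain \<xi> where \<xi>: "continuous_on UNIV \<xi>" "integrable ?M \<xi>" "(LINT x|?M. norm (f x - \<xi> x)) < c / 4"
    using continuous_dense_L1[OF _ M_fin f_M] by blast
  have \<xi>_meas: "\<xi> \<in> borel_measurable borel" by (rule borel_measurable_continuous_onI[OF \<xi>(1)])
  define D where "D x = indicator B x * \<bar>f x - \<xi> x\<bar>" for x
  have "integrable ?M (\<lambda>x. \<bar>f x - \<xi> x\<bar>)" using f_M \<xi>(2) by simp
  then have D_int: "integrable lborel D"
    using f_meas \<xi>_meas B by (subst (asm) integrable_restricted) (simp_all add: D_def[abs_def])
  have D_less: "(LBINT x. D x) < c / 4"
    using \<xi>(3) f_meas \<xi>_meas B by (subst (asm) integral_restricted) (simp_all add: D_def)
  have W_pos: "measure lborel W + 1 > 0" by (simp add: add_nonneg_pos)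
  \<comment> \<open>The budget is c/4 for each of the two integrals of \<open>D\<close> and c/2 for
    the oscillation of \<xi> over \<open>W\<close>; adding 1 to the measure avoids a division by
    zero.\<close>
  define k where "k = c / 2 / (measure lborel W + 1)"
  have k: "k > 0" "k * measure lborel W \<le> c / 2"
    using \<open>c > 0\<close> W_pos by (simp_all add: k_def divide_le_eq mult_left_mono)
  have "uniformly_continuous_on (cball 0 (R + 1)) \<xi>"
    by (rule compact_uniformly_continuous[OF continuous_on_subset[OF \<xi>(1)]]) auto
  then obtain d where d: "d > 0" "\<And>x y. x \<in> cball 0 (R + 1) \<Longrightarrow> y \<in> cball 0 (R + 1) \<Longrightarrow> dist y x < d \<Longrightarrow> dist (\<xi> y) (\<xi> x) < k"
    using k(1) unfolding uniformly_continuous_on_def by metis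
  have step: "indicator W x * \<bar>f (x + y) - f x\<bar> \<le> D (x + y) + k * indicator W x + D x" if y: "norm y < min d 1" for x y
  proof (cases "x \<in> W")
    case True
    then have "norm x < R" using R by auto
    then have xB: "x \<in> B" "x + y \<in> B" using y norm_triangle_ineq[of x y] by (auto simp: B_def)
    then have "\<bar>\<xi> (x + y) - \<xi> x\<bar> < k" using d(2)[of x "x + y"] y by (simp add: B_def dist_norm)
    with True xB show ?thesis by (simp add: D_def)
  qed (simp add: D_def)
  show ?thesis
  proof (rule that[of "min d 1"])
    show "\<forall>y. norm y < min d 1 \<longrightarrow> (LBINT x. indicator W x * \<bar>f (x + y) - f x\<bar>) \<le> c"
    proof (intro allI impI)
      fix y :: 'a assume y: "norm y < min d 1"
      note int = D_int integrable_translate[OF D_int, of y] integrable_indicator_bounded[OF W]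
      have "(LBINT x. indicator W x * \<bar>f (x + y) - f x\<bar>) \<le> (LBINT x. D (x + y) + k * indicator W x + D x)"
      proof (rule integral_mono')
        show "integrable lborel (\<lambda>x. D (x + y) + k * indicator W x + D x)" using int by simp
      qed (use step[OF y] k(1) in \<open>auto simp: D_def less_imp_le\<close>)
      also have "\<dots> = (LBINT x. D (x + y)) + k * measure lborel W + (LBINT x. D x)"
        using int W by simp
      also have "(LBINT x. D (x + y)) = (LBINT x. D x)"
        by (rule integral_translate) (use D_int in \<open>auto dest: borel_measurable_integrable\<close>)
      finally show "(LBINT x. indicator W x * \<bar>f (x + y) - f x\<bar>) \<le> c" using D_less k(2) by linarith
    qed
  qed (use d in simp)
qed

lemma DERIV_test_function_line:
  fixes \<phi> :: "'a::euclidean_space \<Rightarrow> real"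
  assumes "smooth \<phi>"
  shows "((\<lambda>s. \<phi> (x - s *\<^sub>R e)) has_field_derivative - frechet_derivative \<phi> (at (x - s *\<^sub>R e)) e) (at s)"
proof -
  let ?F = "frechet_derivative \<phi> (at (x - s *\<^sub>R e))"
  have F: "(\<phi> has_derivative ?F) (at (x - s *\<^sub>R e))" by (rule smooth_has_derivative[OF assms])
  have "((\<lambda>s. x - s *\<^sub>R e) has_derivative (\<lambda>h. - (h *\<^sub>R e))) (at s)"
    by (auto intro!: derivative_eq_intros)
  from diff_chain_at[OF this F] have "((\<lambda>s. \<phi> (x - s *\<^sub>R e)) has_derivative (\<lambda>h. ?F (- (h *\<^sub>R e)))) (at s)"
    by (simp add: o_def)
  moreover have "?F (- (h *\<^sub>R e)) = - ?F e * h" for h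
  proof -
    have "linear ?F" by (rule has_derivative_linear[OF F])
    then show ?thesis by (simp add: linear_neg linear_scale)
  qed
  then have "(\<lambda>h. ?F (- (h *\<^sub>R e))) = (*) (- ?F e)" by (intro ext)
  ultimately show ?thesis by (simp only: has_field_derivative_def)
qed

text \<open>Integrability of \<open>u\<close> is enough because the derivative falls on \<phi>: its
  difference quotients along \<open>e\<close> are bounded by the supremum of the directional
  derivative, which gives a dominating function.\<close>

lemma DERIV_integral_translate:
  fixes u :: "'a::euclidean_space \<Rightarrow> real"
  assumes u: "integrable lborel u" and \<phi>: "\<phi> \<in> test_functions U"
  shows "((\<lambda>s. LBINT x. u x * \<phi> (x - s *\<^sub>R e)) has_field_derivative
    - (LBINT x. u x * frechet_derivative \<phi> (at (x - s *\<^sub>R e)) e)) (at s)"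
proof -
  let ?D = "\<lambda>x. frechet_derivative \<phi> (at x) e"
  have D: "?D \<in> test_functions U" by (rule test_function_derivative[OF \<phi>])
  obtain B where B: "B > 0" "\<forall>x. norm (?D x) \<le> B" by (rule test_function_bounded[OF D])
  note [measurable] = test_function_measurable[OF \<phi>] test_function_measurable[OF D]
  have [measurable]: "u \<in> borel_measurable borel" using borel_measurable_integrable[OF u] by simp
  note deriv = DERIV_test_function_line[OF test_functions_smooth[OF \<phi>], of _ e]
  have lip: "\<bar>\<phi> (x - s' *\<^sub>R e) - \<phi> (x - s *\<^sub>R e)\<bar> \<le> B * \<bar>s' - s\<bar>" for x s s'
    using field_differentiable_bound[OF convex_UNIV has_field_derivative_at_within[OF deriv], where B=B and x=s' and y=s]
      B(2) by simp
  have int: "integrable lborel (\<lambda>x. u x * \<phi> (x - s *\<^sub>R e))" for s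
    by (rule integrable_mult_test_function[OF u test_function_translate[OF \<phi>, of _ UNIV]]) simp
  show ?thesis
    unfolding DERIV_def tendsto_at_iff_sequentially
  proof (intro allI impI)
    fix X :: "nat \<Rightarrow> real"
    assume X: "\<forall>i. X i \<in> UNIV - {0}" "X \<longlonglongrightarrow> 0"
    have lim: "(\<lambda>i. LBINT x. u x * ((\<phi> (x - (s + X i) *\<^sub>R e) - \<phi> (x - s *\<^sub>R e)) / X i))
       \<longlonglongrightarrow> (LBINT x. u x * (- ?D (x - s *\<^sub>R e)))"
    proof (rule integral_dominated_convergence[where w="\<lambda>x. B * \<bar>u x\<bar>"])
      show "integrable lborel (\<lambda>x. B * \<bar>u x\<bar>)" using u by simp
      show "AE x in lborel. (\<lambda>i. u x * ((\<phi> (x - (s + X i) *\<^sub>R e) - \<phi> (x - s *\<^sub>R e)) / X i))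
          \<longlonglongrightarrow> u x * (- ?D (x - s *\<^sub>R e))"
      proof (intro AE_I2 tendsto_mult tendsto_const)
        fix x :: 'a
        have "((\<lambda>h. (\<phi> (x - (s + h) *\<^sub>R e) - \<phi> (x - s *\<^sub>R e)) / h) \<longlongrightarrow> - ?D (x - s *\<^sub>R e)) (at 0)"
          using deriv[of x s] unfolding DERIV_def .
        then show "(\<lambda>i. (\<phi> (x - (s + X i) *\<^sub>R e) - \<phi> (x - s *\<^sub>R e)) / X i) \<longlonglongrightarrow> - ?D (x - s *\<^sub>R e)"
          using X unfolding tendsto_at_iff_sequentially by (auto simp: o_def)
      qed
      show "AE x in lborel. norm (u x * ((\<phi> (x - (s + X i) *\<^sub>R e) - \<phi> (x - s *\<^sub>R e)) / X i)) \<le> B * \<bar>u x\<bar>" for i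
      proof (intro AE_I2)
        fix x :: 'a
        have "\<bar>\<phi> (x - (s + X i) *\<^sub>R e) - \<phi> (x - s *\<^sub>R e)\<bar> / \<bar>X i\<bar> \<le> B"
          using lip[of x "s + X i" s] X(1) by (simp add: divide_le_eq)
        then have "\<bar>u x\<bar> * (\<bar>\<phi> (x - (s + X i) *\<^sub>R e) - \<phi> (x - s *\<^sub>R e)\<bar> / \<bar>X i\<bar>) \<le> \<bar>u x\<bar> * B"
          by (rule mult_left_mono) simp
        then show "norm (u x * ((\<phi> (x - (s + X i) *\<^sub>R e) - \<phi> (x - s *\<^sub>R e)) / X i)) \<le> B * \<bar>u x\<bar>"
          by (simp only: real_norm_def abs_mult abs_divide mult.commute)
      qed
    qed measurable
    have eq: "(LBINT x. u x * ((\<phi> (x - (s + X i) *\<^sub>R e) - \<phi> (x - s *\<^sub>R e)) / X i))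
      = ((LBINT x. u x * \<phi> (x - (s + X i) *\<^sub>R e)) - (LBINT x. u x * \<phi> (x - s *\<^sub>R e))) / X i" for i
      using int[of "s + X i"] int[of s] by (simp add: right_diff_distrib)
    show "((\<lambda>h. ((LBINT x. u x * \<phi> (x - (s + h) *\<^sub>R e)) - (LBINT x. u x * \<phi> (x - s *\<^sub>R e))) / h) \<circ> X)
       \<longlonglongrightarrow> - (LBINT x. u x * ?D (x - s *\<^sub>R e))"
      using lim unfolding eq by (simp add: o_def)
  qed
qed

lemma integrable_lebesgue_on_borel:
  fixes f :: "'a::euclidean_space \<Rightarrow> 'b::{banach, second_countable_topology}"
  assumes "integrable lborel f" and "S \<in> sets borel"
  shows "integrable (lebesgue_on S) f"
proof -
  have "integrable lebesgue f" using assms by (simp add: integrable_completion)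
  then show ?thesis
    using assms(2) integrable_mult_indicator[of S lebesgue f] by (simp add: integrable_restrict_space)
qed

text \<open>By duality with test functions, the mean value theorem for \<open>s \<mapsto> \<integral> u(x) \<psi>(x - s e) dx\<close>
  reduces this to the continuity of translations in \<open>L\<^sup>1\<close>, applied to the weak derivative.\<close>

lemma difference_quotient_L1:
  fixes u g :: "'a::euclidean_space \<Rightarrow> real" and W \<Omega> :: "'a set"
  assumes W: "open W" "bounded W" and r: "r > 0" "\<And>x y. x \<in> W \<Longrightarrow> norm y < r \<Longrightarrow> x + y \<in> \<Omega>"
    and u: "integrable lborel u" and g: "integrable lborel g" and e: "norm e = 1"
    and weak: "\<And>\<phi>. \<phi> \<in> test_functions \<Omega> \<Longrightarrow>
      (LBINT x. u x * frechet_derivative \<phi> (at x) e) = - (LBINT x. g x * \<phi> x)"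
    and "c > 0"
  obtains d where "d > 0"
    "\<forall>h. 0 < h \<longrightarrow> h < d \<longrightarrow> (LINT x|lebesgue_on W. \<bar>(u (x + h *\<^sub>R e) - u x) / h - g x\<bar>) \<le> c"
proof -
  have Wm: "W \<in> sets borel" using W by simp
  obtain d where d: "d > 0" "\<forall>y. norm y < d \<longrightarrow> (LBINT x. indicator W x * \<bar>g (x + y) - g x\<bar>) \<le> c"
    by (rule L1_translation_local[OF g Wm W(2) \<open>c > 0\<close>])
  have [measurable]: "u \<in> borel_measurable borel" "g \<in> borel_measurable borel"
    using u g by (auto dest: borel_measurable_integrable)
  show ?thesis
  proof (rule that[of "min d r"])
    show "min d r > 0" using d r by simp
    show "\<forall>h. 0 < h \<longrightarrow> h < min d r \<longrightarrow> (LINT x|lebesgue_on W. \<bar>(u (x + h *\<^sub>R e) - u x) / h - g x\<bar>) \<le> c"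
    proof (intro allI impI)
      fix h :: real
      assume h: "0 < h" "h < min d r"
      let ?f = "\<lambda>x. (u (x + h *\<^sub>R e) - u x) / h - g x"
      have f: "integrable lborel ?f" using u g integrable_translate[OF u, of "h *\<^sub>R e"] by simp
      have "(LINT x|lebesgue_on W. norm (?f x)) \<le> c"
      proof (rule L1_norm_lebesgue_le_if_test_functions_le[OF W f])
        fix \<psi> :: "'a \<Rightarrow> real"
        assume \<psi>: "\<psi> \<in> test_functions W" and le: "\<forall>x. norm (\<psi> x) \<le> 1"
        note [measurable] = test_function_measurable[OF \<psi>]
        have int: "integrable lborel (\<lambda>x. w x * \<psi> x)" if "integrable lborel w" for w
          by (rule integrable_mult_test_function[OF that \<psi>])
        define G where "G s = (LBINT x. u x * \<psi> (x - s *\<^sub>R e))" for s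
        have G': "(G has_field_derivative (LBINT x. g (x + s *\<^sub>R e) * \<psi> x)) (at s)" if s: "0 \<le> s" "s \<le> h" for s
        proof -
          \<comment> \<open>Since \<open>s < r\<close>, the translated support stays in \<Omega>,
            where the weak derivative may be tested.\<close>
          have sh: "(\<lambda>x. \<psi> (x - s *\<^sub>R e)) \<in> test_functions \<Omega>"
            using s h e by (intro test_function_translate[OF \<psi>] r(2)) auto
          have "frechet_derivative (\<lambda>x. \<psi> (x - s *\<^sub>R e)) (at x) e = frechet_derivative \<psi> (at (x - s *\<^sub>R e)) e" for x
          proof -
            have "((\<lambda>x. \<psi> (x - s *\<^sub>R e)) has_derivative frechet_derivative \<psi> (at (x - s *\<^sub>R e))) (at x)"
              using has_derivative_affine_compose[OF bounded_linear_ident, of \<psi> _ x "- (s *\<^sub>R e)"]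
                smooth_has_derivative[OF test_functions_smooth[OF \<psi>]] by simp
            then show ?thesis using frechet_derivative_at by metis
          qed
          then have "(LBINT x. u x * frechet_derivative \<psi> (at (x - s *\<^sub>R e)) e) = - (LBINT x. g x * \<psi> (x - s *\<^sub>R e))"
            using weak[OF sh] by simp
          also have "(LBINT x. g x * \<psi> (x - s *\<^sub>R e)) = (LBINT x. g (x + s *\<^sub>R e) * \<psi> x)"
            using integral_translate[of "\<lambda>x. g x * \<psi> (x - s *\<^sub>R e)" "s *\<^sub>R e"] by simp
          finally show ?thesis
            using DERIV_integral_translate[OF u \<psi>, of e s] by (simp add: G_def[abs_def])
        qed
        \<comment> \<open>The intermediate point depends on \<psi>, but it always lies below
          \<open>h < d\<close>, so the resulting bound on the translate of \<open>g\<close> is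
          uniform in \<psi>.\<close>
        obtain s where s: "0 < s" "s < h" "G h - G 0 = (h - 0) * (LBINT x. g (x + s *\<^sub>R e) * \<psi> x)"
          using MVT2[OF \<open>0 < h\<close> G'] by blast
        have "(LINT x|lebesgue_on W. ?f x * \<psi> x) = (LBINT x. ?f x * \<psi> x)"
          using test_function_zero_outside[OF \<psi>] by (intro integral_lebesgue_on_supported[OF _ Wm]) simp_all
        also have "\<dots> = ((LBINT x. u (x + h *\<^sub>R e) * \<psi> x) - (LBINT x. u x * \<psi> x)) / h - (LBINT x. g x * \<psi> x)"
          using int[OF u] int[OF g] int[OF integrable_translate[OF u, of "h *\<^sub>R e"]]
          by (simp add: left_diff_distrib diff_divide_distrib)
        also have "(LBINT x. u (x + h *\<^sub>R e) * \<psi> x) = G h"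
          using integral_translate[of "\<lambda>x. u x * \<psi> (x - h *\<^sub>R e)" "h *\<^sub>R e"] by (simp add: G_def)
        also have "(LBINT x. u x * \<psi> x) = G 0" by (simp add: G_def)
        also have "(G h - G 0) / h = (LBINT x. g (x + s *\<^sub>R e) * \<psi> x)" using s h by simp
        also have "\<dots> - (LBINT x. g x * \<psi> x) = (LBINT x. (g (x + s *\<^sub>R e) - g x) * \<psi> x)"
          using int[OF g] int[OF integrable_translate[OF g, of "s *\<^sub>R e"]]
          by (simp add: left_diff_distrib)
        also have "\<dots> \<le> (LBINT x. indicator W x * \<bar>g (x + s *\<^sub>R e) - g x\<bar>)"
        proof (rule integral_mono)
          note int_g = Bochner_Integration.integrable_diff[OF integrable_translate[OF g, of "s *\<^sub>R e"] g]
          show "integrable lborel (\<lambda>x. (g (x + s *\<^sub>R e) - g x) * \<psi> x)" by (rule int[OF int_g])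
          show "integrable lborel (\<lambda>x. indicator W x * \<bar>g (x + s *\<^sub>R e) - g x\<bar>)"
            using integrable_mult_indicator[OF _ integrable_abs[OF int_g], of W] Wm by simp
          fix x
          have "(g (x + s *\<^sub>R e) - g x) * \<psi> x \<le> \<bar>g (x + s *\<^sub>R e) - g x\<bar> * \<bar>\<psi> x\<bar>"
            by (metis abs_ge_self abs_mult)
          also have "\<dots> \<le> \<bar>g (x + s *\<^sub>R e) - g x\<bar> * indicator W x"
            using le test_function_zero_outside[OF \<psi>, of x] by (intro mult_left_mono) (cases "x \<in> W", auto)
          finally show "(g (x + s *\<^sub>R e) - g x) * \<psi> x \<le> indicator W x * \<bar>g (x + s *\<^sub>R e) - g x\<bar>"
            by (simp add: mult.commute)
        qed
        also have "\<dots> \<le> c" using d(2)[rule_format, of "s *\<^sub>R e"] s h e by simp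
        finally show "(LINT x|lebesgue_on W. ?f x \<bullet> \<psi> x) \<le> c" by simp
      qed
      then show "(LINT x|lebesgue_on W. \<bar>?f x\<bar>) \<le> c" by simp
    qed
  qed
qed

subsection \<open>The derivative of the subgraph indicator\<close>

lemma subgraph_indicator_bounds: "0 \<le> subgraph_indicator u z" "subgraph_indicator u z \<le> 1"
  by (auto simp: subgraph_indicator_def split: prod.splits)

lemma borel_measurable_subgraph_indicator [measurable]:
  fixes u :: "'a::euclidean_space \<Rightarrow> real"
  assumes [measurable]: "u \<in> borel_measurable borel"
  shows "subgraph_indicator u \<in> borel_measurable borel"
proof -
  have "(\<lambda>z. if u (fst z) > snd z then 1 else 0 :: real) \<in> borel_measurable (borel \<Otimes>\<^sub>M borel)"
    by measurable
  then show ?thesis unfolding subgraph_indicator_def case_prod_beta by (simp add: borel_prod)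
qed

text \<open>The difference of the two steps is the signed indicator of the interval between
  \<open>s\<close> and \<open>s'\<close>: its integral is \<open>s' - s\<close> and its mass is the
  length, so freezing \<open>f\<close> at \<open>s\<close> costs at most the length times the
  oscillation.\<close>

lemma integral_step_difference:
  fixes f :: "real \<Rightarrow> real"
  assumes f: "continuous_on UNIV f" and m: "\<And>t. t \<in> closed_segment s s' \<Longrightarrow> \<bar>f t - f s\<bar> \<le> m"
  shows "\<bar>(LBINT t. ((if t < s' then 1 else 0) - (if t < s then 1 else 0)) * f t) - (s' - s) * f s\<bar> \<le> \<bar>s' - s\<bar> * m"
proof -
  define D where "D t = (if t < s' then 1 else 0 :: real) - (if t < s then 1 else 0)" for t
  have [measurable]: "f \<in> borel_measurable borel" using f by (rule borel_measurable_continuous_onI)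
  have D_eq: "D t = indicator {s..<s'} t - indicator {s'..<s} t" for t
    by (auto simp: D_def indicator_def)
  have D_abs: "\<bar>D t\<bar> = indicator {s..<s'} t + indicator {s'..<s} t" for t
    by (auto simp: D_def indicator_def)
  have int_ind: "integrable lborel (indicator {a..<b} :: real \<Rightarrow> real)" for a b :: real
    by (rule integrable_indicator_bounded) simp_all
  have int_D: "integrable lborel D" unfolding D_eq[abs_def] by (intro Bochner_Integration.integrable_diff int_ind)
  have m_ge: "m \<ge> 0" using m[of s] by simp
  have le: "\<bar>D t * (f t - f s)\<bar> \<le> \<bar>D t\<bar> * m" for t
  proof (cases "t \<in> closed_segment s s'")
    case True
    then show ?thesis using m by (simp add: abs_mult mult_left_mono)
  next
    case False
    then have "D t = 0" by (auto simp: D_def closed_segment_eq_real_ivl split: if_splits)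
    then show ?thesis by simp
  qed
  have int: "integrable lborel (\<lambda>t. D t * (f t - f s))"
  proof (rule Bochner_Integration.integrable_bound[of _ "\<lambda>t. \<bar>D t\<bar> * m"])
    show "integrable lborel (\<lambda>t. \<bar>D t\<bar> * m)" using int_D by simp
    have "D \<in> borel_measurable borel" using int_D by (auto dest: borel_measurable_integrable)
    then show "(\<lambda>t. D t * (f t - f s)) \<in> borel_measurable lborel" by simp
    show "AE t in lborel. norm (D t * (f t - f s)) \<le> norm (\<bar>D t\<bar> * m)"
      using le m_ge by (intro AE_I2) (simp add: abs_mult)
  qed
  have int_Df: "integrable lborel (\<lambda>t. D t * f t)"
    using Bochner_Integration.integrable_add[OF int integrable_mult_left[OF int_D, of "f s"]]
    by (simp add: algebra_simps)
  have "(LBINT t. D t) = s' - s"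
    unfolding D_eq using int_ind by (cases "s \<le> s'") (simp_all add: Bochner_Integration.integral_diff)
  moreover have "(LBINT t. D t * (f t - f s)) = (LBINT t. D t * f t) - (LBINT t. D t * f s)"
    using int_Df int_D by (simp add: right_diff_distrib)
  ultimately have "(LBINT t. D t * f t) - (s' - s) * f s = (LBINT t. D t * (f t - f s))"
    by simp
  also have "\<bar>\<dots>\<bar> \<le> (LBINT t. \<bar>D t * (f t - f s)\<bar>)" by (rule integral_abs_bound)
  also have "\<dots> \<le> (LBINT t. \<bar>D t\<bar> * m)"
    using int int_D le by (intro integral_mono) auto
  also have "\<dots> = (LBINT t. \<bar>D t\<bar>) * m" using int_D by simp
  also have "(LBINT t. \<bar>D t\<bar>) = \<bar>s' - s\<bar>"
    unfolding D_abs using int_ind by (cases "s \<le> s'") (simp_all add: Bochner_Integration.integral_add)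
  finally show ?thesis by (simp add: D_def)
qed

lemma DERIV_test_function_snd:
  fixes \<psi> :: "'a::euclidean_space \<times> real \<Rightarrow> real"
  assumes "smooth \<psi>"
  shows "((\<lambda>t. \<psi> (x, t)) has_field_derivative frechet_derivative \<psi> (at (x, t)) (0, 1)) (at t)"
proof -
  let ?F = "frechet_derivative \<psi> (at (x, t))"
  have "(x, 0) - t *\<^sub>R (0, -1) = (x, t)" for t :: real by simp
  with DERIV_test_function_line[OF assms, of "(x, 0)" "(0, -1)" t]
  have "((\<lambda>t. \<psi> (x, t)) has_field_derivative - ?F (0, - 1)) (at t)" by simp
  moreover have "linear ?F" by (rule has_derivative_linear[OF smooth_has_derivative[OF assms]])
  then have "- ?F (0, - 1) = ?F (0, 1)" using linear_neg[of ?F "(0, 1)"] by simp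
  ultimately show ?thesis by simp
qed

text \<open>The difference quotient of \<open>\<integral> 1\<^sub>u(z) \<psi>(z - h (e, 0)) dz\<close> tends to the left-hand side (up to sign).
  By Fubini it is the integral over \<open>x\<close> of \<open>1/h\<close> times the integral of \<open>\<psi>(x, \<cdot>)\<close> from \<open>u(x)\<close> to
  \<open>u(x + h e)\<close>, which is the difference quotient of \<open>u\<close> times \<open>\<psi>(x, u(x))\<close> up to a vanishing error.\<close>

lemma integral_subgraph_indicator_derivative_fst:
  fixes u g :: "'a::euclidean_space \<Rightarrow> real"
  assumes \<Omega>: "open \<Omega>" "bounded \<Omega>" and u: "integrable lborel u" and g: "integrable lborel g"
    and e: "norm e = 1"
    and weak: "\<And>\<phi>. \<phi> \<in> test_functions \<Omega> \<Longrightarrow>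
      (LBINT x. u x * frechet_derivative \<phi> (at x) e) = - (LBINT x. g x * \<phi> x)"
    and \<psi>: "\<psi> \<in> test_functions (\<Omega> \<times> UNIV)"
  shows "(LBINT z. subgraph_indicator u z * frechet_derivative \<psi> (at z) (e, 0))
    = - (LBINT x. g x * \<psi> (x, u x))"
proof -
  have [measurable]: "u \<in> borel_measurable borel" "g \<in> borel_measurable borel"
    using u g by (auto dest: borel_measurable_integrable)
  let ?v = "subgraph_indicator u"
  let ?e = "(e, 0) :: 'a \<times> real"
  let ?D = "\<lambda>z. frechet_derivative \<psi> (at z) ?e"
  have D: "?D \<in> test_functions (\<Omega> \<times> UNIV)" by (rule test_function_derivative[OF \<psi>])
  note [measurable] = test_function_measurable[OF \<psi>] test_function_measurable[OF D]
  have \<psi>_cont: "continuous_on S \<psi>" for S by (rule test_function_continuous[OF \<psi>])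
  have \<psi>_pair_meas [measurable]: "\<psi> \<in> borel_measurable (borel \<Otimes>\<^sub>M borel)"
    by (simp add: borel_prod)
  obtain B where B: "B > 0" "\<forall>z. norm (\<psi> z) \<le> B" by (rule test_function_bounded[OF \<psi>])
  obtain L where L: "L > 0" "\<forall>z. norm (frechet_derivative \<psi> (at z) (0, 1)) \<le> L"
    by (rule test_function_bounded[OF test_function_derivative[OF \<psi>]])
  have lip: "\<bar>\<psi> (x, t) - \<psi> (x, s)\<bar> \<le> L * \<bar>t - s\<bar>" for x t s
    using field_differentiable_bound[OF convex_UNIV
        has_field_derivative_at_within[OF DERIV_test_function_snd[OF test_functions_smooth[OF \<psi>]]],
        where B=L and x=t and y=s] L(2)
    by simp
  obtain K where K: "compact K" "K \<subseteq> \<Omega> \<times> UNIV" and K0: "\<forall>z. z \<notin> K \<longrightarrow> \<psi> z = 0"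
    by (rule test_functionsE[OF \<psi>])
  obtain K' where K': "compact K'" and K'0: "\<forall>z. z \<notin> K' \<longrightarrow> ?D z = 0"
    using test_functionsE[OF D] by metis
  have K1: "compact (fst ` K)" using K(1) by (intro compact_continuous_image continuous_intros)
  have "fst ` K \<subseteq> \<Omega>" using K(2) by auto
  then obtain \<epsilon> where \<epsilon>: "\<epsilon> > 0" "(\<Union>x\<in>fst ` K. cball x \<epsilon>) \<subseteq> \<Omega>"
    by (rule compact_subset_open_imp_cball_epsilon_subset[OF K1 \<Omega>(1)])
  \<comment> \<open>A neighbourhood of the projected support; half of \<epsilon> is kept in reserve
    so that translations by less than \<epsilon>/2 stay in \<Omega>.\<close>
  define W where "W = (\<Union>x\<in>fst ` K. ball x (\<epsilon> / 2))"
  have W_open: "open W" unfolding W_def by blast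
  have W_sub: "x + y \<in> \<Omega>" if "x \<in> W" "norm y < \<epsilon> / 2" for x y
  proof -
    obtain k where k: "k \<in> fst ` K" "dist k x < \<epsilon> / 2" using \<open>x \<in> W\<close> by (auto simp: W_def)
    have "dist k (x + y) \<le> dist k x + norm y"
      using norm_triangle_ineq4[of "k - x" y] by (simp add: dist_norm diff_diff_eq)
    then have "x + y \<in> cball k \<epsilon>" using k that by simp
    then show ?thesis using \<epsilon>(2) k(1) by blast
  qed
  have "W \<subseteq> \<Omega>" using W_sub[of _ 0] \<epsilon>(1) by auto
  then have W_bdd: "bounded W" using \<Omega>(2) bounded_subset by blast
  have W_meas [measurable]: "W \<in> sets borel" using W_open by simp
  have outside: "\<psi> (x, t) = 0" if "x \<notin> W" for x t
  proof -
    have "x \<notin> fst ` K" using that \<epsilon>(1) by (auto simp: W_def)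
    then have "(x, t) \<notin> K" by force
    then show ?thesis using K0 by blast
  qed
  obtain R where R: "\<forall>z\<in>K \<union> K'. norm z \<le> R"
    using compact_imp_bounded[OF compact_Un[OF K(1) K'(1)]] bounded_iff by metis
  \<comment> \<open>The subgraph indicator is not integrable on the whole space, since it equals one
    far below the graph. It is truncated to a ball containing the supports of \<psi> and its
    derivative; the margin 1 absorbs shifts by \<open>h < 1\<close>.\<close>
  define S where "S = ball (0 :: 'a \<times> real) (R + 1)"
  define V where "V z = ?v z * indicator S z" for z
  have "integrable lborel (indicat_real S)"
    unfolding S_def by (rule integrable_indicator_bounded) simp_all
  then have V: "integrable lborel V"
    unfolding V_def using subgraph_indicator_bounds[of u]
    by (intro integrable_bounded_mult[where B=1]) auto
  have V_meas [measurable]: "V \<in> borel_measurable borel" using V by (auto dest: borel_measurable_integrable)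
  define I where "I s = (LBINT z. V z * \<psi> (z - s *\<^sub>R ?e))" for s
  have I_eq: "I h = (LBINT z. ?v (z + h *\<^sub>R ?e) * \<psi> z)" if "0 \<le> h" "h < 1" for h
  proof -
    have "I h = (LBINT z. V (z + h *\<^sub>R ?e) * \<psi> z)"
      using integral_translate[of "\<lambda>z. V z * \<psi> (z - h *\<^sub>R ?e)" "h *\<^sub>R ?e"] by (simp add: I_def)
    also have "\<dots> = (LBINT z. ?v (z + h *\<^sub>R ?e) * \<psi> z)"
    proof (rule Bochner_Integration.integral_cong[OF refl])
      fix z
      show "V (z + h *\<^sub>R ?e) * \<psi> z = ?v (z + h *\<^sub>R ?e) * \<psi> z"
      proof (cases "z \<in> K")
        case True
        have "norm (z + h *\<^sub>R ?e) \<le> norm z + norm (h *\<^sub>R ?e)" by (rule norm_triangle_ineq)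
        also have "\<dots> < R + 1" using R[rule_format, of z] True that e by (simp add: norm_Pair)
        finally show ?thesis by (simp add: V_def S_def)
      qed (use K0[rule_format, of z] in simp)
    qed
    finally show ?thesis .
  qed
  have I': "(I has_field_derivative - (LBINT z. ?v z * ?D z)) (at 0)"
  proof -
    have "(LBINT z. V z * ?D z) = (LBINT z. ?v z * ?D z)"
    proof (rule Bochner_Integration.integral_cong[OF refl])
      fix z
      show "V z * ?D z = ?v z * ?D z"
      proof (cases "z \<in> K'")
        case True
        then have "norm z < R + 1" using R by force
        then show ?thesis by (simp add: V_def S_def)
      qed (use K'0[rule_format, of z] in simp)
    qed
    then show ?thesis
      using DERIV_integral_translate[OF V \<psi>, of ?e 0]
      by (simp add: I_def[abs_def] flip: zero_prod_def)
  qed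
  define q where "q h x = (u (x + h *\<^sub>R e) - u x) / h" for h x
  define J where "J h x = (LBINT t. (?v (x + h *\<^sub>R e, t) - ?v (x, t)) / h * \<psi> (x, t))" for h x
  \<comment> \<open>Of the two bounds on the oscillation of \<psi> between \<open>u x\<close> and
    \<open>u (x + h e)\<close>, the Lipschitz one tends to zero with the increment of
    \<open>u\<close>, and the constant one provides domination.\<close>
  define m where "m h x = min (L * \<bar>u (x + h *\<^sub>R e) - u x\<bar>) (2 * B)" for h x
  have q_int: "integrable lborel (q h)" for h
    unfolding q_def using u integrable_translate[OF u, of "h *\<^sub>R e"] by simp
  have q_meas [measurable]: "q h \<in> borel_measurable borel" for h
    using q_int[of h] by (auto dest: borel_measurable_integrable)
  have m_meas [measurable]: "m h \<in> borel_measurable borel" for h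
    unfolding m_def by measurable
  have m_bounds: "0 \<le> m h x" "m h x \<le> 2 * B" for h x using B L by (auto simp: m_def)
  have J_est: "\<bar>J h x - q h x * \<psi> (x, u x)\<bar> \<le> \<bar>q h x\<bar> * m h x" if "h > 0" for h x
  proof -
    let ?s = "u x" and ?s' = "u (x + h *\<^sub>R e)"
    have cont: "continuous_on UNIV (\<lambda>t. \<psi> (x, t))"
      by (rule continuous_on_compose2[OF \<psi>_cont, of UNIV]) (auto intro: continuous_intros)
    have est: "\<bar>(LBINT t. ((if t < ?s' then 1 else 0) - (if t < ?s then 1 else 0)) * \<psi> (x, t)) - (?s' - ?s) * \<psi> (x, ?s)\<bar>
        \<le> \<bar>?s' - ?s\<bar> * m h x" (is "\<bar>?A - _\<bar> \<le> _")
    proof (rule integral_step_difference[OF cont])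
      fix t
      assume t: "t \<in> closed_segment ?s ?s'"
      then have "\<bar>t - ?s\<bar> \<le> \<bar>?s' - ?s\<bar>" by (auto simp: closed_segment_eq_real_ivl split: if_splits)
      then have "L * \<bar>t - ?s\<bar> \<le> L * \<bar>?s' - ?s\<bar>" using L(1) by (intro mult_left_mono) auto
      moreover have "\<bar>\<psi> (x, t) - \<psi> (x, ?s)\<bar> \<le> 2 * B"
        using B(2)[rule_format, of "(x, t)"] B(2)[rule_format, of "(x, ?s)"] by simp
      ultimately show "\<bar>\<psi> (x, t) - \<psi> (x, ?s)\<bar> \<le> m h x"
        using lip[of x t ?s] by (simp add: m_def)
    qed
    have "J h x = (LBINT t. ((if t < ?s' then 1 else 0) - (if t < ?s then 1 else 0)) * \<psi> (x, t) / h)"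
      unfolding J_def by (intro Bochner_Integration.integral_cong refl) (simp add: subgraph_indicator_def)
    also have "\<dots> = ?A / h" by (rule integral_divide_zero)
    finally have "J h x = ?A / h" .
    moreover have "q h x * \<psi> (x, ?s) = (?s' - ?s) * \<psi> (x, ?s) / h" by (simp add: q_def)
    ultimately have "\<bar>J h x - q h x * \<psi> (x, ?s)\<bar> = \<bar>?A - (?s' - ?s) * \<psi> (x, ?s)\<bar> / h"
      using that by (simp flip: diff_divide_distrib)
    also have "\<dots> \<le> \<bar>?s' - ?s\<bar> * m h x / h" using est that by (intro divide_right_mono) auto
    finally show ?thesis using that by (simp add: q_def abs_divide)
  qed
  have quotient: "(I h - I 0) / h = (LBINT x. J h x)" and J_int: "integrable lborel (J h)"
    if h: "0 < h" "h < 1" for h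
  proof -
    let ?f = "\<lambda>z. (?v (z + h *\<^sub>R ?e) - ?v z) / h * \<psi> z"
    have f_int: "integrable lborel ?f"
    proof (rule integrable_bounded_mult[OF test_function_integrable[OF \<psi>]])
      show "(\<lambda>z. (?v (z + h *\<^sub>R ?e) - ?v z) / h) \<in> borel_measurable lborel" by measurable
      show "AE z in lborel. \<bar>(?v (z + h *\<^sub>R ?e) - ?v z) / h\<bar> \<le> 1 / h"
      proof (rule AE_I2)
        fix z
        have "\<bar>?v (z + h *\<^sub>R ?e) - ?v z\<bar> \<le> 1"
          using subgraph_indicator_bounds[of u z] subgraph_indicator_bounds[of u "z + h *\<^sub>R ?e"] by simp
        then show "\<bar>(?v (z + h *\<^sub>R ?e) - ?v z) / h\<bar> \<le> 1 / h"
          using h by (simp add: abs_divide divide_right_mono)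
      qed
    qed
    have "integrable lborel (\<lambda>z. ?v (z + h *\<^sub>R ?e) * \<psi> z)" for h
    proof (rule integrable_bounded_mult[OF test_function_integrable[OF \<psi>], where B=1])
      show "(\<lambda>z. ?v (z + h *\<^sub>R ?e)) \<in> borel_measurable lborel" by measurable
    qed (use subgraph_indicator_bounds[of u] in auto)
    note int = this[of h] this[of 0]
    have "(I h - I 0) / h = (LBINT z. ?f z)"
      unfolding I_eq[OF less_imp_le[OF h(1)] h(2)] I_eq[OF order_refl zero_less_one]
      using int by (simp add: left_diff_distrib flip: zero_prod_def)
    also have "\<dots> = (LINT z|(lborel \<Otimes>\<^sub>M lborel). ?f z)" by (simp add: lborel_prod)
    also have "\<dots> = (LBINT x. (LBINT t. ?f (x, t)))"
      using f_int by (intro lborel_pair.integral_fst'[symmetric]) (simp add: lborel_prod)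
    finally show "(I h - I 0) / h = (LBINT x. J h x)" by (simp add: J_def)
    have "integrable lborel (\<lambda>x. LBINT t. ?f (x, t))"
      using f_int by (intro lborel_pair.integrable_fst') (simp add: lborel_prod)
    then show "integrable lborel (J h)" by (simp add: J_def[abs_def])
  qed
  have \<psi>u_meas [measurable]: "(\<lambda>x. \<psi> (x, u x)) \<in> borel_measurable borel"
    by measurable
  have g\<psi>_int: "integrable lborel (\<lambda>x. g x * \<psi> (x, u x))"
    by (rule integrable_mult_bounded[OF g, where B=B]) (use B in auto)
  define a where "a h = (LINT x|lebesgue_on W. \<bar>q h x - g x\<bar>)" for h
  define b where "b h = (LINT x|lebesgue_on W. \<bar>g x\<bar> * m h x)" for h
  have gm_int: "integrable lborel (\<lambda>x. \<bar>g x\<bar> * m h x)" for h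
    by (rule integrable_mult_bounded[where B="2*B"]) (use g m_bounds in auto)
  \<comment> \<open>Replacing \<open>q h\<close> by \<open>g\<close> in front of \<psi> costs
    \<open>B * \<bar>q h x - g x\<bar>\<close>. The error of the step estimate is
    \<open>\<bar>q h x\<bar> * m h x\<close>, where \<open>q h\<close> is split into
    \<open>q h - g\<close>, paired with \<open>m \<le> 2 * B\<close>, and \<open>g\<close>. This
    gives the constant \<open>3 * B\<close> and the remainder \<open>b h\<close>.\<close>
  have main_est: "\<bar>(I h - I 0) / h - (LBINT x. g x * \<psi> (x, u x))\<bar> \<le> 3 * B * a h + b h" if h: "0 < h" "h < 1" for h
  proof -
    let ?w = "\<lambda>x. 3 * B * \<bar>q h x - g x\<bar> + \<bar>g x\<bar> * m h x"
    have w_int: "integrable lborel ?w" using q_int[of h] g gm_int[of h] by simp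
    have "(I h - I 0) / h - (LBINT x. g x * \<psi> (x, u x)) = (LBINT x. J h x - g x * \<psi> (x, u x))"
      using quotient[OF h] J_int[OF h] g\<psi>_int by simp
    also have "\<bar>\<dots>\<bar> \<le> (LBINT x. \<bar>J h x - g x * \<psi> (x, u x)\<bar>)" by (rule integral_abs_bound)
    also have "\<dots> \<le> (LBINT x. indicator W x *\<^sub>R ?w x)"
    proof (rule integral_mono)
      show "integrable lborel (\<lambda>x. \<bar>J h x - g x * \<psi> (x, u x)\<bar>)" using J_int[OF h] g\<psi>_int by simp
      show "integrable lborel (\<lambda>x. indicator W x *\<^sub>R ?w x)"
        by (rule integrable_mult_indicator[OF _ w_int]) simp
      fix x
      show "\<bar>J h x - g x * \<psi> (x, u x)\<bar> \<le> indicator W x *\<^sub>R ?w x"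
      proof (cases "x \<in> W")
        case True
        have "\<bar>q h x\<bar> * m h x \<le> (\<bar>q h x - g x\<bar> + \<bar>g x\<bar>) * m h x"
          using m_bounds[of h x] by (intro mult_right_mono) auto
        also have "\<dots> \<le> \<bar>q h x - g x\<bar> * (2 * B) + \<bar>g x\<bar> * m h x"
          using m_bounds[of h x] by (simp add: distrib_right mult_left_mono)
        finally have 1: "\<bar>q h x\<bar> * m h x \<le> \<bar>q h x - g x\<bar> * (2 * B) + \<bar>g x\<bar> * m h x" .
        have "\<bar>q h x * \<psi> (x, u x) - g x * \<psi> (x, u x)\<bar> = \<bar>q h x - g x\<bar> * \<bar>\<psi> (x, u x)\<bar>"
          by (simp flip: left_diff_distrib abs_mult)
        also have "\<dots> \<le> \<bar>q h x - g x\<bar> * B" using B(2) by (intro mult_left_mono) auto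
        finally have "\<bar>J h x - g x * \<psi> (x, u x)\<bar> \<le> \<bar>q h x - g x\<bar> * (2 * B) + \<bar>g x\<bar> * m h x + \<bar>q h x - g x\<bar> * B"
          using J_est[OF h(1), of x] 1 by linarith
        then show ?thesis using True by (simp add: algebra_simps)
      next
        case False
        then show ?thesis by (simp add: outside J_def)
      qed
    qed
    also have "\<dots> = (LINT x|lebesgue_on W. ?w x)"
      using w_int by (intro integral_lebesgue_on_borel[symmetric]) auto
    also have "\<dots> = 3 * B * a h + b h"
      unfolding a_def b_def
      using integrable_lebesgue_on_borel[OF gm_int W_meas] integrable_lebesgue_on_borel[OF _ W_meas, of "\<lambda>x. q h x - g x"] q_int[of h] g
      by simp
    finally show ?thesis .
  qed
  \<comment> \<open>Two successors, so that already the first step is below 1, as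
    \<open>I_eq\<close> and \<open>quotient\<close> require.\<close>
  define h where "h n = inverse (real (Suc (Suc n)))" for n
  have h_pos: "0 < h n" "h n < 1" for n by (simp_all add: h_def field_simps)
  have h_lim: "h \<longlonglongrightarrow> 0"
    unfolding h_def using LIMSEQ_Suc[OF LIMSEQ_inverse_real_of_nat] by simp
  have a_lim: "(\<lambda>n. a (h n)) \<longlonglongrightarrow> 0"
  proof (rule LIMSEQ_I)
    fix c :: real assume "c > 0"
    then have "c / 2 > 0" "\<epsilon> / 2 > 0" using \<epsilon> by auto
    obtain d where d: "d > 0" "\<forall>h. 0 < h \<longrightarrow> h < d \<longrightarrow> (LINT x|lebesgue_on W. \<bar>(u (x + h *\<^sub>R e) - u x) / h - g x\<bar>) \<le> c / 2"
      by (rule difference_quotient_L1[OF W_open W_bdd \<open>\<epsilon> / 2 > 0\<close> W_sub u g e weak \<open>c / 2 > 0\<close>])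
    obtain N where "\<forall>n\<ge>N. norm (h n - 0) < d" using LIMSEQ_D[OF h_lim d(1)] by blast
    then have "a (h n) \<le> c / 2" if "n \<ge> N" for n
      using d(2)[rule_format, of "h n"] that h_pos[of n] by (auto simp: a_def q_def)
    moreover have "0 \<le> a h" for h by (simp add: a_def)
    ultimately have "norm (a (h n) - 0) < c" if "n \<ge> N" for n
      using \<open>c > 0\<close> that by (smt (verit) field_sum_of_halves real_norm_def)
    then show "\<exists>N. \<forall>n\<ge>N. norm (a (h n) - 0) < c" by blast
  qed
  have "\<exists>r::nat\<Rightarrow>nat. strict_mono r \<and> (AE x in lebesgue_on W. (\<lambda>n. q (h (r n)) x - g x) \<longlonglongrightarrow> 0)"
  proof (rule tendsto_L1_AE_subseq)
    show "integrable (lebesgue_on W) (\<lambda>x. q (h n) x - g x)" for n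
      using q_int g by (intro integrable_lebesgue_on_borel) auto
    show "(\<lambda>n. LINT x|lebesgue_on W. norm (q (h n) x - g x)) \<longlonglongrightarrow> 0"
      using a_lim by (simp add: a_def)
  qed
  then obtain r :: "nat \<Rightarrow> nat" where r: "strict_mono r"
    and r_AE: "AE x in lebesgue_on W. (\<lambda>n. q (h (r n)) x - g x) \<longlonglongrightarrow> 0" by blast
  have hr_lim: "(\<lambda>n. h (r n)) \<longlonglongrightarrow> 0" using LIMSEQ_subseq_LIMSEQ[OF h_lim r] by (simp add: o_def)
  have ar_lim: "(\<lambda>n. a (h (r n))) \<longlonglongrightarrow> 0" using LIMSEQ_subseq_LIMSEQ[OF a_lim r] by (simp add: o_def)
  \<comment> \<open>\<open>u\<close> need not be continuous, so its increments do not tend to zero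
    at every point. Along the subsequence, however, the quotients converge almost everywhere to a
    finite limit, and the increment is \<open>h\<close> times the quotient; hence \<open>m\<close>
    tends to zero there.\<close>
  have br_lim: "(\<lambda>n. b (h (r n))) \<longlonglongrightarrow> 0"
  proof -
    have "(\<lambda>n. b (h (r n))) \<longlonglongrightarrow> (LINT x|lebesgue_on W. 0)"
      unfolding b_def
    proof (rule integral_dominated_convergence[where w="\<lambda>x. \<bar>g x\<bar> * (2 * B)"])
      show "integrable (lebesgue_on W) (\<lambda>x. \<bar>g x\<bar> * (2 * B))"
        using g by (intro integrable_lebesgue_on_borel) auto
      show "(\<lambda>x. \<bar>g x\<bar> * m (h (r n)) x) \<in> borel_measurable (lebesgue_on W)" for n
        using integrable_lebesgue_on_borel[OF gm_int W_meas] by (rule borel_measurable_integrable)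
      show "AE x in lebesgue_on W. norm (\<bar>g x\<bar> * m (h (r n)) x) \<le> \<bar>g x\<bar> * (2 * B)" for n
        using m_bounds by (intro AE_I2) (simp add: abs_mult mult_left_mono)
      show "AE x in lebesgue_on W. (\<lambda>n. \<bar>g x\<bar> * m (h (r n)) x) \<longlonglongrightarrow> 0"
        using r_AE
      proof eventually_elim
        case (elim x)
        have "(\<lambda>n. q (h (r n)) x - g x + g x) \<longlonglongrightarrow> 0 + g x" by (intro tendsto_add elim tendsto_const)
        then have "(\<lambda>n. h (r n) * q (h (r n)) x) \<longlonglongrightarrow> 0 * g x"
          by (intro tendsto_mult hr_lim) simp
        moreover have "h (r n) * q (h (r n)) x = u (x + h (r n) *\<^sub>R e) - u x" for n
          using h_pos[of "r n"] by (simp add: q_def)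
        ultimately have "(\<lambda>n. u (x + h (r n) *\<^sub>R e) - u x) \<longlonglongrightarrow> 0" by simp
        then have "(\<lambda>n. m (h (r n)) x) \<longlonglongrightarrow> min (L * \<bar>0\<bar>) (2 * B)"
          unfolding m_def by (intro tendsto_min tendsto_mult tendsto_rabs tendsto_const)
        then have "(\<lambda>n. \<bar>g x\<bar> * m (h (r n)) x) \<longlonglongrightarrow> \<bar>g x\<bar> * min (L * \<bar>0\<bar>) (2 * B)"
          by (intro tendsto_mult tendsto_const)
        then show ?case using B by simp
      qed
    qed simp
    then show ?thesis by simp
  qed
  define c where "c = (LBINT x. g x * \<psi> (x, u x))"
  have bound_lim: "(\<lambda>n. 3 * B * a (h (r n)) + b (h (r n))) \<longlonglongrightarrow> 0"
    using tendsto_add[OF tendsto_mult[OF tendsto_const ar_lim, of "3 * B"] br_lim] by simp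
  have est: "norm ((I (h (r n)) - I 0) / h (r n) - c) \<le> 3 * B * a (h (r n)) + b (h (r n))" for n
    using main_est[OF h_pos] by (simp only: real_norm_def c_def)
  have "(\<lambda>n. (I (h (r n)) - I 0) / h (r n) - c) \<longlonglongrightarrow> 0"
    by (rule Lim_null_comparison[OF always_eventually bound_lim]) (rule allI, rule est)
  then have "(\<lambda>n. (I (h (r n)) - I 0) / h (r n)) \<longlonglongrightarrow> c"
    by (rule LIM_zero_cancel)
  moreover have "(\<lambda>n. (I (h (r n)) - I 0) / h (r n)) \<longlonglongrightarrow> - (LBINT z. ?v z * ?D z)"
  proof -
    have "h (r n) \<noteq> 0" for n using h_pos(1)[of "r n"] by simp
    then have "filterlim (\<lambda>n. h (r n)) (at 0) sequentially"
      by (intro filterlim_atI[OF hr_lim] always_eventually allI)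
    with I' show ?thesis
      unfolding DERIV_def add_0_left by (rule filterlim_compose)
  qed
  ultimately have "c = - (LBINT z. ?v z * ?D z)"
    by (rule LIMSEQ_unique)
  then show ?thesis by (simp add: c_def)
qed

text \<open>For fixed x the inner integral runs over t below u(x), and the fundamental theorem of
  calculus leaves only the upper end, since \<psi> vanishes far below.\<close>

lemma integral_subgraph_indicator_derivative_snd:
  fixes u :: "'a::euclidean_space \<Rightarrow> real"
  assumes [measurable]: "u \<in> borel_measurable borel" and \<psi>: "\<psi> \<in> test_functions U"
  shows "(LBINT z. subgraph_indicator u z * frechet_derivative \<psi> (at z) (0, 1))
    = (LBINT x. \<psi> (x, u x))"
proof -
  let ?v = "subgraph_indicator u"
  let ?D = "\<lambda>z. frechet_derivative \<psi> (at z) (0, 1)"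
  have D: "?D \<in> test_functions U" by (rule test_function_derivative[OF \<psi>])
  have D_cont: "continuous_on S ?D" for S by (rule test_function_continuous[OF D])
  note [measurable] = test_function_measurable[OF D]
  obtain K where K: "compact K" and K0: "\<forall>z. z \<notin> K \<longrightarrow> \<psi> z = 0"
    using test_functionsE[OF \<psi>] by metis
  obtain K' where K': "compact K'" and K'0: "\<forall>z. z \<notin> K' \<longrightarrow> ?D z = 0"
    using test_functionsE[OF D] by metis
  obtain R where R: "\<forall>z\<in>K \<union> K'. norm z \<le> R"
    using compact_imp_bounded[OF compact_Un[OF K K']] bounded_iff by metis
  have out: "\<psi> (x, t) = 0" "?D (x, t) = 0" if "t < - R" for x t
  proof -
    have "norm (x, t) > R" using that norm_snd_le[of t x] by simp
    then have "(x, t) \<notin> K \<union> K'" using R by force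
    then show "\<psi> (x, t) = 0" "?D (x, t) = 0" using K0 K'0 by blast+
  qed
  have inner: "(LBINT t. ?v (x, t) * ?D (x, t)) = \<psi> (x, u x)" for x
  proof -
    \<comment> \<open>A lower end below both supports; the minimum with \<open>u x\<close> also
      covers a graph that itself runs below the supports, where the interval degenerates to a
      point.\<close>
    define a where "a = min (- R - 1) (u x)"
    have a: "a \<le> u x" "a < - R" by (auto simp: a_def)
    have D_line: "continuous_on S (\<lambda>t. ?D (x, t))" for S
      using continuous_on_compose2[OF D_cont[of UNIV], of S "Pair x"]
      by (simp add: continuous_on_Pair continuous_on_const continuous_on_id)
    have D_line_meas: "(\<lambda>t. ?D (x, t)) \<in> borel_measurable borel"
      by (rule borel_measurable_continuous_onI[OF D_line])
    have "(LBINT t. ?v (x, t) * ?D (x, t)) = (LBINT t. ?D (x, t) * indicator {a..u x} t)"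
    proof (rule integral_cong_AE)
      show "AE t in lborel. ?v (x, t) * ?D (x, t) = ?D (x, t) * indicator {a..u x} t"
        using AE_lborel_singleton[of "u x"]
      proof eventually_elim
        case (elim t)
        show ?case
        proof (cases "t < a")
          case True
          then have "?D (x, t) = 0" using a by (intro out) simp
          then show ?thesis by simp
        qed (use elim in \<open>auto simp: subgraph_indicator_def indicator_def\<close>)
      qed
      have "(\<lambda>t. if u x > t then 1 else 0 :: real) \<in> borel_measurable borel" by measurable
      then have "(\<lambda>t. (if u x > t then 1 else 0) * ?D (x, t)) \<in> borel_measurable borel"
        using D_line_meas by (intro borel_measurable_times)
      then show "(\<lambda>t. ?v (x, t) * ?D (x, t)) \<in> borel_measurable lborel"
        by (simp add: subgraph_indicator_def)
      show "(\<lambda>t. ?D (x, t) * indicator {a..u x} t) \<in> borel_measurable lborel"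
        using D_line_meas by simp
    qed
    also have "\<dots> = \<psi> (x, u x) - \<psi> (x, a)"
    proof (rule integral_FTC_Icc_real[OF a(1)])
      show "((\<lambda>t. \<psi> (x, t)) has_real_derivative ?D (x, t)) (at t)" for t
        by (rule DERIV_test_function_snd[OF test_functions_smooth[OF \<psi>]])
      show "isCont (\<lambda>t. ?D (x, t)) t" for t
        using D_line[of UNIV] by (simp add: continuous_on_eq_continuous_at)
    qed
    also have "\<psi> (x, a) = 0" by (rule out[OF a(2)])
    finally show ?thesis by simp
  qed
  have int: "integrable lborel (\<lambda>z. ?v z * ?D z)"
    by (rule integrable_bounded_mult[OF test_function_integrable[OF D], where B=1])
      (use subgraph_indicator_bounds[of u] in auto)
  have "(LBINT z. ?v z * ?D z) = (LINT z|(lborel \<Otimes>\<^sub>M lborel). ?v z * ?D z)" by (simp add: lborel_prod)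
  also have "\<dots> = (LBINT x. (LBINT t. ?v (x, t) * ?D (x, t)))"
    using int by (intro lborel_pair.integral_fst'[symmetric]) (simp add: lborel_prod)
  finally show ?thesis by (simp add: inner)
qed

lemma frechet_derivative_inner:
  assumes "smooth \<psi>"
  shows "frechet_derivative (\<lambda>z. \<psi> z \<bullet> i) (at z) h = frechet_derivative \<psi> (at z) h \<bullet> i"
proof -
  have "((\<lambda>z. \<psi> z \<bullet> i) has_derivative (\<lambda>h. frechet_derivative \<psi> (at z) h \<bullet> i)) (at z)"
    by (rule has_derivative_inner_left[OF smooth_has_derivative[OF assms]])
  then show ?thesis using frechet_derivative_at by metis
qed

text \<open>Function and gradient are Borel and integrable on the whole space, so that translates
  make sense across the boundary of \<Omega>, while the weak derivative is tested in \<Omega> only.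
  \<open>W11_representative\<close> shows that every element of \<open>W11\<close> has such a
  representative.\<close>

locale sobolev_function =
  fixes \<Omega> :: "'a::euclidean_space set" and u :: "'a \<Rightarrow> real" and g :: "'a \<Rightarrow> 'a"
  assumes open_dom: "open \<Omega>" and bounded_dom: "bounded \<Omega>"
    and integrable_fun: "integrable lborel u" and integrable_grad: "integrable lborel g"
    and weak: "\<And>\<phi> e. \<phi> \<in> test_functions \<Omega> \<Longrightarrow> e \<in> Basis \<Longrightarrow>
      (LBINT x. u x * frechet_derivative \<phi> (at x) e) = - (LBINT x. (g x \<bullet> e) * \<phi> x)"
begin

abbreviation M :: "'a measure" where
  "M \<equiv> lebesgue_on \<Omega>"

lemma fun_measurable [measurable]: "u \<in> borel_measurable borel"
  and grad_measurable [measurable]: "g \<in> borel_measurable borel"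
  and dom_measurable [measurable]: "\<Omega> \<in> sets borel"
  using integrable_fun integrable_grad open_dom by (auto dest: borel_measurable_integrable)

lemma dom_times_measurable: "\<Gamma> \<in> sets borel \<Longrightarrow> \<Omega> \<times> \<Gamma> \<in> sets borel"
  by (rule borel_Times) simp_all

text \<open>The derivative of \<open>1\<^sub>u\<close> lives on the graph of \<open>u\<close>, with polar decomposition read off from
  \<open>(\<nabla>u, -1) dx = (\<nabla>u, -1) / \<surd>(1 + |\<nabla>u|\<^sup>2) \<cdot> \<surd>(1 + |\<nabla>u|\<^sup>2) dx\<close>.\<close>

definition area :: "'a \<Rightarrow> real" where
  "area x = sqrt (1 + (norm (g x))\<^sup>2)"

definition graph_measure :: "('a \<times> real) measure" where
  "graph_measure = distr (density lborel (\<lambda>x. ennreal (indicator \<Omega> x * area x))) borel (\<lambda>x. (x, u x))"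

definition graph_normal :: "'a \<times> real \<Rightarrow> 'a \<times> real" where
  "graph_normal z = (1 / area (fst z)) *\<^sub>R (g (fst z), - 1)"

lemma area_pos: "area x > 0"
  by (simp add: area_def add_pos_nonneg)

lemma area_measurable [measurable]: "area \<in> borel_measurable borel"
  unfolding area_def by measurable

lemma graph_normal_measurable [measurable]: "graph_normal \<in> borel_measurable borel"
proof -
  have "(\<lambda>z :: 'a \<times> real. (1 / area (fst z)) *\<^sub>R (g (fst z), - 1 :: real)) \<in> borel_measurable (borel \<Otimes>\<^sub>M borel)"
    by measurable
  then show ?thesis by (simp add: graph_normal_def[abs_def] borel_prod del: scaleR_Pair)
qed

lemma integral_graph_measure:
  fixes F :: "'a \<times> real \<Rightarrow> real"
  assumes F [measurable]: "F \<in> borel_measurable borel"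
  shows "(LINT z|graph_measure. F z) = (LBINT x. indicator \<Omega> x * area x * F (x, u x))"
proof -
  have "(LINT z|graph_measure. F z) = (LINT x|density lborel (\<lambda>x. ennreal (indicator \<Omega> x * area x)). F (x, u x))"
    unfolding graph_measure_def by (rule integral_distr) simp_all
  also have "\<dots> = (LBINT x. (indicator \<Omega> x * area x) *\<^sub>R F (x, u x))"
    by (intro integral_density AE_I2 mult_nonneg_nonneg less_imp_le[OF area_pos]) simp_all
  finally show ?thesis by simp
qed

lemma integral_graph_measure_normal:
  fixes F :: "'a \<times> real \<Rightarrow> 'a \<times> real"
  assumes F [measurable]: "F \<in> borel_measurable borel"
  shows "(LINT z|graph_measure. F z \<bullet> graph_normal z) = (LBINT x. indicator \<Omega> x * (F (x, u x) \<bullet> (g x, - 1)))"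
proof -
  have "(LINT z|graph_measure. F z \<bullet> graph_normal z)
     = (LBINT x. indicator \<Omega> x * area x * (F (x, u x) \<bullet> graph_normal (x, u x)))"
    by (rule integral_graph_measure) measurable
  also have "\<dots> = (LBINT x. indicator \<Omega> x * (F (x, u x) \<bullet> (g x, - 1)))"
  proof (rule Bochner_Integration.integral_cong[OF refl])
    fix x
    show "indicator \<Omega> x * area x * (F (x, u x) \<bullet> graph_normal (x, u x)) = indicator \<Omega> x * (F (x, u x) \<bullet> (g x, - 1))"
      using area_pos[of x] by (simp add: graph_normal_def del: scaleR_Pair)
  qed
  finally show ?thesis .
qed

text \<open>The total mass is the area of the graph, bounded through sqrt(1 + |g|^2) \<le> 1 + |g|
  on the bounded set \<Omega>.\<close>

lemma emeasure_graph_measure_finite: "emeasure graph_measure UNIV < \<infinity>"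
proof -
  have le: "area x \<le> 1 + norm (g x)" for x
    unfolding area_def using sqrt_add_le_add_sqrt[of 1 "(norm (g x))\<^sup>2"] by simp
  have "integrable lborel (\<lambda>x. indicator \<Omega> x + norm (g x))"
    using integrable_grad integrable_indicator_bounded[OF dom_measurable bounded_dom] by simp
  then have "integrable lborel (\<lambda>x. indicator \<Omega> x * area x)"
  proof (rule Bochner_Integration.integrable_bound)
    show "AE x in lborel. norm (indicator \<Omega> x * area x) \<le> norm (indicator \<Omega> x + norm (g x))"
      using le area_pos by (intro AE_I2) (auto simp: indicator_def abs_of_pos)
  qed measurable
  then have fin: "(\<integral>\<^sup>+x. ennreal (indicator \<Omega> x * area x) \<partial>lborel) < \<infinity>"
    using area_pos by (simp add: integrable_iff_bounded abs_mult abs_of_pos)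
  have "emeasure graph_measure UNIV = (\<integral>\<^sup>+x. ennreal (indicator \<Omega> x * area x) \<partial>lborel)"
    unfolding graph_measure_def by (simp add: emeasure_distr emeasure_density)
  with fin show ?thesis by simp
qed

lemma integral_test_function_dom:
  assumes "\<psi> \<in> test_functions (\<Omega> \<times> UNIV)"
  shows "indicator \<Omega> x *\<^sub>R \<psi> (x, t) = \<psi> (x, t)"
  using test_function_zero_outside[OF assms, of "(x, t)"] by (cases "x \<in> \<Omega>") auto

text \<open>The divergence splits along the product basis: the directions \<open>(e, 0)\<close>
  contribute minus the components of \<open>g\<close>, the direction \<open>(0, 1)\<close>
  contributes plus one. Since the definition carries a minus sign, the result is the density
  \<open>(g, - 1)\<close>, and \<open>area\<close> cancels between measure and normal.\<close>

lemma is_derivative_measure_subgraph: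
  "is_derivative_measure (\<Omega> \<times> UNIV) (subgraph_indicator u) graph_measure graph_normal"
  unfolding is_derivative_measure_def
proof (intro conjI allI impI ballI)
  show "sets graph_measure = sets borel" by (simp add: graph_measure_def)
  show "graph_normal \<in> borel_measurable borel" by measurable
  have dom: "\<Omega> \<times> (UNIV :: real set) \<in> sets borel" by (rule dom_times_measurable) simp
  show "emeasure graph_measure (- (\<Omega> \<times> UNIV)) = 0"
  proof -
    have "emeasure graph_measure (- (\<Omega> \<times> UNIV))
       = emeasure (density lborel (\<lambda>x. ennreal (indicator \<Omega> x * area x))) (- \<Omega>)"
    proof -
      have "(\<lambda>x. (x, u x)) -` (- (\<Omega> \<times> UNIV)) = - \<Omega>" by auto
      then show ?thesis
        unfolding graph_measure_def using borel_comp[OF dom] by (subst emeasure_distr) simp_all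
    qed
    also have "\<dots> = (\<integral>\<^sup>+x. ennreal (indicator \<Omega> x * area x) * indicator (- \<Omega>) x \<partial>lborel)"
      by (subst emeasure_density) (auto simp: borel_comp)
    also have "\<dots> = (\<integral>\<^sup>+x. 0 \<partial>(lborel :: 'a measure))"
      by (intro nn_integral_cong) (simp add: indicator_def)
    finally show ?thesis by simp
  qed
  show "emeasure graph_measure K < \<infinity>" for K
    using emeasure_mono[of K UNIV graph_measure] emeasure_graph_measure_finite
    by (simp add: graph_measure_def order.strict_trans1)
  show "AE z in graph_measure. norm (graph_normal z) = 1"
  proof (rule AE_I2)
    fix z :: "'a \<times> real"
    have "norm (g (fst z), - 1 :: real) = area (fst z)"
      by (simp add: norm_Pair area_def add.commute)
    then show "norm (graph_normal z) = 1"
      using area_pos[of "fst z"] by (simp add: graph_normal_def abs_of_pos del: scaleR_Pair)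
  qed
  fix \<psi> :: "'a \<times> real \<Rightarrow> 'a \<times> real"
  assume \<psi>: "\<psi> \<in> test_functions (\<Omega> \<times> UNIV)"
  have \<psi>_smooth: "smooth \<psi>" by (rule test_functions_smooth[OF \<psi>])
  note [measurable] = test_function_measurable[OF \<psi>]
  let ?v = "subgraph_indicator u"
  have comp: "(\<lambda>z. \<psi> z \<bullet> i) \<in> test_functions (\<Omega> \<times> UNIV)" for i
    by (rule test_function_linear_compose[OF bounded_linear_inner_left \<psi>])
  have int: "integrable lborel (\<lambda>z. ?v z * (frechet_derivative \<psi> (at z) i \<bullet> i))" for i
  proof -
    have "integrable lborel (\<lambda>z. ?v z * frechet_derivative (\<lambda>z. \<psi> z \<bullet> i) (at z) i)"
      by (rule integrable_bounded_mult[OF test_function_integrable[OF test_function_derivative[OF comp]], where B=1])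
        (use subgraph_indicator_bounds[of u] in auto)
    then show ?thesis by (simp add: frechet_derivative_inner[OF \<psi>_smooth])
  qed
  have fst_part: "(LBINT z. ?v z * (frechet_derivative \<psi> (at z) (e, 0) \<bullet> (e, 0)))
      = - (LBINT x. (g x \<bullet> e) * (\<psi> (x, u x) \<bullet> (e, 0)))" if e: "e \<in> Basis" for e
    using integral_subgraph_indicator_derivative_fst[OF open_dom bounded_dom integrable_fun _ _ weak[OF _ e] comp[of "(e, 0)"]]
      integrable_grad e by (simp add: frechet_derivative_inner[OF \<psi>_smooth])
  have snd_part: "(LBINT z. ?v z * (frechet_derivative \<psi> (at z) (0, 1) \<bullet> (0, 1)))
      = (LBINT x. \<psi> (x, u x) \<bullet> (0, 1))"
    using integral_subgraph_indicator_derivative_snd[OF fun_measurable comp[of "(0, 1)"]]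
    by (simp add: frechet_derivative_inner[OF \<psi>_smooth])
  obtain B where B: "\<forall>z. norm (\<psi> z) \<le> B" using test_function_bounded[OF \<psi>] by metis
  have \<psi>_B: "\<bar>\<psi> (x, u x) \<bullet> i\<bar> \<le> B" if "i \<in> Basis" for x i
    using Basis_le_norm[OF that, of "\<psi> (x, u x)"] B by (meson order_trans)
  have int_fst: "integrable lborel (\<lambda>x. (g x \<bullet> e) * (\<psi> (x, u x) \<bullet> (e, 0)))" if e: "e \<in> Basis" for e
    by (rule integrable_mult_bounded[where B=B]) (use integrable_grad e in \<open>auto intro!: AE_I2 \<psi>_B simp: Basis_prod_def\<close>)
  have int_snd: "integrable lborel (\<lambda>x. \<psi> (x, u x) \<bullet> (0, 1))"
  proof -
    have "integrable lborel (\<lambda>x. indicator \<Omega> x * (\<psi> (x, u x) \<bullet> (0, 1)))"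
      by (rule integrable_mult_bounded[OF integrable_indicator_bounded[OF dom_measurable bounded_dom], where B=B])
        (auto intro!: AE_I2 \<psi>_B simp: Basis_prod_def)
    moreover have "indicator \<Omega> x * (\<psi> (x, u x) \<bullet> (0, 1)) = \<psi> (x, u x) \<bullet> (0, 1)" for x
      using integral_test_function_dom[OF \<psi>, of x "u x"] by (metis inner_scaleR_left)
    ultimately show ?thesis by simp
  qed
  note div = test_function_measurable[OF test_function_divergence[OF \<psi>]]
    test_function_zero_outside[OF test_function_divergence[OF \<psi>]]
  have basis: "(Basis :: ('a \<times> real) set) = (\<lambda>e. (e, 0)) ` Basis \<union> {(0, 1)}"
    by (simp add: Basis_prod_def)
  have sum_basis: "(\<Sum>i\<in>(Basis :: ('a \<times> real) set). f i) = (\<Sum>e\<in>Basis. f (e, 0)) + f (0, 1)" for f :: "_ \<Rightarrow> real"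
    unfolding basis by (subst sum.union_disjoint) (auto simp: sum.reindex inj_on_def)
  have "(LINT z|lebesgue_on (\<Omega> \<times> UNIV). ?v z * divergence \<psi> z) = (LBINT z. ?v z * divergence \<psi> z)"
    using div dom by (intro integral_lebesgue_on_supported) auto
  also have "\<dots> = (\<Sum>i\<in>Basis. LBINT z. ?v z * (frechet_derivative \<psi> (at z) i \<bullet> i))"
    unfolding divergence_def sum_distrib_left by (intro Bochner_Integration.integral_sum int)
  also have "\<dots> = (\<Sum>e\<in>Basis. - (LBINT x. (g x \<bullet> e) * (\<psi> (x, u x) \<bullet> (e, 0)))) + (LBINT x. \<psi> (x, u x) \<bullet> (0, 1))"
    unfolding sum_basis by (simp only: fst_part snd_part cong: sum.cong)
  also have "\<dots> = - ((\<Sum>e\<in>Basis. (LBINT x. (g x \<bullet> e) * (\<psi> (x, u x) \<bullet> (e, 0)))) - (LBINT x. \<psi> (x, u x) \<bullet> (0, 1)))"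
    by (simp add: sum_negf)
  also have "(\<Sum>e\<in>Basis. (LBINT x. (g x \<bullet> e) * (\<psi> (x, u x) \<bullet> (e, 0)))) - (LBINT x. \<psi> (x, u x) \<bullet> (0, 1))
      = (LBINT x. (\<Sum>e\<in>Basis. (g x \<bullet> e) * (\<psi> (x, u x) \<bullet> (e, 0))) - \<psi> (x, u x) \<bullet> (0, 1))"
    using int_fst int_snd by (simp add: Bochner_Integration.integral_sum Bochner_Integration.integral_diff)
  also have "\<dots> = (LBINT x. indicator \<Omega> x * (\<psi> (x, u x) \<bullet> (g x, - 1)))"
  proof (rule Bochner_Integration.integral_cong[OF refl])
    fix x
    have "(\<Sum>e\<in>Basis. (g x \<bullet> e) * (\<psi> (x, u x) \<bullet> (e, 0))) = fst (\<psi> (x, u x)) \<bullet> g x"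
      by (subst euclidean_inner[of _ "g x"]) (simp add: inner_prod_def mult.commute)
    then have "(\<Sum>e\<in>Basis. (g x \<bullet> e) * (\<psi> (x, u x) \<bullet> (e, 0))) - \<psi> (x, u x) \<bullet> (0, 1) = \<psi> (x, u x) \<bullet> (g x, - 1)"
      by (simp add: inner_prod_def)
    also have "\<dots> = indicator \<Omega> x * (\<psi> (x, u x) \<bullet> (g x, - 1))"
      using integral_test_function_dom[OF \<psi>, of x "u x"] by (metis inner_scaleR_left)
    finally show "(\<Sum>e\<in>Basis. (g x \<bullet> e) * (\<psi> (x, u x) \<bullet> (e, 0))) - \<psi> (x, u x) \<bullet> (0, 1) = \<dots>" .
  qed
  also have "\<dots> = (LINT z|graph_measure. \<psi> z \<bullet> graph_normal z)"
    by (rule integral_graph_measure_normal[symmetric]) measurable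
  finally show "(LINT z|lebesgue_on (\<Omega> \<times> UNIV). ?v z * divergence \<psi> z) = - (LINT z|graph_measure. \<psi> z \<bullet> graph_normal z)" .
qed

end

subsection \<open>Total variation and data term of subgraphs\<close>

context sobolev_function
begin

lemma AE_dom_iff:
  "(AE x in M. P x) \<longleftrightarrow> (AE x in lborel. x \<in> \<Omega> \<longrightarrow> P x)"
  using open_dom by (simp add: AE_restrict_space_iff AE_completion_iff)

lemma measurable_lebesgue_on_dom: "f \<in> borel_measurable borel \<Longrightarrow> f \<in> borel_measurable M"
  by (intro measurable_restrict_space1 measurable_completion) simp

lemma integral_test_divergence:
  assumes \<psi>: "\<psi> \<in> test_functions \<Omega>"
  shows "(LINT x|M. u x * (- divergence \<psi> x)) = (LINT x|M. g x \<bullet> \<psi> x)"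
proof -
  have \<psi>_smooth: "smooth \<psi>" by (rule test_functions_smooth[OF \<psi>])
  note [measurable] = test_function_measurable[OF \<psi>]
  note [measurable] = test_function_measurable[OF test_function_divergence[OF \<psi>]]
  have comp: "(\<lambda>x. \<psi> x \<bullet> i) \<in> test_functions \<Omega>" for i
    by (rule test_function_linear_compose[OF bounded_linear_inner_left \<psi>])
  have int: "integrable lborel (\<lambda>x. u x * (frechet_derivative \<psi> (at x) i \<bullet> i))" for i
    using integrable_mult_test_function[OF integrable_fun test_function_derivative[OF comp[of i]], of i]
    by (simp add: frechet_derivative_inner[OF \<psi>_smooth])
  have int_g: "integrable lborel (\<lambda>x. (g x \<bullet> i) * (\<psi> x \<bullet> i))" for i
    using integrable_grad by (intro integrable_mult_test_function[OF _ comp]) simp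
  have "(LINT x|M. u x * (- divergence \<psi> x)) = (LBINT x. u x * (- divergence \<psi> x))"
    using test_function_zero_outside[OF test_function_divergence[OF \<psi>]]
    by (intro integral_lebesgue_on_supported) simp_all
  also have "\<dots> = - (\<Sum>i\<in>Basis. LBINT x. u x * (frechet_derivative \<psi> (at x) i \<bullet> i))"
    using int by (simp add: divergence_def sum_distrib_left Bochner_Integration.integral_sum)
  also have "\<dots> = (\<Sum>i\<in>Basis. LBINT x. (g x \<bullet> i) * (\<psi> x \<bullet> i))"
    using weak[OF comp] by (simp add: frechet_derivative_inner[OF \<psi>_smooth] sum_negf)
  also have "\<dots> = (LBINT x. g x \<bullet> \<psi> x)"
    unfolding euclidean_inner[of "g _" "\<psi> _"] using int_g by (intro Bochner_Integration.integral_sum[symmetric])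
  also have "\<dots> = (LINT x|M. g x \<bullet> \<psi> x)"
    using test_function_zero_outside[OF \<psi>] by (intro integral_lebesgue_on_supported[symmetric]) simp_all
  finally show ?thesis .
qed

lemma grad_integrable_dom: "integrable M g"
  by (rule integrable_lebesgue_on_borel[OF integrable_grad]) simp

text \<open>One inequality is Cauchy-Schwarz after integration by parts; the other is the duality
  lemma. In particular the total variation is finite.\<close>

lemma TV_eq: "TV \<Omega> u = ereal (LINT x|M. norm (g x))"
proof (rule antisym)
  have TV_ge: "ereal (LINT x|M. g x \<bullet> \<psi> x) \<le> TV \<Omega> u"
    if "\<psi> \<in> test_functions \<Omega>" "\<forall>x. norm (\<psi> x) \<le> 1" for \<psi>
    unfolding TV_def integral_test_divergence[OF that(1), symmetric] using that by (intro SUP_upper) auto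
  \<comment> \<open>The zero field excludes the value minus infinity in the case distinction
    below.\<close>
  have "ereal (LINT x|M. g x \<bullet> 0) \<le> TV \<Omega> u"
    by (rule TV_ge[OF zero_test_function]) simp
  then have "0 \<le> TV \<Omega> u" by (simp add: zero_ereal_def)
  then show "ereal (LINT x|M. norm (g x)) \<le> TV \<Omega> u"
  proof (cases "TV \<Omega> u")
    case (real r)
    have "(LINT x|M. norm (g x)) \<le> r"
      using TV_ge real by (intro L1_norm_lebesgue_le_if_test_functions_le[OF open_dom bounded_dom integrable_grad]) simp
    with real show ?thesis by simp
  qed auto
  show "TV \<Omega> u \<le> ereal (LINT x|M. norm (g x))"
    unfolding TV_def
  proof (rule SUP_least)
    fix \<psi> :: "'a \<Rightarrow> 'a"
    assume \<psi>: "\<psi> \<in> {\<psi> \<in> test_functions \<Omega>. \<forall>x\<in>\<Omega>. norm (\<psi> x) \<le> 1}"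
    have "(LINT x|M. g x \<bullet> \<psi> x) \<le> (LINT x|M. norm (g x))"
    proof (rule integral_mono')
      fix x assume "x \<in> space M"
      then have "norm (\<psi> x) \<le> 1" using \<psi> by (simp add: space_restrict_space)
      then have "norm (g x) * norm (\<psi> x) \<le> norm (g x)" by (rule mult_left_le) simp
      then show "g x \<bullet> \<psi> x \<le> norm (g x)" using norm_cauchy_schwarz order_trans by blast
    qed (use grad_integrable_dom in auto)
    with \<psi> show "ereal (LINT x|M. u x * (- divergence \<psi> x)) \<le> ereal (LINT x|M. norm (g x))"
      by (simp only: integral_test_divergence mem_Collect_eq ereal_less_eq)
  qed
qed

lemma subgraph_measurable_dom: "subgraph_indicator u \<in> borel_measurable (lebesgue_on S)"
  by (intro measurable_restrict_space1 measurable_completion) simp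

text \<open>The graph measure witnesses existence, so the choice in \<open>dist_derivative\<close>
  is a derivative measure; uniqueness then replaces it by the graph measure and its normal. All
  lifted functionals of subgraphs are computed from this formula.\<close>

lemma lint_dist_derivative:
  fixes F :: "'a \<times> real \<Rightarrow> 'a \<times> real"
  assumes v: "v \<in> borel_measurable (lebesgue_on (\<Omega> \<times> UNIV))"
    "AE z in lebesgue_on (\<Omega> \<times> UNIV). v z = subgraph_indicator u z"
    and \<Gamma>: "\<Gamma> \<in> sets borel" "AE x in M. u x \<in> \<Gamma>"
    and F: "continuous_on (\<Omega> \<times> UNIV) F"
  shows "(LINT z:\<Omega> \<times> \<Gamma>|fst (dist_derivative (\<Omega> \<times> UNIV) v). F z \<bullet> snd (dist_derivative (\<Omega> \<times> UNIV) v) z)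
    = (LINT x|M. F (x, u x) \<bullet> (g x, - 1))"
proof -
  let ?U = "\<Omega> \<times> (UNIV :: real set)"
  define d where "d = dist_derivative ?U v"
  have cong: "is_derivative_measure ?U v = is_derivative_measure ?U (subgraph_indicator u)"
    by (rule is_derivative_measure_cong[OF v(2,1) subgraph_measurable_dom])
  have "is_derivative_measure ?U v (fst (graph_measure, graph_normal)) (snd (graph_measure, graph_normal))"
    using is_derivative_measure_subgraph by (simp add: cong)
  then have "is_derivative_measure ?U v (fst d) (snd d)"
    unfolding d_def dist_derivative_def by (rule someI)
  then have d: "is_derivative_measure ?U (subgraph_indicator u) (fst d) (snd d)" by (simp add: cong)
  have "open ?U" using open_dom by (simp add: open_Times)
  note unique = derivative_measure_unique[OF this d is_derivative_measure_subgraph]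
  have [measurable]: "snd d \<in> borel_measurable borel" using d by (simp add: is_derivative_measure_def)
  have dom: "?U \<in> sets borel" and dom_\<Gamma>: "\<Omega> \<times> \<Gamma> \<in> sets borel"
    using \<Gamma>(1) by (simp_all add: dom_times_measurable)
  \<comment> \<open>\<open>F\<close> is controlled only on the domain; extension by zero makes it
    Borel on the whole space.\<close>
  define F' where "F' z = indicator ?U z *\<^sub>R F z" for z
  have F' [measurable]: "F' \<in> borel_measurable borel"
    unfolding F'_def by (rule borel_measurable_continuous_on_indicator[OF dom F])
  \<comment> \<open>The restriction to \<Gamma> has no effect on the graph, because
    \<open>u x\<close> lies in \<Gamma> for almost every \<open>x\<close>.\<close>
  define G where "G z = indicator (\<Omega> \<times> \<Gamma>) z *\<^sub>R F' z" for z
  have G [measurable]: "G \<in> borel_measurable borel"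
    unfolding G_def using dom_\<Gamma> by measurable
  have sets: "sets graph_measure = sets borel" by (simp add: graph_measure_def)
  have "(LINT z:\<Omega> \<times> \<Gamma>|fst d. F z \<bullet> snd d z) = (LINT z|graph_measure. G z \<bullet> snd d z)"
    unfolding set_lebesgue_integral_def unique(1)
    by (rule Bochner_Integration.integral_cong[OF refl]) (auto simp: G_def F'_def indicator_def)
  also have "\<dots> = (LINT z|graph_measure. G z \<bullet> graph_normal z)"
  proof (rule integral_cong_AE)
    show "AE z in graph_measure. G z \<bullet> snd d z = G z \<bullet> graph_normal z"
      using unique(2) by eventually_elim simp
  qed (simp_all add: measurable_cong_sets[OF sets refl])
  also have "\<dots> = (LBINT x. indicator \<Omega> x * (G (x, u x) \<bullet> (g x, - 1)))"
    by (rule integral_graph_measure_normal) measurable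
  also have "\<dots> = (LBINT x. indicator \<Omega> x *\<^sub>R (F' (x, u x) \<bullet> (g x, - 1)))"
  proof (rule integral_cong_AE)
    have "AE x in lborel. x \<in> \<Omega> \<longrightarrow> u x \<in> \<Gamma>" using \<Gamma>(2) by (simp add: AE_dom_iff)
    then show "AE x in lborel. indicator \<Omega> x * (G (x, u x) \<bullet> (g x, - 1)) = indicator \<Omega> x *\<^sub>R (F' (x, u x) \<bullet> (g x, - 1))"
      by eventually_elim (auto simp: G_def indicator_def)
  qed measurable
  also have "\<dots> = (LINT x|M. F' (x, u x) \<bullet> (g x, - 1))"
    by (rule integral_lebesgue_on_borel[symmetric]) measurable
  also have "\<dots> = (LINT x|M. F (x, u x) \<bullet> (g x, - 1))"
    by (rule Bochner_Integration.integral_cong[OF refl]) (simp add: F'_def space_restrict_space)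
  finally show ?thesis by (simp add: d_def)
qed

end

lemma C_0_if_compact_support:
  fixes \<phi> :: "'a::euclidean_space \<Rightarrow> 'b::real_normed_vector"
  assumes \<phi>: "continuous_on UNIV \<phi>" and K: "compact K" "K \<subseteq> U" "\<And>z. z \<notin> K \<Longrightarrow> \<phi> z = 0"
  shows "\<phi> \<in> C_0 U"
proof -
  have "compact {z \<in> U. e \<le> norm (\<phi> z)}" if "e > 0" for e
  proof -
    have "closed {z. e \<le> norm (\<phi> z)}"
      using \<phi> by (intro closed_Collect_le continuous_intros)
    then have "compact (K \<inter> {z. e \<le> norm (\<phi> z)})" by (rule compact_Int_closed[OF K(1)])
    moreover have "K \<inter> {z. e \<le> norm (\<phi> z)} = {z \<in> U. e \<le> norm (\<phi> z)}"
    proof (intro set_eqI iffI)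
      fix z assume z: "z \<in> {z \<in> U. e \<le> norm (\<phi> z)}"
      then have "z \<in> K" using K(3)[of z] that by (cases "z \<in> K") auto
      with z show "z \<in> K \<inter> {z. e \<le> norm (\<phi> z)}" by blast
    qed (use K(2) in blast)
    ultimately show ?thesis by simp
  qed
  then show ?thesis using \<phi> by (auto simp: C_0_def intro: continuous_on_subset)
qed

context sobolev_function
begin

text \<open>Evaluated on the graph, a lifted field is a field on \<Omega> bounded by one, so
  Cauchy-Schwarz bounds it by the norm of \<open>g\<close>. Conversely a test field on \<Omega>
  lifts to one that is constant in t near the values of u.\<close>

lemma lifted_TV_subgraph:
  assumes v: "v \<in> borel_measurable (lebesgue_on (\<Omega> \<times> UNIV))"
    "AE z in lebesgue_on (\<Omega> \<times> UNIV). v z = subgraph_indicator u z"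
    and \<Gamma>: "compact \<Gamma>" "AE x in M. u x \<in> \<Gamma>"
  shows "lifted_TV \<Omega> \<Gamma> v = TV \<Omega> u"
proof -
  have \<Gamma>': "\<Gamma> \<in> sets borel" using \<Gamma>(1) by (simp add: compact_imp_closed)
  have lint: "(LINT z:\<Omega> \<times> \<Gamma>|fst (dist_derivative (\<Omega> \<times> UNIV) v). \<phi> z \<bullet> fst (snd (dist_derivative (\<Omega> \<times> UNIV) v) z))
      = (LINT x|M. \<phi> (x, u x) \<bullet> g x)" if "continuous_on (\<Omega> \<times> UNIV) \<phi>" for \<phi>
    using lint_dist_derivative[OF v \<Gamma>' \<Gamma>(2), of "\<lambda>z. (\<phi> z, 0)"] that
    by (simp add: inner_prod_def continuous_on_Pair)
  have TV: "lifted_TV \<Omega> \<Gamma> v = (SUP \<phi>\<in>K_x \<Omega>. ereal (LINT x|M. \<phi> (x, u x) \<bullet> g x))"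
    unfolding lifted_TV_def case_prod_beta Let_def
    by (intro SUP_cong refl) (simp add: lint K_x_def C_0_def)
  show ?thesis
  proof (rule antisym)
    show "lifted_TV \<Omega> \<Gamma> v \<le> TV \<Omega> u"
      unfolding TV TV_eq
    proof (rule SUP_least)
      fix \<phi> assume \<phi>: "\<phi> \<in> K_x \<Omega>"
      have "(LINT x|M. \<phi> (x, u x) \<bullet> g x) \<le> (LINT x|M. norm (g x))"
      proof (rule integral_mono')
        fix x assume "x \<in> space M"
        then have "norm (\<phi> (x, u x)) \<le> 1" using \<phi> by (simp add: space_restrict_space K_x_def)
        then have "norm (\<phi> (x, u x)) * norm (g x) \<le> norm (g x)"
          by (intro mult_left_le_one_le) auto
        then show "\<phi> (x, u x) \<bullet> g x \<le> norm (g x)" using norm_cauchy_schwarz order_trans by blast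
      qed (use grad_integrable_dom in auto)
      then show "ereal (LINT x|M. \<phi> (x, u x) \<bullet> g x) \<le> ereal (LINT x|M. norm (g x))"
        by simp
    qed
    obtain R where R: "\<forall>t\<in>\<Gamma>. \<bar>t\<bar> \<le> R"
      using compact_imp_bounded[OF \<Gamma>(1)] unfolding bounded_iff real_norm_def by blast
    \<comment> \<open>A cut-off in t that equals one on \<Gamma>: the lifted field vanishes at
      infinity but is unchanged on the graph.\<close>
    define \<eta> where "\<eta> t = max 0 (min 1 (R + 1 - \<bar>t\<bar>))" for t :: real
    have \<eta>_cont: "continuous_on UNIV \<eta>" unfolding \<eta>_def by (intro continuous_intros)
    have \<eta>_bounds: "0 \<le> \<eta> t" "\<eta> t \<le> 1" for t by (auto simp: \<eta>_def)
    have \<eta>_one: "\<eta> t = 1" if "t \<in> \<Gamma>" for t using R that by (force simp: \<eta>_def)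
    have \<eta>_out: "\<eta> t = 0" if "t \<notin> {- R - 1..R + 1}" for t using that by (auto simp: \<eta>_def)
    show "TV \<Omega> u \<le> lifted_TV \<Omega> \<Gamma> v"
      unfolding TV TV_def
    proof (rule SUP_least)
      fix \<psi> :: "'a \<Rightarrow> 'a"
      assume "\<psi> \<in> {\<psi> \<in> test_functions \<Omega>. \<forall>x\<in>\<Omega>. norm (\<psi> x) \<le> 1}"
      then have \<psi>: "\<psi> \<in> test_functions \<Omega>" and \<psi>_le: "\<forall>x\<in>\<Omega>. norm (\<psi> x) \<le> 1" by auto
      have \<psi>_cont: "continuous_on UNIV \<psi>" by (rule test_function_continuous[OF \<psi>])
      note [measurable] = test_function_measurable[OF \<psi>]
      define \<phi> where "\<phi> z = \<eta> (snd z) *\<^sub>R \<psi> (fst z)" for z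
      have \<phi>_cont: "continuous_on UNIV \<phi>"
        unfolding \<phi>_def
        by (intro continuous_on_scaleR continuous_on_compose2[OF \<eta>_cont] continuous_on_compose2[OF \<psi>_cont])
          (auto intro: continuous_intros)
      obtain K where K: "compact K" "K \<subseteq> \<Omega>" and K0: "\<forall>x. x \<notin> K \<longrightarrow> \<psi> x = 0"
        by (rule test_functionsE[OF \<psi>])
      have "\<phi> \<in> C_0 (\<Omega> \<times> UNIV)"
      proof (rule C_0_if_compact_support[OF \<phi>_cont])
        show "compact (K \<times> {- R - 1..R + 1})" using K(1) by (intro compact_Times) simp_all
        show "K \<times> {- R - 1..R + 1} \<subseteq> \<Omega> \<times> UNIV" using K(2) by blast
        fix z assume "z \<notin> K \<times> {- R - 1..R + 1}"
        then have "fst z \<notin> K \<or> snd z \<notin> {- R - 1..R + 1}" by (auto simp: mem_Times_iff)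
        then show "\<phi> z = 0" using K0[rule_format, of "fst z"] \<eta>_out[of "snd z"] by (auto simp: \<phi>_def)
      qed
      moreover have "norm (\<phi> z) \<le> 1" if "z \<in> \<Omega> \<times> UNIV" for z
      proof -
        have "norm (\<psi> (fst z)) \<le> 1" using \<psi>_le that by auto
        then show ?thesis
          using \<eta>_bounds[of "snd z"] mult_le_one[of "\<eta> (snd z)" "norm (\<psi> (fst z))"] by (simp add: \<phi>_def)
      qed
      ultimately have \<phi>: "\<phi> \<in> K_x \<Omega>" by (simp add: K_x_def)
      have [measurable]: "\<phi> \<in> borel_measurable borel" by (rule borel_measurable_continuous_onI[OF \<phi>_cont])
      have "(LINT x|M. u x * (- divergence \<psi> x)) = (LINT x|M. g x \<bullet> \<psi> x)"
        by (rule integral_test_divergence[OF \<psi>])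
      also have "\<dots> = (LINT x|M. \<phi> (x, u x) \<bullet> g x)"
      proof (rule integral_cong_AE)
        show "AE x in M. g x \<bullet> \<psi> x = \<phi> (x, u x) \<bullet> g x"
          using \<Gamma>(2) by eventually_elim (simp add: \<phi>_def \<eta>_one inner_commute)
      qed (intro measurable_lebesgue_on_dom; measurable)+
      also have "ereal \<dots> \<le> (SUP \<phi>\<in>K_x \<Omega>. ereal (LINT x|M. \<phi> (x, u x) \<bullet> g x))"
        using \<phi> by (rule SUP_upper)
      finally show "ereal (LINT x|M. u x * (- divergence \<psi> x))
         \<le> (SUP \<phi>\<in>K_x \<Omega>. ereal (LINT x|M. \<phi> (x, u x) \<bullet> g x))" .
    qed
  qed
qed

end

text \<open>The right-hand side keeps only the positive part. If \<open>f\<close> is not integrable,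
  its Bochner integral has the default value 0, which is below any nonnegative value.\<close>

lemma ereal_integral_le_nn_integral:
  fixes f :: "'a \<Rightarrow> real"
  shows "ereal (LINT x|M. f x) \<le> enn2ereal (\<integral>\<^sup>+x. ennreal (f x) \<partial>M)"
proof (cases "integrable M f")
  case True
  then have "(LINT x|M. f x) \<le> (LINT x|M. max 0 (f x))" by (intro integral_mono) auto
  moreover have "(\<integral>\<^sup>+x. ennreal (f x) \<partial>M) = ennreal (LINT x|M. max 0 (f x))"
  proof -
    have "(\<integral>\<^sup>+x. ennreal (f x) \<partial>M) = (\<integral>\<^sup>+x. ennreal (max 0 (f x)) \<partial>M)"
      by (intro nn_integral_cong) (simp add: max_def ennreal_neg)
    also have "\<dots> = ennreal (LINT x|M. max 0 (f x))" using True by (intro nn_integral_eq_integral) auto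
    finally show ?thesis .
  qed
  ultimately show ?thesis by simp
qed (simp add: not_integrable_integral_eq flip: zero_ereal_def)

text \<open>The approximants are Baire's inf-convolutions \<open>inf\<^sub>y min (f y) n + n |x - y|\<close>.\<close>

lemma lsc_on_approx_continuous:
  fixes f :: "'a::metric_space \<Rightarrow> ereal"
  assumes "S \<noteq> {}" and nonneg: "\<forall>x\<in>S. 0 \<le> f x" and lsc: "lsc_on S f"
  obtains F :: "nat \<Rightarrow> 'a \<Rightarrow> real" where "\<And>n. continuous_on UNIV (F n)" "\<And>n x. 0 \<le> F n x"
    "\<And>n x. x \<in> S \<Longrightarrow> ereal (F n x) \<le> f x" "\<And>x. x \<in> S \<Longrightarrow> (\<lambda>n. ereal (F n x)) \<longlonglongrightarrow> f x"
proof -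
  \<comment> \<open>The truncation makes the values real even where \<open>f\<close> is infinite;
    its level grows together with the slope \<open>n\<close> of the penalty.\<close>
  define r where "r n y = real_of_ereal (min (f y) (ereal (real n)))" for n :: nat and y
  define F where "F n x = (INF y\<in>S. r n y + real n * dist x y)" for n :: nat and x
  have r_eq: "ereal (r n y) = min (f y) (ereal (real n))" if "y \<in> S" for n y
  proof -
    have "0 \<le> f y" using nonneg that by blast
    then have "\<bar>min (f y) (ereal (real n))\<bar> \<noteq> \<infinity>"
      by (cases "f y") (auto simp: min_def)
    then show ?thesis unfolding r_def by (rule ereal_real')
  qed
  have r_nonneg: "0 \<le> r n y" if "y \<in> S" for n y
  proof -
    have "0 \<le> ereal (r n y)" using nonneg that by (simp add: r_eq)
    then show ?thesis by simp
  qed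
  have bdd: "bdd_below ((\<lambda>y. r n y + real n * dist x y) ` S)" for n x
    using r_nonneg by (intro bdd_belowI[of _ 0]) auto
  have F_le: "F n x \<le> r n y + real n * dist x y" if "y \<in> S" for n x y
    unfolding F_def by (rule cINF_lower[OF bdd that])
  have F_ge: "c \<le> F n x" if "\<And>y. y \<in> S \<Longrightarrow> c \<le> r n y + real n * dist x y" for n x c
    unfolding F_def by (rule cINF_greatest[OF \<open>S \<noteq> {}\<close> that])
  have lip: "F n x \<le> F n x' + real n * dist x x'" for n x x'
  proof -
    have "F n x - real n * dist x x' \<le> F n x'"
    proof (rule F_ge)
      fix y assume "y \<in> S"
      have "real n * dist x y \<le> real n * (dist x x' + dist x' y)"
        by (intro mult_left_mono dist_triangle) simp
      then show "F n x - real n * dist x x' \<le> r n y + real n * dist x' y"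
        using F_le[OF \<open>y \<in> S\<close>, of n x] by (simp add: distrib_left)
    qed
    then show ?thesis by simp
  qed
  have F_upper: "ereal (F n x) \<le> f x" if "x \<in> S" for n x
  proof -
    have "ereal (F n x) \<le> ereal (r n x)" using F_le[OF that, of n x] by simp
    also have "\<dots> \<le> f x" by (simp add: r_eq[OF that])
    finally show ?thesis .
  qed
  show ?thesis
  proof (rule that)
    show "continuous_on UNIV (F n)" for n
    proof (rule lipschitz_on_continuous_on[of "real n"], rule lipschitz_onI)
      fix x y
      show "dist (F n x) (F n y) \<le> real n * dist x y"
        using lip[of n x y] lip[of n y x] by (simp add: dist_real_def dist_commute abs_le_iff)
    qed simp
    show "0 \<le> F n x" for n x using r_nonneg by (intro F_ge add_nonneg_nonneg) auto
    show "ereal (F n x) \<le> f x" if "x \<in> S" for n x by (rule F_upper[OF that])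
    fix x assume x: "x \<in> S"
    show "(\<lambda>n. ereal (F n x)) \<longlonglongrightarrow> f x"
    proof (rule order_tendstoI)
      fix a assume "f x < a"
      then show "\<forall>\<^sub>F n in sequentially. ereal (F n x) < a"
        using F_upper[OF x] by (intro always_eventually allI) (rule le_less_trans)
    next
      fix a assume "a < f x"
      then obtain c where c: "a < ereal c" "ereal c < f x" using ereal_dense2 by blast
      have "closedin (top_of_set S) {y \<in> S. f y \<le> ereal c}" using lsc by (simp add: lsc_on_def)
      then obtain T where T: "closed T" "{y \<in> S. f y \<le> ereal c} = S \<inter> T"
        by (auto simp: closedin_closed)
      have "x \<in> - T" using T(2) x c(2) by (auto simp: not_le[symmetric])
      then obtain \<delta> where \<delta>: "\<delta> > 0" "ball x \<delta> \<subseteq> - T"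
        using T(1) open_contains_ball[of "- T"] by (auto simp: open_Compl)
      have far: "ereal c < f y" if "y \<in> S" "dist x y < \<delta>" for y
      proof -
        have "y \<notin> T" using \<delta>(2) that(2) by auto
        then have "y \<notin> {y \<in> S. f y \<le> ereal c}" using T(2) by blast
        with that(1) show ?thesis by (simp add: not_le)
      qed
      \<comment> \<open>\<open>c \<le> n\<close> lets the bound on \<open>f\<close> near
        \<open>x\<close> survive the truncation, and \<open>c / \<delta> \<le> n\<close> makes the
        penalty alone at least \<open>c\<close> at distance \<delta> or more.\<close>
      obtain N :: nat where N: "max c (c / \<delta>) \<le> real N" using real_arch_simple by blast
      have "c \<le> F n x" if "n \<ge> N" for n
      proof (rule F_ge)
        fix y assume y: "y \<in> S"
        have n: "c \<le> real n" "c / \<delta> \<le> real n" using N that by auto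
        show "c \<le> r n y + real n * dist x y"
        proof (cases "dist x y < \<delta>")
          case True
          have "ereal c \<le> ereal (r n y)"
            using far[OF y True] n(1) by (simp add: r_eq[OF y] less_imp_le)
          then have "c \<le> r n y" by simp
          then show ?thesis by (simp add: add_increasing2)
        next
          case False
          have "c \<le> real n * \<delta>" using n(2) \<delta>(1) by (simp add: divide_le_eq)
          also have "\<dots> \<le> real n * dist x y" using False by (intro mult_left_mono) auto
          finally show ?thesis using r_nonneg[OF y, of n] by simp
        qed
      qed
      then show "\<forall>\<^sub>F n in sequentially. a < ereal (F n x)"
        using c(1) by (intro eventually_sequentiallyI[of N]) (meson ereal_less_eq(3) less_le_trans)
    qed
  qed
qed

context sobolev_function
begin

text \<open>The vertical density of the derivative is -1, so the constraint on \<phi> bounds exactly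
  the integrand that appears. For the reverse inequality, negatives of continuous functions below
  \<rho> with compact support are admissible, and Fatou's lemma carries out the limit.\<close>

lemma lifted_data_term_subgraph:
  fixes \<rho> :: "'a \<times> real \<Rightarrow> ereal"
  assumes v: "v \<in> borel_measurable (lebesgue_on (\<Omega> \<times> UNIV))"
    "AE z in lebesgue_on (\<Omega> \<times> UNIV). v z = subgraph_indicator u z"
    and \<Gamma>: "compact \<Gamma>" "AE x in M. u x \<in> \<Gamma>"
    and \<rho>: "\<forall>z\<in>\<Omega> \<times> \<Gamma>. 0 \<le> \<rho> z" "lsc_on (\<Omega> \<times> \<Gamma>) \<rho>" and ne: "\<Omega> \<times> \<Gamma> \<noteq> {}"
  shows "lifted_data_term \<Omega> \<Gamma> \<rho> v = data_term \<Omega> \<rho> u"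
proof -
  have \<Gamma>': "\<Gamma> \<in> sets borel" using \<Gamma>(1) by (simp add: compact_imp_closed)
  have in_S: "AE x in M. (x, u x) \<in> \<Omega> \<times> \<Gamma>"
    using \<Gamma>(2) AE_space by eventually_elim (simp add: space_restrict_space)
  have lint: "(LINT z:\<Omega> \<times> \<Gamma>|fst (dist_derivative (\<Omega> \<times> UNIV) v). \<phi> z * snd (snd (dist_derivative (\<Omega> \<times> UNIV) v) z))
      = (LINT x|M. - \<phi> (x, u x))" if "continuous_on (\<Omega> \<times> UNIV) \<phi>" for \<phi>
    using lint_dist_derivative[OF v \<Gamma>' \<Gamma>(2), of "\<lambda>z. (0, \<phi> z)"] that
    by (simp add: inner_prod_def continuous_on_Pair)
  define s where "s = (SUP \<phi>\<in>K_t \<Omega> \<Gamma> \<rho>. ereal (LINT x|M. - \<phi> (x, u x)))"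
  have data: "lifted_data_term \<Omega> \<Gamma> \<rho> v = s"
    unfolding lifted_data_term_def case_prod_beta Let_def s_def
    by (intro SUP_cong refl) (simp only: lint K_t_def C_0_def mem_Collect_eq)
  show ?thesis
  proof (rule antisym)
    show "lifted_data_term \<Omega> \<Gamma> \<rho> v \<le> data_term \<Omega> \<rho> u"
      unfolding data s_def
    proof (rule SUP_least)
      fix \<phi> assume \<phi>: "\<phi> \<in> K_t \<Omega> \<Gamma> \<rho>"
      have "ereal (LINT x|M. - \<phi> (x, u x)) \<le> enn2ereal (\<integral>\<^sup>+x. ennreal (- \<phi> (x, u x)) \<partial>M)"
        by (rule ereal_integral_le_nn_integral)
      also have "(\<integral>\<^sup>+x. ennreal (- \<phi> (x, u x)) \<partial>M) \<le> (\<integral>\<^sup>+x. e2ennreal (\<rho> (x, u x)) \<partial>M)"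
      proof (rule nn_integral_mono_AE)
        show "AE x in M. ennreal (- \<phi> (x, u x)) \<le> e2ennreal (\<rho> (x, u x))"
          using in_S
        proof eventually_elim
          case (elim x)
          then have "ereal (- \<phi> (x, u x)) \<le> \<rho> (x, u x)" using \<phi> by (simp add: K_t_def)
          from e2ennreal_mono[OF this] show ?case by simp
        qed
      qed
      finally show "ereal (LINT x|M. - \<phi> (x, u x)) \<le> data_term \<Omega> \<rho> u"
        by (simp add: data_term_def less_eq_ennreal.rep_eq)
    qed
    obtain F :: "nat \<Rightarrow> 'a \<times> real \<Rightarrow> real" where F: "\<And>n. continuous_on UNIV (F n)" "\<And>n z. 0 \<le> F n z"
      "\<And>n z. z \<in> \<Omega> \<times> \<Gamma> \<Longrightarrow> ereal (F n z) \<le> \<rho> z" "\<And>z. z \<in> \<Omega> \<times> \<Gamma> \<Longrightarrow> (\<lambda>n. ereal (F n z)) \<longlonglongrightarrow> \<rho> z"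
      using lsc_on_approx_continuous[OF ne \<rho>] by metis
    have "open (\<Omega> \<times> (UNIV :: real set))" using open_dom by (simp add: open_Times)
    then obtain \<eta> :: "nat \<Rightarrow> 'a \<times> real \<Rightarrow> real" where \<eta>: "\<And>n. \<eta> n \<in> test_functions (\<Omega> \<times> UNIV)"
      "\<And>n z. 0 \<le> \<eta> n z" "\<And>n z. \<eta> n z \<le> 1" "\<And>z. (\<lambda>n. \<eta> n z) \<longlonglongrightarrow> indicator (\<Omega> \<times> UNIV) z"
      using test_functions_approx_indicator by metis
    \<comment> \<open>The factor \<open>\<eta> n\<close> gives compact support, hence membership in
      \<open>C_0\<close>; as it lies between 0 and 1 and \<open>F n\<close> is nonnegative, the
      bound by \<rho> persists.\<close>
    define f where "f n z = \<eta> n z * F n z" for n z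
    have f_cont: "continuous_on UNIV (f n)" for n
      unfolding f_def
      by (intro continuous_on_mult F test_function_continuous[OF \<eta>(1)])
    have f_meas [measurable]: "f n \<in> borel_measurable borel" for n
      by (rule borel_measurable_continuous_onI[OF f_cont])
    have f_nonneg: "0 \<le> f n z" for n z using F(2) \<eta>(2) by (simp add: f_def)
    have f_le: "ereal (f n z) \<le> \<rho> z" if "z \<in> \<Omega> \<times> \<Gamma>" for n z
    proof -
      have "f n z \<le> F n z" unfolding f_def using F(2) \<eta>(2,3) by (intro mult_left_le_one_le) auto
      then show ?thesis using F(3)[OF that, of n] by (meson ereal_less_eq(3) order_trans)
    qed
    have f_C0: "(\<lambda>z. - f n z) \<in> C_0 (\<Omega> \<times> UNIV)" for n
    proof -
      obtain K where K: "compact K" "K \<subseteq> \<Omega> \<times> UNIV" and K0: "\<forall>z. z \<notin> K \<longrightarrow> \<eta> n z = 0"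
        by (rule test_functionsE[OF \<eta>(1)])
      show ?thesis
      proof (rule C_0_if_compact_support[OF _ K])
        show "continuous_on UNIV (\<lambda>z. - f n z)" by (intro continuous_on_minus f_cont)
        show "- f n z = 0" if "z \<notin> K" for z using K0[rule_format, OF that] by (simp add: f_def)
      qed
    qed
    have f_Kt: "(\<lambda>z. - f n z) \<in> K_t \<Omega> \<Gamma> \<rho>" for n
      using f_C0[of n] f_le by (simp only: K_t_def mem_Collect_eq minus_minus) blast
    have f_int: "integrable M (\<lambda>x. f n (x, u x))" for n
    proof -
      obtain K where K: "compact K" "K \<subseteq> \<Omega> \<times> UNIV" and K0: "\<forall>z. z \<notin> K \<longrightarrow> \<eta> n z = 0"
        by (rule test_functionsE[OF \<eta>(1)])
      have "compact (f n ` K)" by (rule compact_continuous_image[OF continuous_on_subset[OF f_cont] K(1)]) simp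
      then obtain B where B: "\<forall>y\<in>f n ` K. norm y \<le> B" using compact_imp_bounded bounded_iff by metis
      have f_B: "norm (f n z) \<le> max B 0" for z
        using B K0[rule_format, of z] by (cases "z \<in> K") (auto simp: f_def)
      show ?thesis
        using f_B by (intro integrable_lebesgue_on_indicator[OF integrable_bounded_mult[where B="max B 0"] dom_measurable]
            integrable_indicator_bounded[OF dom_measurable bounded_dom]) auto
    qed
    have s_ge: "ereal (LINT x|M. f n (x, u x)) \<le> s" for n
      unfolding s_def by (rule SUP_upper2[OF f_Kt[of n]]) simp
    have "0 \<le> ereal (LINT x|M. f 0 (x, u x))" using f_nonneg by simp
    then have s_nonneg: "0 \<le> s" using s_ge by (rule order_trans)
    have f_lim: "e2ennreal (\<rho> z) = liminf (\<lambda>n. ennreal (f n z))" if z: "z \<in> \<Omega> \<times> \<Gamma>" for z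
    proof -
      have "(\<lambda>n. \<eta> n z) \<longlonglongrightarrow> 1" using \<eta>(4)[of z] z by (simp add: indicator_def mem_Times_iff)
      then have "(\<lambda>n. ereal (\<eta> n z)) \<longlonglongrightarrow> ereal 1" by simp
      then have "(\<lambda>n. ereal (\<eta> n z) * ereal (F n z)) \<longlonglongrightarrow> ereal 1 * \<rho> z"
        using F(4)[OF z] by (intro tendsto_mult_ereal) simp_all
      then have "(\<lambda>n. ereal (f n z)) \<longlonglongrightarrow> \<rho> z" by (simp add: f_def flip: one_ereal_def)
      then have "(\<lambda>n. e2ennreal (ereal (f n z))) \<longlonglongrightarrow> e2ennreal (\<rho> z)"
        by (rule tendsto_e2ennrealI)
      then have "(\<lambda>n. ennreal (f n z)) \<longlonglongrightarrow> e2ennreal (\<rho> z)" by simp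
      from lim_imp_Liminf[OF _ this] show ?thesis by simp
    qed
    \<comment> \<open>Almost every point of the graph lies over \<Gamma>, where \<rho> is the limit
      of the Borel functions \<open>f n\<close>; in this form the integral is ready for Fatou's
      lemma.\<close>
    have "(\<integral>\<^sup>+x. e2ennreal (\<rho> (x, u x)) \<partial>M) = (\<integral>\<^sup>+x. liminf (\<lambda>n. ennreal (f n (x, u x))) \<partial>M)"
    proof (rule nn_integral_cong_AE)
      show "AE x in M. e2ennreal (\<rho> (x, u x)) = liminf (\<lambda>n. ennreal (f n (x, u x)))"
        using in_S by eventually_elim (rule f_lim)
    qed
    also have "\<dots> \<le> liminf (\<lambda>n. \<integral>\<^sup>+x. ennreal (f n (x, u x)) \<partial>M)"
    proof (rule nn_integral_liminf)
      fix n
      have "(\<lambda>x. f n (x, u x)) \<in> borel_measurable M" by (intro measurable_lebesgue_on_dom) measurable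
      then show "(\<lambda>x. ennreal (f n (x, u x))) \<in> borel_measurable M" by simp
    qed
    also have "\<dots> \<le> liminf (\<lambda>n::nat. e2ennreal s)"
    proof (intro Liminf_mono always_eventually allI)
      fix n
      have "(\<integral>\<^sup>+x. ennreal (f n (x, u x)) \<partial>M) = ennreal (LINT x|M. f n (x, u x))"
        using f_int f_nonneg by (intro nn_integral_eq_integral) auto
      also have "\<dots> \<le> e2ennreal s" using e2ennreal_mono[OF s_ge[of n]] by simp
      finally show "(\<integral>\<^sup>+x. ennreal (f n (x, u x)) \<partial>M) \<le> e2ennreal s" .
    qed
    also have "\<dots> = e2ennreal s" by (simp add: Liminf_const)
    finally have "(\<integral>\<^sup>+x. e2ennreal (\<rho> (x, u x)) \<partial>M) \<le> e2ennreal s" .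
    then have "data_term \<Omega> \<rho> u \<le> enn2ereal (e2ennreal s)" by (simp add: data_term_def less_eq_ennreal.rep_eq)
    also have "\<dots> = s" by (rule enn2ereal_e2ennreal[OF s_nonneg])
    finally show "data_term \<Omega> \<rho> u \<le> lifted_data_term \<Omega> \<Gamma> \<rho> v" by (simp only: data)
  qed
qed

end

subsection \<open>Borel representatives and the linear term\<close>

text \<open>A real function measurable for the completion agrees almost everywhere with a Borel
  function; this is applied to each coordinate of the extension by zero.\<close>

lemma integrable_lebesgue_on_representative:
  fixes f :: "'a::euclidean_space \<Rightarrow> 'b::euclidean_space"
  assumes S: "S \<in> sets borel" and f: "integrable (lebesgue_on S) f"
  obtains f' where "integrable lborel f'" "AE x in lborel. f' x = indicator S x *\<^sub>R f x"
proof -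
  have int: "integrable lebesgue (\<lambda>x. indicator S x *\<^sub>R f x)"
    using f S by (simp add: integrable_restrict_space)
  have "\<exists>h\<in>borel_measurable lborel. AE x in lborel. (indicator S x *\<^sub>R f x) \<bullet> i = h x" for i
    using int by (intro completion_ex_borel_measurable_real borel_measurable_inner) auto
  then obtain h where h: "\<And>i. h i \<in> borel_measurable lborel" "\<And>i. AE x in lborel. (indicator S x *\<^sub>R f x) \<bullet> i = h i x"
    by metis
  define f' where "f' x = (\<Sum>i\<in>Basis. h i x *\<^sub>R i)" for x
  have meas: "f' \<in> borel_measurable lborel"
    unfolding f'_def using h(1) by (intro borel_measurable_sum borel_measurable_scaleR) auto
  have "AE x in lborel. \<forall>i\<in>Basis. (indicator S x *\<^sub>R f x) \<bullet> i = h i x"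
    using h(2) by (intro AE_finite_allI) auto
  then have eq: "AE x in lborel. f' x = indicator S x *\<^sub>R f x"
  proof eventually_elim
    case (elim x)
    then have "f' x = (\<Sum>i\<in>Basis. ((indicator S x *\<^sub>R f x) \<bullet> i) *\<^sub>R i)" by (simp add: f'_def)
    then show ?case by (simp only: euclidean_representation)
  qed
  have "integrable lebesgue f'"
  proof (rule integrable_cong_AE_imp[OF int])
    show "f' \<in> borel_measurable lebesgue" using meas by (rule measurable_completion)
    show "AE x in lebesgue. indicator S x *\<^sub>R f x = f' x"
      using AE_completion[OF eq] by eventually_elim simp
  qed
  then have "integrable lborel f'" using meas by (simp add: integrable_completion)
  then show ?thesis using that eq by blast
qed

lemma AE_representative:
  fixes f f' :: "'a::euclidean_space \<Rightarrow> 'b::real_vector"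
  assumes "S \<in> sets borel" and "AE x in lborel. f' x = indicator S x *\<^sub>R f x"
  shows "AE x in lebesgue_on S. f' x = f x"
proof -
  have "AE x in lborel. x \<in> S \<longrightarrow> f' x = f x" using assms(2) by eventually_elim simp
  from AE_completion[OF this] show ?thesis
    using assms(1) by (simp add: AE_restrict_space_iff)
qed

lemma integral_representative:
  fixes f f' h :: "'a::euclidean_space \<Rightarrow> real"
  assumes S: "S \<in> sets borel" and f: "f \<in> borel_measurable (lebesgue_on S)"
    and f': "f' \<in> borel_measurable borel" "AE x in lborel. f' x = indicator S x *\<^sub>R f x"
    and h: "h \<in> borel_measurable borel"
  shows "(LBINT x. f' x * h x) = (LINT x|lebesgue_on S. f x * h x)"
proof -
  have "(LBINT x. f' x * h x) = (LBINT x. indicator S x *\<^sub>R (f' x * h x))"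
  proof (rule integral_cong_AE)
    show "AE x in lborel. f' x * h x = indicator S x *\<^sub>R (f' x * h x)"
      using f'(2) by eventually_elim (simp add: indicator_def)
  qed (use f'(1) h S in auto)
  also have "\<dots> = (LINT x|lebesgue_on S. f' x * h x)"
    using f' h S by (intro integral_lebesgue_on_borel[symmetric]) auto
  also have "\<dots> = (LINT x|lebesgue_on S. f x * h x)"
  proof (rule integral_cong_AE)
    have meas: "F \<in> borel_measurable (lebesgue_on S)" if "F \<in> borel_measurable borel" for F :: "'a \<Rightarrow> real"
      using that by (intro measurable_restrict_space1 measurable_completion) simp
    show "(\<lambda>x. f' x * h x) \<in> borel_measurable (lebesgue_on S)"
      using f' h by (intro meas borel_measurable_times)
    show "(\<lambda>x. f x * h x) \<in> borel_measurable (lebesgue_on S)"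
      using h by (intro borel_measurable_times f meas)
    show "AE x in lebesgue_on S. f' x * h x = f x * h x"
      using AE_representative[OF S f'(2)] by eventually_elim simp
  qed
  finally show ?thesis .
qed

text \<open>The extension by zero may jump at the boundary of \<Omega>, but test functions of
  \<Omega> vanish there, so the weak derivative identity is preserved.\<close>

lemma W11_representative:
  assumes \<Omega>: "open \<Omega>" "bounded \<Omega>" and w: "w \<in> W11 \<Omega> \<Gamma>"
  obtains w' g where "sobolev_function \<Omega> w' g" "AE x in lebesgue_on \<Omega>. w' x = w x"
    "AE x in lebesgue_on \<Omega>. w' x \<in> \<Gamma>"
proof -
  have \<Omega>_meas: "\<Omega> \<in> sets borel" using \<Omega>(1) by simp
  obtain G where w_int: "integrable (lebesgue_on \<Omega>) w" and w_\<Gamma>: "AE x in lebesgue_on \<Omega>. w x \<in> \<Gamma>"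
    and G_int: "integrable (lebesgue_on \<Omega>) G" and weak: "weak_gradient \<Omega> w G"
    using w by (auto simp: W11_def)
  obtain w' where w': "integrable lborel w'" "AE x in lborel. w' x = indicator \<Omega> x *\<^sub>R w x"
    by (rule integrable_lebesgue_on_representative[OF \<Omega>_meas w_int])
  obtain g where g: "integrable lborel g" "AE x in lborel. g x = indicator \<Omega> x *\<^sub>R G x"
    by (rule integrable_lebesgue_on_representative[OF \<Omega>_meas G_int])
  have w'_AE: "AE x in lebesgue_on \<Omega>. w' x = w x" by (rule AE_representative[OF \<Omega>_meas w'(2)])
  have "sobolev_function \<Omega> w' g"
  proof
    fix \<phi> :: "'a \<Rightarrow> real" and e :: 'a
    assume \<phi>: "\<phi> \<in> test_functions \<Omega>" and e: "e \<in> Basis"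
    have "(LBINT x. w' x * frechet_derivative \<phi> (at x) e) = (LINT x|lebesgue_on \<Omega>. w x * frechet_derivative \<phi> (at x) e)"
      using w_int w' test_function_measurable[OF test_function_derivative[OF \<phi>]]
      by (intro integral_representative[OF \<Omega>_meas]) (auto dest: borel_measurable_integrable)
    also have "\<dots> = - (LINT x|lebesgue_on \<Omega>. (G x \<bullet> e) * \<phi> x)"
      using weak \<phi> e by (simp add: weak_gradient_def)
    also have "(LINT x|lebesgue_on \<Omega>. (G x \<bullet> e) * \<phi> x) = (LBINT x. (g x \<bullet> e) * \<phi> x)"
    proof (rule integral_representative[OF \<Omega>_meas, symmetric])
      show "(\<lambda>x. G x \<bullet> e) \<in> borel_measurable (lebesgue_on \<Omega>)"
        using borel_measurable_integrable[OF G_int] by simp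
      show "(\<lambda>x. g x \<bullet> e) \<in> borel_measurable borel"
        using borel_measurable_integrable[OF g(1)] by simp
      show "AE x in lborel. g x \<bullet> e = indicator \<Omega> x *\<^sub>R (G x \<bullet> e)"
        using g(2) by eventually_elim simp
    qed (rule test_function_measurable[OF \<phi>])
    finally show "(LBINT x. w' x * frechet_derivative \<phi> (at x) e) = - (LBINT x. (g x \<bullet> e) * \<phi> x)" .
  qed (use \<Omega> w' g in auto)
  moreover have "AE x in lebesgue_on \<Omega>. w' x \<in> \<Gamma>"
    using w'_AE w_\<Gamma> by eventually_elim simp
  ultimately show ?thesis using that w'_AE by blast
qed

text \<open>The exceptional set is first enlarged to a measurable null set, so that the two
  quantifiers may be exchanged; the compatibility hypothesis fixes t first.\<close>

lemma AE_lborel_pair_swap: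
  fixes Q :: "'a::euclidean_space \<times> 'b::euclidean_space \<Rightarrow> bool"
  assumes "AE z in lborel. Q z"
  shows "AE t in lborel. AE x in lborel. Q (x, t)"
proof -
  obtain N where N: "N \<in> null_sets lborel" "{z \<in> space lborel. \<not> Q z} \<subseteq> N"
    using assms unfolding eventually_ae_filter by blast
  have N_meas: "N \<in> sets (lborel \<Otimes>\<^sub>M lborel)" unfolding lborel_prod by (rule null_setsD2[OF N(1)])
  have "AE z in lborel \<Otimes>\<^sub>M lborel. z \<notin> N" using N(1) by (simp add: lborel_prod AE_not_in)
  then have "AE x in lborel. AE t in lborel. (x, t) \<notin> N" by (rule lborel_pair.AE_pair)
  moreover have "{z \<in> space (lborel \<Otimes>\<^sub>M lborel). (fst z, snd z) \<notin> N} \<in> sets (lborel \<Otimes>\<^sub>M lborel)"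
    using sets.compl_sets[OF N_meas] by (simp add: set_diff_eq)
  ultimately have "AE t in lborel. AE x in lborel. (x, t) \<notin> N"
    by (simp only: lborel_pair.AE_commute)
  then show ?thesis
  proof eventually_elim
    case (elim t)
    then show ?case
    proof eventually_elim
      case (elim x)
      then show ?case using N(2) by auto
    qed
  qed
qed

text \<open>A set with null slices is null only if it is measurable, whence the first
  hypothesis.\<close>

lemma AE_lborel_pairI:
  fixes P :: "'a::euclidean_space \<times> 'b::euclidean_space \<Rightarrow> bool"
  assumes P: "{z. P z} \<in> sets borel" and ae: "AE t in lborel. AE x in lborel. P (x, t)"
  shows "AE z in lborel. P z"
proof -
  have meas: "{z \<in> space (lborel \<Otimes>\<^sub>M lborel). P z} \<in> sets (lborel \<Otimes>\<^sub>M lborel)"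
    unfolding lborel_prod using P by simp
  have "AE x in lborel. AE t in lborel. P (x, t)"
    using ae meas by (subst lborel_pair.AE_commute) (auto simp: space_pair_measure)
  from lborel_pair.AE_pair_measure[OF meas this] show ?thesis unfolding lborel_prod .
qed

text \<open>From 2|f| \<le> 1 + f^2 on a set of finite measure.\<close>

lemma integrable_if_L2:
  assumes "f \<in> L2_space (lebesgue_on S)" and "S \<in> sets borel" "bounded S"
  shows "integrable (lebesgue_on S) f"
proof (rule Bochner_Integration.integrable_bound[of _ "\<lambda>x. 1 + (f x)\<^sup>2"])
  have "integrable (lebesgue_on S) (\<lambda>x. 1 :: real)"
    by (rule integrable_lebesgue_on_indicator) (use assms integrable_indicator_bounded in simp_all)
  then show "integrable (lebesgue_on S) (\<lambda>x. 1 + (f x)\<^sup>2)" using assms(1) by (simp add: L2_space_def)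
  show "f \<in> borel_measurable (lebesgue_on S)" using assms(1) by (simp add: L2_space_def)
  show "AE x in lebesgue_on S. norm (f x) \<le> norm (1 + (f x)\<^sup>2)"
  proof (rule AE_I2)
    fix x
    have "0 \<le> (\<bar>f x\<bar> - 1)\<^sup>2" by simp
    then have "2 * \<bar>f x\<bar> \<le> 1 + (f x)\<^sup>2" by (simp add: power2_diff)
    then show "norm (f x) \<le> norm (1 + (f x)\<^sup>2)" by simp
  qed
qed

context sobolev_function
begin

text \<open>Compatibility is given slice by slice, and \<open>q\<close> and \<open>p\<close> are
  only Lebesgue measurable. Borel representatives make the set where the two sides agree a Borel
  set, so that agreement on slices becomes agreement on the product.\<close>

lemma AE_subgradient_representative:
  fixes p' :: "'a \<Rightarrow> real" and q :: "'a \<times> real \<Rightarrow> real"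
  assumes \<Gamma>: "\<Gamma> \<in> sets borel" "bounded \<Gamma>" and p': "p' \<in> borel_measurable borel" "AE x in M. p' x = p x"
    and q: "q \<in> L2_space (lebesgue_on (\<Omega> \<times> \<Gamma>))"
    and compatible: "AE t in lebesgue_on \<Gamma>. AE x in M. q (x, t) = p x"
  shows "AE z in lebesgue_on (\<Omega> \<times> \<Gamma>). q z = p' (fst z)"
proof -
  have S: "\<Omega> \<times> \<Gamma> \<in> sets borel" by (rule dom_times_measurable[OF \<Gamma>(1)])
  have "bounded (\<Omega> \<times> \<Gamma>)" using bounded_dom \<Gamma>(2) by (rule bounded_Times)
  then have "integrable (lebesgue_on (\<Omega> \<times> \<Gamma>)) q" by (rule integrable_if_L2[OF q S])
  then obtain q' where q': "integrable lborel q'" "AE z in lborel. q' z = indicator (\<Omega> \<times> \<Gamma>) z *\<^sub>R q z"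
    by (rule integrable_lebesgue_on_representative[OF S])
  have q'_meas: "q' \<in> borel_measurable borel" using borel_measurable_integrable[OF q'(1)] by simp
  have p'_fst: "(\<lambda>z :: 'a \<times> real. p' (fst z)) \<in> borel_measurable borel"
    by (rule measurable_compose[OF borel_measurable_continuous_onI[OF continuous_on_fst[OF continuous_on_id]] p'(1)])
  have "AE t in lborel. AE x in lborel. q' (x, t) = indicator (\<Omega> \<times> \<Gamma>) (x, t) *\<^sub>R q (x, t)"
    by (rule AE_lborel_pair_swap[OF q'(2)])
  moreover have "AE t in lborel. t \<in> \<Gamma> \<longrightarrow> (AE x in M. q (x, t) = p x)"
    using compatible \<Gamma>(1) by (simp add: AE_restrict_space_iff AE_completion_iff)
  ultimately have "AE t in lborel. AE x in lborel. (x, t) \<in> \<Omega> \<times> \<Gamma> \<longrightarrow> q' (x, t) = p' (fst (x, t))"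
  proof eventually_elim
    case (elim t)
    show ?case
    proof (cases "t \<in> \<Gamma>")
      case True
      then have "AE x in M. q (x, t) = p' x"
        using elim(2) p'(2) by (auto elim: eventually_elim2)
      then have "AE x in lborel. x \<in> \<Omega> \<longrightarrow> q (x, t) = p' x" by (simp add: AE_dom_iff)
      with elim(1) show ?thesis by eventually_elim auto
    qed simp
  qed
  then have "AE z in lborel. z \<in> \<Omega> \<times> \<Gamma> \<longrightarrow> q' z = p' (fst z)"
  proof (rule AE_lborel_pairI[rotated])
    have "{z. q' z = p' (fst z)} \<in> sets borel"
      using q'_meas p'_fst by (intro borel_measurable_eq[where M=borel, simplified])
    moreover have "{z. z \<in> \<Omega> \<times> \<Gamma> \<longrightarrow> q' z = p' (fst z)} = - (\<Omega> \<times> \<Gamma>) \<union> {z. q' z = p' (fst z)}" by auto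
    ultimately show "{z. z \<in> \<Omega> \<times> \<Gamma> \<longrightarrow> q' z = p' (fst z)} \<in> sets borel"
      using S by (simp add: borel_comp)
  qed
  then have "AE z in lborel. z \<in> \<Omega> \<times> \<Gamma> \<longrightarrow> q z = p' (fst z)"
    using q'(2) by eventually_elim auto
  then show ?thesis using S by (simp add: AE_restrict_space_iff AE_completion_iff)
qed

lemma pairing_subgraph:
  fixes p :: "'a \<Rightarrow> real" and q :: "'a \<times> real \<Rightarrow> real"
  assumes v: "v \<in> borel_measurable (lebesgue_on (\<Omega> \<times> UNIV))"
    "AE z in lebesgue_on (\<Omega> \<times> UNIV). v z = subgraph_indicator u z"
    and \<Gamma>: "compact \<Gamma>" "is_interval \<Gamma>" "\<Gamma> \<noteq> {}" "AE x in M. u x \<in> \<Gamma>"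
    and p: "p \<in> L2_space M" and q: "q \<in> L2_space (lebesgue_on (\<Omega> \<times> \<Gamma>))"
    and compatible: "AE t in lebesgue_on \<Gamma>. AE x in M. q (x, t) = p x"
  shows "pairing (lebesgue_on (\<Omega> \<times> \<Gamma>)) q v
    = pairing M p u - Inf \<Gamma> * (LINT x|M. p x)"
proof -
  obtain a b where ab: "\<Gamma> = {a..b}" using \<Gamma>(1,2) is_interval_compact by (metis interval_cbox)
  then have a_le_b: "a \<le> b" using \<Gamma>(3) by simp
  have \<Gamma>_meas: "\<Gamma> \<in> sets borel" and Inf: "Inf \<Gamma> = a" using ab a_le_b by (simp_all add: cInf_atLeastAtMost)
  have S: "\<Omega> \<times> \<Gamma> \<in> sets borel" by (rule dom_times_measurable[OF \<Gamma>_meas])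
  have p_int: "integrable M p" by (rule integrable_if_L2[OF p dom_measurable bounded_dom])
  obtain p' where p': "integrable lborel p'" "AE x in lborel. p' x = indicator \<Omega> x *\<^sub>R p x"
    by (rule integrable_lebesgue_on_representative[OF dom_measurable p_int])
  have p'_meas [measurable]: "p' \<in> borel_measurable borel" using borel_measurable_integrable[OF p'(1)] by simp
  have p'_fst [measurable]: "(\<lambda>z :: 'a \<times> real. p' (fst z)) \<in> borel_measurable borel"
    by (rule measurable_compose[OF borel_measurable_continuous_onI[OF continuous_on_fst[OF continuous_on_id]] p'_meas])
  have p'_AE: "AE x in M. p' x = p x" by (rule AE_representative[OF dom_measurable p'(2)])
  let ?v = "subgraph_indicator u"
  let ?f = "\<lambda>z. indicator (\<Omega> \<times> \<Gamma>) z *\<^sub>R (p' (fst z) * ?v z)"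
  have pv_meas: "(\<lambda>z. p' (fst z) * ?v z) \<in> borel_measurable borel"
    by (rule borel_measurable_times[OF p'_fst borel_measurable_subgraph_indicator[OF fun_measurable]])
  have f_meas: "?f \<in> borel_measurable borel" using S pv_meas by simp
  have q_AE: "AE z in lebesgue_on (\<Omega> \<times> \<Gamma>). q z = p' (fst z)"
    by (rule AE_subgradient_representative[OF \<Gamma>_meas compact_imp_bounded[OF \<Gamma>(1)] p'_meas p'_AE q compatible])
  have dom: "\<Omega> \<times> (UNIV :: real set) \<in> sets borel" by (rule dom_times_measurable) simp
  have v_AE: "AE z in lebesgue_on (\<Omega> \<times> \<Gamma>). v z = ?v z"
    using v(2) S dom by (auto simp: AE_restrict_space_iff elim: eventually_mono)
  have v_meas: "v \<in> borel_measurable (lebesgue_on (\<Omega> \<times> \<Gamma>))"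
  proof -
    have "v \<in> borel_measurable (restrict_space (lebesgue_on (\<Omega> \<times> UNIV)) (\<Omega> \<times> \<Gamma>))"
      by (rule measurable_restrict_space1[OF v(1)])
    moreover have "restrict_space (lebesgue_on (\<Omega> \<times> UNIV)) (\<Omega> \<times> \<Gamma>) = lebesgue_on (\<Omega> \<times> \<Gamma>)"
      using S dom by (subst restrict_restrict_space) (auto intro!: arg_cong[of _ _ "restrict_space lebesgue"])
    ultimately show ?thesis by simp
  qed
  have "pairing (lebesgue_on (\<Omega> \<times> \<Gamma>)) q v = (LINT z|lebesgue_on (\<Omega> \<times> \<Gamma>). p' (fst z) * ?v z)"
    unfolding pairing_def
  proof (rule integral_cong_AE)
    show "(\<lambda>z. q z * v z) \<in> borel_measurable (lebesgue_on (\<Omega> \<times> \<Gamma>))"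
      using q v_meas by (intro borel_measurable_times) (simp_all add: L2_space_def)
    show "(\<lambda>z. p' (fst z) * ?v z) \<in> borel_measurable (lebesgue_on (\<Omega> \<times> \<Gamma>))"
      using pv_meas by (intro measurable_restrict_space1 measurable_completion) simp
    show "AE z in lebesgue_on (\<Omega> \<times> \<Gamma>). q z * v z = p' (fst z) * ?v z"
      using q_AE v_AE by eventually_elim simp
  qed
  also have "\<dots> = (LBINT z. ?f z)"
    by (rule integral_lebesgue_on_borel[OF pv_meas S])
  also have "\<dots> = (LINT z|(lborel \<Otimes>\<^sub>M lborel). ?f z)" by (simp add: lborel_prod)
  also have "\<dots> = (LBINT x. (LBINT t. ?f (x, t)))"
  proof (rule lborel_pair.integral_fst'[symmetric])
    \<comment> \<open>Fubini needs joint integrability, obtained by domination with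
      \<open>p' (fst z) * indicator \<Gamma> (snd z)\<close>.\<close>
    have \<Gamma>_int: "integrable lborel (indicator \<Gamma> :: real \<Rightarrow> real)"
      by (rule integrable_indicator_bounded[OF \<Gamma>_meas compact_imp_bounded[OF \<Gamma>(1)]])
    have "integrable (lborel \<Otimes>\<^sub>M lborel) (\<lambda>z. p' (fst z) * indicator \<Gamma> (snd z))"
    proof (rule lborel_pair.Fubini_integrable)
      show "(\<lambda>z. p' (fst z) * indicator \<Gamma> (snd z)) \<in> borel_measurable (lborel \<Otimes>\<^sub>M lborel)"
        using \<Gamma>_meas by measurable
      have "(LBINT t. norm (p' (fst (x, t)) * indicator \<Gamma> (snd (x, t)))) = \<bar>p' x\<bar> * measure lborel \<Gamma>" for x
        using \<Gamma>_meas by (simp add: abs_mult)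
      then show "integrable lborel (\<lambda>x. LBINT t. norm (p' (fst (x, t)) * indicator \<Gamma> (snd (x, t))))"
        using p'(1) by simp
      show "AE x in lborel. integrable lborel (\<lambda>t. p' (fst (x, t)) * indicator \<Gamma> (snd (x, t)))"
        using \<Gamma>_int by simp
    qed
    then show "integrable (lborel \<Otimes>\<^sub>M lborel) ?f"
    proof (rule Bochner_Integration.integrable_bound)
      show "?f \<in> borel_measurable (lborel \<Otimes>\<^sub>M lborel)" using f_meas by (simp add: lborel_prod)
      show "AE z in lborel \<Otimes>\<^sub>M lborel. norm (?f z) \<le> norm (p' (fst z) * indicator \<Gamma> (snd z))"
        using subgraph_indicator_bounds[of u]
        by (intro AE_I2) (auto simp: indicator_def abs_mult mem_Times_iff intro!: mult_left_le)
    qed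
  qed
  also have "\<dots> = (LBINT x. indicator \<Omega> x * (p' x * (u x - a)))"
  proof (rule integral_cong_AE)
    \<comment> \<open>Within \<Gamma> the slice of the subgraph over \<open>x\<close> is
      \<open>{a..<u x}\<close>, of length \<open>u x - a\<close>; this is the origin of the constant
      with \<open>Inf \<Gamma>\<close>.\<close>
    have inner: "(LBINT t. ?f (x, t)) = indicator \<Omega> x * (p' x * (u x - a))" if "x \<in> \<Omega> \<longrightarrow> u x \<in> \<Gamma>" for x
    proof (cases "x \<in> \<Omega>")
      case True
      then have ux: "a \<le> u x" "u x \<le> b" using that ab by auto
      then have "?f (x, t) = p' x * indicator {a..<u x} t" for t
        using True by (auto simp: ab indicator_def subgraph_indicator_def)
      then have "(LBINT t. ?f (x, t)) = (LBINT t. p' x * indicator {a..<u x} t)"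
        by (simp only:)
      then show ?thesis using True ux by simp
    qed simp
    have "AE x in lborel. x \<in> \<Omega> \<longrightarrow> u x \<in> \<Gamma>" using \<Gamma>(4) by (simp add: AE_dom_iff)
    then show "AE x in lborel. (LBINT t. ?f (x, t)) = indicator \<Omega> x * (p' x * (u x - a))"
      by eventually_elim (rule inner)
    have "?f \<in> borel_measurable (lborel \<Otimes>\<^sub>M lborel)" using f_meas by (simp add: lborel_prod)
    moreover have "(\<lambda>(x, t). ?f (x, t)) = ?f" by (auto simp: fun_eq_iff)
    ultimately have "(\<lambda>(x, t). ?f (x, t)) \<in> borel_measurable (lborel \<Otimes>\<^sub>M lborel)" by (simp only:)
    then show "(\<lambda>x. LBINT t. ?f (x, t)) \<in> borel_measurable lborel"
      by (rule lborel.borel_measurable_lebesgue_integral)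
  qed measurable
  also have "\<dots> = (LINT x|M. p' x * (u x - a))"
    using integral_lebesgue_on_borel[of "\<lambda>x. p' x * (u x - a)" \<Omega>] by simp
  also have "\<dots> = (LINT x|M. p' x * u x) - a * (LINT x|M. p' x)"
  proof -
    have p'_int: "integrable M p'" by (rule integrable_lebesgue_on_borel[OF p'(1) dom_measurable])
    have "integrable M (\<lambda>x. p' x * u x)"
    proof (rule integrable_mult_bounded[OF p'_int measurable_lebesgue_on_dom[OF fun_measurable]])
      show "AE x in M. \<bar>u x\<bar> \<le> max \<bar>a\<bar> \<bar>b\<bar>"
        using \<Gamma>(4) by eventually_elim (auto simp: ab)
    qed
    with p'_int show ?thesis by (simp add: right_diff_distrib mult.commute[of _ a])
  qed
  also have "(LINT x|M. p' x * u x) = (LINT x|M. p x * u x)"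
  proof (rule integral_cong_AE)
    show "AE x in M. p' x * u x = p x * u x" using p'_AE by eventually_elim simp
    show "(\<lambda>x. p x * u x) \<in> borel_measurable M"
      using p_int by (intro borel_measurable_times measurable_lebesgue_on_dom[OF fun_measurable]) auto
  qed (intro measurable_lebesgue_on_dom; measurable)
  also have "(LINT x|M. p' x) = (LINT x|M. p x)"
    by (rule integral_cong_AE[OF measurable_lebesgue_on_dom[OF p'_meas] borel_measurable_integrable[OF p_int] p'_AE])
  finally show ?thesis by (simp add: pairing_def Inf)
qed

end

subsection \<open>Comparison of the two energies\<close>

context sobolev_function
begin

lemma subgraph_in_relaxed_set:
  assumes \<Gamma>: "compact \<Gamma>" "AE x in M. u x \<in> \<Gamma>"
  shows "subgraph_indicator u \<in> relaxed_set \<Omega> \<Gamma>"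
proof -
  let ?v = "subgraph_indicator u"
  have "integrable (lebesgue_on K) ?v" if "compact K" for K
  proof -
    have K: "K \<in> sets borel" using that by (simp add: compact_imp_closed)
    show ?thesis
      using subgraph_indicator_bounds[of u]
      by (intro integrable_lebesgue_on_indicator[OF integrable_bounded_mult[where B=1] K]
          integrable_indicator_bounded[OF K compact_imp_bounded[OF that]]) auto
  qed
  then have "?v \<in> BV_loc (\<Omega> \<times> UNIV)"
    using is_derivative_measure_subgraph subgraph_measurable_dom by (auto simp: BV_loc_def)
  moreover have "AE z in lebesgue_on (\<Omega> \<times> UNIV). ?v z \<in> {0..1}"
    using subgraph_indicator_bounds[of u] by (intro AE_I2) simp
  \<comment> \<open>The subgraph is defined by a strict inequality, so at
    \<open>t = Inf \<Gamma>\<close> the indicator vanishes wherever \<open>u\<close> attains the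
    minimum, possibly on a set of positive measure. This single value of t is discarded as a null
    set.\<close>
  moreover have "AE t in lebesgue. t \<le> Inf \<Gamma> \<longrightarrow> (AE x in M. ?v (x, t) = 1)"
    using AE_completion[OF AE_lborel_singleton[of "Inf \<Gamma>"]]
  proof eventually_elim
    case (elim t)
    show ?case
    proof
      assume "t \<le> Inf \<Gamma>"
      with elim have t: "t < Inf \<Gamma>" by simp
      show "AE x in M. ?v (x, t) = 1"
        using \<Gamma>(2)
      proof eventually_elim
        case (elim x)
        then have "Inf \<Gamma> \<le> u x"
          using compact_imp_bounded[OF \<Gamma>(1)] by (intro cInf_lower bounded_imp_bdd_below)
        with t show ?case by (simp add: subgraph_indicator_def)
      qed
    qed
  qed
  moreover have "AE t in lebesgue. t > Sup \<Gamma> \<longrightarrow> (AE x in M. ?v (x, t) = 0)"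
  proof (rule AE_I2, rule impI)
    fix t
    assume t: "t > Sup \<Gamma>"
    show "AE x in M. ?v (x, t) = 0"
      using \<Gamma>(2)
    proof eventually_elim
      case (elim x)
      then have "u x \<le> Sup \<Gamma>"
        using compact_imp_bounded[OF \<Gamma>(1)] by (intro cSup_upper bounded_imp_bdd_above)
      with t show ?case by (simp add: subgraph_indicator_def)
    qed
  qed
  ultimately show ?thesis by (simp add: relaxed_set_def)
qed

lemma lifted_energy_subgraph:
  fixes \<rho> :: "'a \<times> real \<Rightarrow> ereal"
  assumes v: "v \<in> borel_measurable (lebesgue_on (\<Omega> \<times> UNIV))"
    "AE z in lebesgue_on (\<Omega> \<times> UNIV). v z = subgraph_indicator u z"
    and \<Gamma>: "compact \<Gamma>" "is_interval \<Gamma>" "AE x in M. u x \<in> \<Gamma>"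
    and \<rho>: "\<forall>z\<in>\<Omega> \<times> \<Gamma>. 0 \<le> \<rho> z" "lsc_on (\<Omega> \<times> \<Gamma>) \<rho>" and ne: "\<Omega> \<times> \<Gamma> \<noteq> {}"
    and p: "p \<in> L2_space M" and q: "q \<in> L2_space (lebesgue_on (\<Omega> \<times> \<Gamma>))"
    and compatible: "AE t in lebesgue_on \<Gamma>. AE x in M. q (x, t) = p x"
  shows "lifted_energy \<Omega> \<Gamma> \<rho> q v
    = bregman_energy \<Omega> \<rho> p u + ereal (Inf \<Gamma> * (LINT x|M. p x))"
proof -
  have "\<Gamma> \<noteq> {}" using ne by auto
  note eqs = lifted_data_term_subgraph[OF v \<Gamma>(1,3) \<rho> ne] lifted_TV_subgraph[OF v \<Gamma>(1,3)]
    pairing_subgraph[OF v \<Gamma>(1,2) \<open>\<Gamma> \<noteq> {}\<close> \<Gamma>(3) p q compatible]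
  \<comment> \<open>By \<open>TV_eq\<close> and the form of the pairings, everything except the data
    term is a real number, so a case distinction on the data term settles the extended
    arithmetic.\<close>
  show ?thesis
    unfolding lifted_energy_def bregman_energy_def eqs TV_eq
    by (cases "data_term \<Omega> \<rho> u") simp_all
qed

end

lemma bregman_energy_cong:
  fixes \<Omega> :: "'a::euclidean_space set"
  assumes w: "w \<in> borel_measurable (lebesgue_on \<Omega>)" "w' \<in> borel_measurable (lebesgue_on \<Omega>)"
    and eq: "AE x in lebesgue_on \<Omega>. w x = w' x" and p: "p \<in> borel_measurable (lebesgue_on \<Omega>)"
  shows "bregman_energy \<Omega> \<rho> p w = bregman_energy \<Omega> \<rho> p w'"
proof -
  have "data_term \<Omega> \<rho> w = data_term \<Omega> \<rho> w'"
    unfolding data_term_def using eq by (intro arg_cong[of _ _ enn2ereal] nn_integral_cong_AE) auto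
  moreover have "TV \<Omega> w = TV \<Omega> w'"
    unfolding TV_def
  proof (intro SUP_cong refl arg_cong[of _ _ ereal] integral_cong_AE)
    fix \<psi> :: "'a \<Rightarrow> 'a"
    assume "\<psi> \<in> {\<psi> \<in> test_functions \<Omega>. \<forall>x\<in>\<Omega>. norm (\<psi> x) \<le> 1}"
    then have \<psi>: "\<psi> \<in> test_functions \<Omega>" by simp
    have d: "divergence \<psi> \<in> borel_measurable (lebesgue_on \<Omega>)"
      by (rule continuous_imp_measurable_lebesgue_on[OF test_function_continuous[OF test_function_divergence[OF \<psi>]]])
    show "(\<lambda>x. w x * - divergence \<psi> x) \<in> borel_measurable (lebesgue_on \<Omega>)"
      and "(\<lambda>x. w' x * - divergence \<psi> x) \<in> borel_measurable (lebesgue_on \<Omega>)"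
      using w d by simp_all
    show "AE x in lebesgue_on \<Omega>. w x * - divergence \<psi> x = w' x * - divergence \<psi> x"
      using eq by eventually_elim simp
  qed
  moreover have "pairing (lebesgue_on \<Omega>) p w = pairing (lebesgue_on \<Omega>) p w'"
    unfolding pairing_def using eq w p by (intro integral_cong_AE) auto
  ultimately show ?thesis by (simp add: bregman_energy_def)
qed

text \<open>The two indicators differ only over a Borel null set N of base points, and the cylinder
  over N is null by Fubini.\<close>

lemma AE_subgraph_indicator_cong:
  fixes \<Omega> :: "'a::euclidean_space set"
  assumes \<Omega>: "open \<Omega>" and eq: "AE x in lebesgue_on \<Omega>. w x = w' x"
  shows "AE z in lebesgue_on (\<Omega> \<times> UNIV). subgraph_indicator w z = subgraph_indicator w' z"
proof -
  have S: "\<Omega> \<times> (UNIV :: real set) \<in> sets borel" using \<Omega> by (intro borel_Times) simp_all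
  have "AE x in lborel. x \<in> \<Omega> \<longrightarrow> w x = w' x"
    using eq \<Omega> by (simp add: AE_restrict_space_iff AE_completion_iff)
  then obtain N where N: "N \<in> null_sets lborel" "{x \<in> space lborel. \<not> (x \<in> \<Omega> \<longrightarrow> w x = w' x)} \<subseteq> N"
    unfolding eventually_ae_filter by blast
  have "AE z :: 'a \<times> real in lborel. fst z \<notin> N"
  proof (rule AE_lborel_pairI)
    have "fst -` (- N) \<inter> space (borel :: ('a \<times> real) measure) \<in> sets borel"
      using null_setsD2[OF N(1)]
      by (intro measurable_sets[OF borel_measurable_continuous_onI[OF continuous_on_fst[OF continuous_on_id]]])
        (simp add: borel_comp)
    then show "{z :: 'a \<times> real. fst z \<notin> N} \<in> sets borel" by (simp add: vimage_def)
    show "AE t in (lborel :: real measure). AE x in lborel. fst (x, t) \<notin> N"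
      by (rule AE_I2) (simp add: AE_not_in[OF N(1)])
  qed
  then have "AE z in lborel. z \<in> \<Omega> \<times> UNIV \<longrightarrow> subgraph_indicator w z = subgraph_indicator w' z"
  proof eventually_elim
    case (elim z)
    then show ?case using N(2) by (cases z) (auto simp: subgraph_indicator_def)
  qed
  then show ?thesis using S by (simp add: AE_restrict_space_iff AE_completion_iff)
qed

theorem proposition1:
  fixes \<Omega> :: "(real ^ 2) set" and \<Gamma> :: "real set"
    and \<rho> :: "(real ^ 2) \<times> real \<Rightarrow> ereal"
    and u p :: "nat \<Rightarrow> real ^ 2 \<Rightarrow> real"
    and v q :: "nat \<Rightarrow> (real ^ 2) \<times> real \<Rightarrow> real"
    and k :: nat
  assumes "open \<Omega>" and "bounded \<Omega>"
    and "compact \<Gamma>" and "is_interval \<Gamma>" and "\<Gamma> \<noteq> {}"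
    and rho_nonneg: "\<forall>z\<in>\<Omega> \<times> \<Gamma>. 0 \<le> \<rho> z"
    and rho_proper: "\<exists>z\<in>\<Omega> \<times> \<Gamma>. \<rho> z \<noteq> \<infinity>"
    and rho_lsc: "lsc_on (\<Omega> \<times> \<Gamma>) \<rho>"
    and H_convex: "convex_functional_on (W11 \<Omega> \<Gamma>) (data_term \<Omega> \<rho>)"
    and original: "bregman_iteration \<Omega> \<Gamma> \<rho> u p"
    and lifted: "lifted_bregman_iteration \<Omega> \<Gamma> \<rho> v q"
    and unique: "\<forall>j\<ge>1. \<forall>w. is_arg_min (bregman_energy \<Omega> \<rho> (p (j - 1))) (\<lambda>w. w \<in> W11 \<Omega> \<Gamma>) w
                   \<longrightarrow> (AE x in lebesgue_on \<Omega>. w x = u j x)"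
    and integral: "\<forall>j\<ge>1. \<exists>w\<in>W11 \<Omega> \<Gamma>.
                     AE z in lebesgue_on (\<Omega> \<times> UNIV). v j z = subgraph_indicator w z"
    and "k \<ge> 1"
    and compatible: "AE t in lebesgue_on \<Gamma>. AE x in lebesgue_on \<Omega>. q (k - 1) (x, t) = p (k - 1) x"
  shows "AE z in lebesgue_on (\<Omega> \<times> UNIV). v k z = subgraph_indicator (u k) z"
proof -
  have u_min: "is_arg_min (bregman_energy \<Omega> \<rho> (p (k - 1))) (\<lambda>w. w \<in> W11 \<Omega> \<Gamma>) (u k)"
    using original \<open>k \<ge> 1\<close> by (simp add: bregman_iteration_def)
  have v_min: "is_arg_min (lifted_energy \<Omega> \<Gamma> \<rho> (q (k - 1))) (\<lambda>w. w \<in> relaxed_set \<Omega> \<Gamma>) (v k)"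
    using lifted \<open>k \<ge> 1\<close> by (simp add: lifted_bregman_iteration_def)
  \<comment> \<open>For \<open>k = 1\<close> the subgradient is the zero function fixed by the
    iteration; otherwise it belongs to a subdifferential, which contains square integrable functions
    only.\<close>
  have p: "p (k - 1) \<in> L2_space (lebesgue_on \<Omega>)"
    using original by (cases "k - 1") (auto simp: bregman_iteration_def subdifferential_def L2_space_def)
  have q: "q (k - 1) \<in> L2_space (lebesgue_on (\<Omega> \<times> \<Gamma>))"
    using lifted by (cases "k - 1") (auto simp: lifted_bregman_iteration_def subdifferential_def L2_space_def)
  have ne: "\<Omega> \<times> \<Gamma> \<noteq> {}" using rho_proper by blast
  have p_meas: "p (k - 1) \<in> borel_measurable (lebesgue_on \<Omega>)" using p by (simp add: L2_space_def)
  have W11_meas: "f \<in> borel_measurable (lebesgue_on \<Omega>)" if "f \<in> W11 \<Omega> \<Gamma>" for f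
    using that by (auto simp: W11_def)
  define E where "E = bregman_energy \<Omega> \<rho> (p (k - 1))"
  define L where "L = lifted_energy \<Omega> \<Gamma> \<rho> (q (k - 1))"
  define c where "c = Inf \<Gamma> * (LINT x|lebesgue_on \<Omega>. p (k - 1) x)"
  obtain w where w: "w \<in> W11 \<Omega> \<Gamma>" and vw: "AE z in lebesgue_on (\<Omega> \<times> UNIV). v k z = subgraph_indicator w z"
    using integral \<open>k \<ge> 1\<close> by blast
  have u: "u k \<in> W11 \<Omega> \<Gamma>" using u_min by (simp add: is_arg_min_def)
  have v: "v k \<in> borel_measurable (lebesgue_on (\<Omega> \<times> UNIV))"
    using v_min by (simp add: is_arg_min_def relaxed_set_def BV_loc_def)
  \<comment> \<open>The energies and the subgraph relation depend on \<open>w\<close> and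
    \<open>u k\<close> only up to null sets, so both are replaced by Borel representatives.\<close>
  obtain w' gw where w': "sobolev_function \<Omega> w' gw" "AE x in lebesgue_on \<Omega>. w' x = w x"
    "AE x in lebesgue_on \<Omega>. w' x \<in> \<Gamma>"
    by (rule W11_representative[OF \<open>open \<Omega>\<close> \<open>bounded \<Omega>\<close> w])
  obtain u' gu where u': "sobolev_function \<Omega> u' gu" "AE x in lebesgue_on \<Omega>. u' x = u k x"
    "AE x in lebesgue_on \<Omega>. u' x \<in> \<Gamma>"
    by (rule W11_representative[OF \<open>open \<Omega>\<close> \<open>bounded \<Omega>\<close> u])
  interpret w': sobolev_function \<Omega> w' gw by (rule w'(1))
  interpret u': sobolev_function \<Omega> u' gu by (rule u'(1))
  have vw': "AE z in lebesgue_on (\<Omega> \<times> UNIV). v k z = subgraph_indicator w' z"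
    using vw AE_subgraph_indicator_cong[OF \<open>open \<Omega>\<close> w'(2)] by eventually_elim simp
  have "L (v k) = bregman_energy \<Omega> \<rho> (p (k - 1)) w' + ereal c"
    unfolding L_def c_def
    by (rule w'.lifted_energy_subgraph[OF v vw' assms(3,4) w'(3) rho_nonneg rho_lsc ne p q compatible])
  also have "bregman_energy \<Omega> \<rho> (p (k - 1)) w' = E w"
    unfolding E_def
    by (rule bregman_energy_cong[OF w'.measurable_lebesgue_on_dom[OF w'.fun_measurable] W11_meas[OF w] w'(2) p_meas])
  finally have Lv: "L (v k) = E w + ereal c" .
  have "L (subgraph_indicator u') = bregman_energy \<Omega> \<rho> (p (k - 1)) u' + ereal c"
    unfolding L_def c_def
    by (rule u'.lifted_energy_subgraph[OF u'.subgraph_measurable_dom _ assms(3,4) u'(3) rho_nonneg rho_lsc ne p q compatible])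
      simp
  also have "bregman_energy \<Omega> \<rho> (p (k - 1)) u' = E (u k)"
    unfolding E_def
    by (rule bregman_energy_cong[OF u'.measurable_lebesgue_on_dom[OF u'.fun_measurable] W11_meas[OF u] u'(2) p_meas])
  finally have Lu: "L (subgraph_indicator u') = E (u k) + ereal c" .
  have "\<not> L (subgraph_indicator u') < L (v k)"
    using v_min u'.subgraph_in_relaxed_set[OF assms(3) u'(3)] unfolding L_def is_arg_min_def by blast
  \<comment> \<open>The constant \<open>c\<close> is real, so it cancels even if the energies are
    infinite.\<close>
  then have "E w \<le> E (u k)"
    unfolding Lv Lu by (simp add: not_less ereal_add_le_add_iff2)
  moreover have "\<not> E y < E (u k)" if "y \<in> W11 \<Omega> \<Gamma>" for y
    using u_min that by (simp add: E_def is_arg_min_def)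
  \<comment> \<open>\<open>E w\<close> does not exceed the minimal value \<open>E (u k)\<close>, so
    \<open>w\<close> is itself a minimiser and uniqueness applies to it.\<close>
  ultimately have "is_arg_min E (\<lambda>w. w \<in> W11 \<Omega> \<Gamma>) w"
    using w by (auto simp: is_arg_min_def dest: less_le_trans)
  then have "AE x in lebesgue_on \<Omega>. w x = u k x"
    using unique \<open>k \<ge> 1\<close> by (simp add: E_def)
  from AE_subgraph_indicator_cong[OF \<open>open \<Omega>\<close> this] vw show ?thesis
    by eventually_elim simp
qed

end
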